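(* Let $N$ be a positive integer. (1) Suppose that $N$ is composite or $N \in \{2,3,5,7,13\}$. Let $k$ be a non-negative even integer and suppose that either $\epsilon_3(\Gamma_0(N)) = 0$ or $6 \mid k$, and that either $\epsilon_2(\Gamma_0(N)) = 0$ or $4 \mid k$. Then $\mathcal{E}_k(\Gamma_0(N))$ has finite codimension in $\mathcal{R}_k(\Gamma_0(N))$. (2) If $N$ is prime and $N = 11$ or $N \geq 17$, then $\mathcal{E}_k(\Gamma_0(N))$ has infinite codimension in $\mathcal{R}_k(\Gamma_0(N))$ for all non-negative even integers $k$.
   Context: $\eta(z) = q^{1/24}\prod_{n\ge 1}(1-q^n)$, $q = e^{2\pi i z}$, for $z$ in the upper half plane $\mathbb{H}$. An eta-quotient of level $N$ is a function $\prod_{\delta \mid N}\eta(\delta z)^{r_\delta}$ with $r_\delta \in \mathbb{Z}$. A weakly holomorphic modular form of weight $k$ for $\Gamma_0(N)$ obeys the weight $k$ transformation law for $\Gamma_0(N)$, is holomorphic on $\mathbb{H}$ and meromorphic at the cusps. $\mathcal{R}_k(\Gamma_0(N))$ is the complex vector space of weakly holomorphic modular forms of weight $k$ for $\Gamma_0(N)$ that are holomorphic at every cusp other than $\infty$ (a pole at $\infty$ is allowed but not required). $\mathcal{E}_k(\Gamma_0(N))$ is the subspace of $\mathcal{R}_k(\Gamma_0(N))$ spanned by the eta-quotients of level $N$ that lie in $\mathcal{R}_k(\Gamma_0(N))$. An elliptic point of $\Gamma_0(N)$ is a $z\in\mathbb{H}$ fixed by some $M\in\Gamma_0(N)$, $M\neq\pm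 I$; its order ($2$ or $3$) is the order of $M$ in $\mathrm{PSL}_2(\mathbb{Z})$. $\epsilon_2(\Gamma_0(N))$ and $\epsilon_3(\Gamma_0(N))$ are the numbers of $\Gamma_0(N)$-orbits of elliptic points of order $2$ and $3$. *)

theory Defs
  imports
    "HOL-Complex_Analysis.Complex_Analysis"
    "HOL-Computational_Algebra.Primes"
    "HOL-Library.Function_Algebras"
    "HOL-Library.Set_Algebras"
begin

section \<open>The group \<open>\<Gamma>\<^sub>0(N)\<close> and its actions\<close>

definition uhp :: "complex set" where
  "uhp = {z. Im z > 0}"

definition SL2Z :: "(int^2^2) set" where
  "SL2Z = {M. det M = 1}"

definition Gamma0 :: "nat \<Rightarrow> (int^2^2) set" where
  "Gamma0 N = {M \<in> SL2Z. int N dvd M $ 2 $ 1}"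

definition moebius_act :: "int^2^2 \<Rightarrow> complex \<Rightarrow> complex" where
  "moebius_act M z = (of_int (M $ 1 $ 1) * z + of_int (M $ 1 $ 2)) /
                 (of_int (M $ 2 $ 1) * z + of_int (M $ 2 $ 2))"

definition automorphy :: "int^2^2 \<Rightarrow> complex \<Rightarrow> complex" where
  "automorphy M z = of_int (M $ 2 $ 1) * z + of_int (M $ 2 $ 2)"

definition slash :: "int \<Rightarrow> (complex \<Rightarrow> complex) \<Rightarrow> int^2^2 \<Rightarrow> complex \<Rightarrow> complex" where
  "slash k f M z = automorphy M z powi (- k) * f (moebius_act M z)"

text \<open>
  Cusps are points of the projective line over the rationals, with \<^const>\<open>None\<close> in the role
  of \<open>\<infinity>\<close>. Every cusp is \<open>M \<infinity>\<close> for some \<open>M\<close> in \<open>SL\<^sub>2(\<int>)\<close>.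
\<close>

definition moebius_infinity :: "int^2^2 \<Rightarrow> rat option" where
  "moebius_infinity M =
     (if M $ 2 $ 1 = 0 then None else Some (of_int (M $ 1 $ 1) / of_int (M $ 2 $ 1)))"

definition cusp_infinity :: "nat \<Rightarrow> (rat option) set" where
  "cusp_infinity N = moebius_infinity ` Gamma0 N"


section \<open>Elliptic points\<close>

text \<open>
  The product on \<^typ>\<open>int^2^2\<close> inherited from the entries is componentwise, so powers are
  written as iterates of the matrix product.
\<close>

definition has_PSL2_order :: "int^2^2 \<Rightarrow> nat \<Rightarrow> bool" where
  "has_PSL2_order M n \<longleftrightarrow>
     0 < n \<and> (((**) M) ^^ n) (mat 1) \<in> {mat 1, - mat 1} \<and>
     (\<forall>m. 0 < m \<and> m < n \<longrightarrow> (((**) M) ^^ m) (mat 1) \<notin> {mat 1, - mat 1})"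

definition elliptic_points :: "nat \<Rightarrow> nat \<Rightarrow> complex set" where
  "elliptic_points n N =
     {z \<in> uhp. \<exists>M \<in> Gamma0 N. M \<noteq> mat 1 \<and> M \<noteq> - mat 1 \<and> moebius_act M z = z \<and> has_PSL2_order M n}"

definition Gamma0_orbit :: "nat \<Rightarrow> complex \<Rightarrow> complex set" where
  "Gamma0_orbit N z = (\<lambda>M. moebius_act M z) ` Gamma0 N"

text \<open>The set of orbits counted here is finite for every \<open>N > 0\<close>.\<close>

definition elliptic_number :: "nat \<Rightarrow> nat \<Rightarrow> nat" where
  "elliptic_number n N = card (Gamma0_orbit N ` elliptic_points n N)"

abbreviation epsilon2 :: "nat \<Rightarrow> nat" where
  "epsilon2 \<equiv> elliptic_number 2"

abbreviation epsilon3 :: "nat \<Rightarrow> nat" where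
  "epsilon3 \<equiv> elliptic_number 3"


section \<open>Behaviour at the cusps\<close>

text \<open>
  If \<open>f\<close> obeys the transformation law for \<open>\<Gamma>\<^sub>0(N)\<close>, then \<open>f\<close> slashed with an
  element of \<open>SL\<^sub>2(\<int>)\<close> has period \<open>N\<close>, as \<open>\<Gamma>\<^sub>0(N)\<close> contains the principal congruence
  subgroup \<open>\<Gamma>(N)\<close>, which is normal. It is therefore a function \<open>F\<close> of \<open>exp (2 \<pi> \<i> z / N)\<close>,
  and one asks how \<open>F\<close> behaves at \<open>0\<close>.
\<close>

definition meromorphic_at_ii_infinity :: "nat \<Rightarrow> (complex \<Rightarrow> complex) \<Rightarrow> bool" where
  "meromorphic_at_ii_infinity N g \<longleftrightarrow>
     (\<exists>F y. F meromorphic_on {0} \<and>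
        (\<forall>z. Im z > y \<longrightarrow> g z = F (exp (2 * of_real pi * \<i> * z / of_nat N))))"

definition holomorphic_at_ii_infinity :: "nat \<Rightarrow> (complex \<Rightarrow> complex) \<Rightarrow> bool" where
  "holomorphic_at_ii_infinity N g \<longleftrightarrow>
     (\<exists>F y. F analytic_on {0} \<and>
        (\<forall>z. Im z > y \<longrightarrow> g z = F (exp (2 * of_real pi * \<i> * z / of_nat N))))"

definition meromorphic_at_cusp :: "int \<Rightarrow> nat \<Rightarrow> (complex \<Rightarrow> complex) \<Rightarrow> rat option \<Rightarrow> bool" where
  "meromorphic_at_cusp k N f s \<longleftrightarrow>
     (\<forall>M \<in> SL2Z. moebius_infinity M = s \<longrightarrow> meromorphic_at_ii_infinity N (slash k f M))"

definition holomorphic_at_cusp :: "int \<Rightarrow> nat \<Rightarrow> (complex \<Rightarrow> complex) \<Rightarrow> rat option \<Rightarrow> bool" where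
  "holomorphic_at_cusp k N f s \<longleftrightarrow>
     (\<forall>M \<in> SL2Z. moebius_infinity M = s \<longrightarrow> holomorphic_at_ii_infinity N (slash k f M))"


section \<open>Weakly holomorphic modular forms\<close>

text \<open>
  A function on the upper half plane is represented by its extension by \<open>0\<close> to all of
  \<^typ>\<open>complex\<close>, so that equality of representatives is equality on the upper half plane.
\<close>

definition weakly_holomorphic_forms :: "int \<Rightarrow> nat \<Rightarrow> (complex \<Rightarrow> complex) set" where
  "weakly_holomorphic_forms k N =
     {f. (\<forall>z. z \<notin> uhp \<longrightarrow> f z = 0) \<and>
         f holomorphic_on uhp \<and>
         (\<forall>M \<in> Gamma0 N. \<forall>z \<in> uhp. f (moebius_act M z) = automorphy M z powi k * f z) \<and>
         (\<forall>s. meromorphic_at_cusp k N f s)}"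

definition R_space :: "int \<Rightarrow> nat \<Rightarrow> (complex \<Rightarrow> complex) set" where
  "R_space k N =
     {f \<in> weakly_holomorphic_forms k N. \<forall>s. s \<notin> cusp_infinity N \<longrightarrow> holomorphic_at_cusp k N f s}"


section \<open>Eta-quotients\<close>

text \<open>The factor \<open>q\<^sup>1\<^sup>/\<^sup>2\<^sup>4\<close> stands for \<open>exp (2 \<pi> \<i> z / 24)\<close>.\<close>

definition dedekind_eta :: "complex \<Rightarrow> complex" where
  "dedekind_eta z = exp (2 * of_real pi * \<i> * z / 24) *
     prodinf (\<lambda>n. 1 - exp (2 * of_real pi * \<i> * z) ^ Suc n)"

definition eta_quotient :: "nat \<Rightarrow> (nat \<Rightarrow> int) \<Rightarrow> complex \<Rightarrow> complex" where
  "eta_quotient N r z =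
     (if z \<in> uhp then \<Prod>\<delta> | \<delta> dvd N. dedekind_eta (of_nat \<delta> * z) powi r \<delta> else 0)"

definition fun_scale :: "complex \<Rightarrow> (complex \<Rightarrow> complex) \<Rightarrow> complex \<Rightarrow> complex" where
  "fun_scale c f = (\<lambda>z. c * f z)"

lemma fun_scale_apply: "fun_scale c f z = c * f z"
  by (simp add: fun_scale_def)

interpretation fun_space: vector_space fun_scale
  by unfold_locales (auto simp: fun_scale_def algebra_simps)

definition E_space :: "int \<Rightarrow> nat \<Rightarrow> (complex \<Rightarrow> complex) set" where
  "E_space k N = fun_space.span (range (eta_quotient N) \<inter> R_space k N)"

lemma slash_add: "slash k (f + g) M = slash k f M + slash k g M"
  by (auto simp: slash_def fun_eq_iff algebra_simps)

lemma slash_fun_scale: "slash k (fun_scale c f) M = fun_scale c (slash k f M)"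
  by (auto simp: slash_def fun_scale_def fun_eq_iff)

lemma slash_zero: "slash k 0 M = 0"
  by (auto simp: slash_def fun_eq_iff)

lemma meromorphic_at_ii_infinity_add:
  assumes "meromorphic_at_ii_infinity N f" "meromorphic_at_ii_infinity N g"
  shows "meromorphic_at_ii_infinity N (f + g)"
proof -
  let ?e = "\<lambda>z. exp (2 * of_real pi * \<i> * z / of_nat N)"
  obtain F y where F: "F meromorphic_on {0}" "\<And>z. Im z > y \<Longrightarrow> f z = F (?e z)"
    using assms(1) unfolding meromorphic_at_ii_infinity_def by blast
  obtain G x where G: "G meromorphic_on {0}" "\<And>z. Im z > x \<Longrightarrow> g z = G (?e z)"
    using assms(2) unfolding meromorphic_at_ii_infinity_def by blast
  have "(\<lambda>w. F w + G w) meromorphic_on {0}"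
    using F(1) G(1) by (rule meromorphic_on_add)
  moreover have "\<forall>z. Im z > max x y \<longrightarrow> (f + g) z = F (?e z) + G (?e z)"
    using F(2) G(2) by simp
  ultimately show ?thesis
    unfolding meromorphic_at_ii_infinity_def by (intro exI[of _ "\<lambda>w. F w + G w"] exI[of _ "max x y"]) simp
qed

lemma holomorphic_at_ii_infinity_add:
  assumes "holomorphic_at_ii_infinity N f" "holomorphic_at_ii_infinity N g"
  shows "holomorphic_at_ii_infinity N (f + g)"
proof -
  let ?e = "\<lambda>z. exp (2 * of_real pi * \<i> * z / of_nat N)"
  obtain F y where F: "F analytic_on {0}" "\<And>z. Im z > y \<Longrightarrow> f z = F (?e z)"
    using assms(1) unfolding holomorphic_at_ii_infinity_def by blast
  obtain G x where G: "G analytic_on {0}" "\<And>z. Im z > x \<Longrightarrow> g z = G (?e z)"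
    using assms(2) unfolding holomorphic_at_ii_infinity_def by blast
  have "(\<lambda>w. F w + G w) analytic_on {0}"
    using F(1) G(1) by (rule analytic_on_add)
  moreover have "\<forall>z. Im z > max x y \<longrightarrow> (f + g) z = F (?e z) + G (?e z)"
    using F(2) G(2) by simp
  ultimately show ?thesis
    unfolding holomorphic_at_ii_infinity_def by (intro exI[of _ "\<lambda>w. F w + G w"] exI[of _ "max x y"]) simp
qed

lemma meromorphic_at_ii_infinity_fun_scale:
  assumes "meromorphic_at_ii_infinity N f"
  shows "meromorphic_at_ii_infinity N (fun_scale c f)"
proof -
  let ?e = "\<lambda>z. exp (2 * of_real pi * \<i> * z / of_nat N)"
  obtain F y where F: "F meromorphic_on {0}" "\<And>z. Im z > y \<Longrightarrow> f z = F (?e z)"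
    using assms unfolding meromorphic_at_ii_infinity_def by blast
  have "(\<lambda>w. c * F w) meromorphic_on {0}"
    using F(1) by (intro meromorphic_intros)
  moreover have "\<forall>z. Im z > y \<longrightarrow> fun_scale c f z = c * F (?e z)"
    using F(2) by (simp add: fun_scale_def)
  ultimately show ?thesis
    unfolding meromorphic_at_ii_infinity_def by (intro exI[of _ "\<lambda>w. c * F w"] exI[of _ y]) simp
qed

lemma holomorphic_at_ii_infinity_fun_scale:
  assumes "holomorphic_at_ii_infinity N f"
  shows "holomorphic_at_ii_infinity N (fun_scale c f)"
proof -
  let ?e = "\<lambda>z. exp (2 * of_real pi * \<i> * z / of_nat N)"
  obtain F y where F: "F analytic_on {0}" "\<And>z. Im z > y \<Longrightarrow> f z = F (?e z)"
    using assms unfolding holomorphic_at_ii_infinity_def by blast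
  have "(\<lambda>w. c * F w) analytic_on {0}"
    using F(1) by (intro analytic_intros)
  moreover have "\<forall>z. Im z > y \<longrightarrow> fun_scale c f z = c * F (?e z)"
    using F(2) by (simp add: fun_scale_def)
  ultimately show ?thesis
    unfolding holomorphic_at_ii_infinity_def by (intro exI[of _ "\<lambda>w. c * F w"] exI[of _ y]) simp
qed

lemma ii_infinity_zero:
  "meromorphic_at_ii_infinity N 0" "holomorphic_at_ii_infinity N 0"
  unfolding meromorphic_at_ii_infinity_def holomorphic_at_ii_infinity_def
  by (intro exI[of _ "\<lambda>_. 0"], simp add: zero_fun_def meromorphic_on_const)+

lemma subspace_weakly_holomorphic_forms: "fun_space.subspace (weakly_holomorphic_forms k N)"
proof (rule fun_space.subspaceI)
  show "0 \<in> weakly_holomorphic_forms k N"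
    by (auto simp: weakly_holomorphic_forms_def meromorphic_at_cusp_def slash_zero ii_infinity_zero zero_fun_def[symmetric] holomorphic_on_def)
       (auto simp: zero_fun_def field_differentiable_const)
next
  fix f g assume "f \<in> weakly_holomorphic_forms k N" "g \<in> weakly_holomorphic_forms k N"
  then show "f + g \<in> weakly_holomorphic_forms k N"
    unfolding weakly_holomorphic_forms_def meromorphic_at_cusp_def
    using holomorphic_on_add[of f uhp g]
    by (auto simp: slash_add algebra_simps plus_fun_def[of f g, symmetric]
             intro: meromorphic_at_ii_infinity_add)
next
  fix c f assume "f \<in> weakly_holomorphic_forms k N"
  then show "fun_scale c f \<in> weakly_holomorphic_forms k N"
    unfolding weakly_holomorphic_forms_def meromorphic_at_cusp_def
    using holomorphic_on_mult[of "\<lambda>_. c" uhp f]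
    by (auto simp: slash_fun_scale fun_scale_apply algebra_simps fun_scale_def[of c f, symmetric]
             intro: meromorphic_at_ii_infinity_fun_scale)
qed

lemma subspace_R_space: "fun_space.subspace (R_space k N)"
  using subspace_weakly_holomorphic_forms[of k N]
  by (auto simp: fun_space.subspace_def R_space_def holomorphic_at_cusp_def slash_zero slash_add
      slash_fun_scale ii_infinity_zero
      intro: holomorphic_at_ii_infinity_add holomorphic_at_ii_infinity_fun_scale)

lemma E_space_subset_R_space: "E_space k N \<subseteq> R_space k N"
  unfolding E_space_def by (rule fun_space.span_minimal) (auto simp: subspace_R_space)


section \<open>Codimension\<close>

text \<open>
  The elements of the quotient space are the cosets \<open>f +o U\<close> with \<open>f \<in> V\<close>; a linear combination
  of cosets is the coset of the linear combination of representatives. The quotient is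
  finite-dimensional if it is spanned by the cosets of a finite set \<open>B\<close>.
\<close>

definition quotient_space ::
    "(complex \<Rightarrow> complex) set \<Rightarrow> (complex \<Rightarrow> complex) set \<Rightarrow> (complex \<Rightarrow> complex) set set" where
  "quotient_space V U = (\<lambda>f. f +o U) ` V"

definition finite_codimension_in ::
    "(complex \<Rightarrow> complex) set \<Rightarrow> (complex \<Rightarrow> complex) set \<Rightarrow> bool" where
  "finite_codimension_in U V \<longleftrightarrow>
     (\<exists>B. finite B \<and> B \<subseteq> V \<and> quotient_space V U = (\<lambda>f. f +o U) ` fun_space.span B)"

end

theory Submission
  imports Defs
    "HOL-Number_Theory.Number_Theory"
    "HOL-Real_Asymp.Real_Asymp"
begin

text \<open>
  Write \<open>q = exp (2 \<pi> \<i> z)\<close>. A nonzero element of \<open>R_space k N\<close> has an order at \<open>\<infinity>\<close>, the exponent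
  of its leading term in \<open>q\<close>, and everything is decided by the orders that occur. Orders in
  \<open>R_space k N\<close> are bounded above (\<open>R_space_order_bound\<close>). If \<open>E_space k N\<close> contains elements of
  all sufficiently negative orders, leading terms can be removed one after the other and the
  codimension is finite (\<open>finite_codimension_of_orders\<close>). If infinitely many orders occur in
  \<open>R_space k N\<close> but not in \<open>E_space k N\<close>, it is infinite (\<open>infinite_codimension_of_orders\<close>).

  All eta-quotients that are constructed have even exponents, so they are products of \<open>\<eta>(\<delta> z)\<^sup>2\<close>.
  The multiplier of \<open>\<eta>\<^sup>2\<close> is a twelfth root of unity, and its exponent is an integer polynomial in
  the entries of the matrix (\<open>eta2_transformation\<close>); this rests on \<open>\<eta>(-1/z)\<^sup>2 = -\<i> z \<eta>(z)\<^sup>2\<close>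
  (\<open>dedekind_eta_inversion\<close>). Membership in \<open>R_space k N\<close> becomes a congruence modulo \<open>12\<close> and an
  inequality for each cusp (\<open>eta_quotient_in_R_space\<close>).

  For finite codimension, one eta-quotient of weight \<open>k\<close> is multiplied with elements of \<open>E_space 0
  N\<close>, which form a ring. For every \<open>N\<close> there is an eta-quotient of positive weight with all its
  zeros at \<open>\<infinity>\<close> (\<open>inf_vec\<close>). Dividing powers of \<open>\<eta>(\<delta> z)\<close> by it gives, for each divisor \<open>\<delta>\<close> of \<open>N\<close>,
  a function of weight \<open>0\<close> with a pole at \<open>\<infinity>\<close> only. If \<open>N\<close> is composite, two of them, with pole
  orders \<open>m\<close> and \<open>m'\<close>, have expansions so different that \<open>u\<^bsup>m'\<^esup> - v\<^bsup>m\<^esup>\<close> has a pole of order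
  exactly \<open>m m' - 1\<close>, and then all large pole orders occur (\<open>composite_all_orders\<close>). For the
  primes \<open>p\<close> with \<open>p - 1\<close> dividing \<open>12\<close>, the function \<open>(\<eta>(z) / \<eta>(p z))\<^bsup>24 / (p - 1)\<^esup>\<close> has a simple
  pole (\<open>genus_zero_all_orders\<close>). The hypotheses on elliptic points enter through the weight: if
  there are none of order \<open>2\<close>, then \<open>4\<close> or a prime that is \<open>3\<close> modulo \<open>4\<close> divides \<open>N\<close>, and this
  yields trivial multipliers in weight \<open>6\<close>; order \<open>3\<close> is related to weight \<open>4\<close> in the same way,
  and weight \<open>12\<close> is always available (\<open>weight_vector\<close>).

  For infinite codimension, an eta-quotient of prime level \<open>p\<close> has only two exponents, so weight
  \<open>k\<close> and order \<open>n\<close> determine it, and integrality forces \<open>p - 1\<close> to divide \<open>24 n - 2 k\<close>. The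
  orders in the span are subject to the same condition (\<open>prime_level_E_space_order\<close>). The
  logarithmic derivative of \<open>\<Delta>(z) / \<Delta>(p z)\<close>, with \<open>\<Delta> = \<eta>\<^bsup>24\<^esup>\<close>, has weight \<open>2\<close> and order \<open>0\<close>.
  Products of its powers with eta-quotients give elements of \<open>R_space k p\<close> of infinitely many
  orders that violate the condition, unless \<open>p - 1\<close> divides \<open>24\<close> (\<open>infinite_codimension\<close>).
\<close>

section \<open>The Euler product and the eta function\<close>

definition euler_prod :: "complex \<Rightarrow> complex" where
  "euler_prod w = (\<Prod>n. 1 - w ^ Suc n)"

definition nome :: "complex \<Rightarrow> complex" where
  "nome z = exp (2 * of_real pi * \<i> * z)"

lemma abs_convergent_euler_prod:
  fixes w :: complex
  assumes "norm w < 1"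
  shows "abs_convergent_prod (\<lambda>n. 1 - w ^ Suc n)"
proof (rule summable_imp_abs_convergent_prod)
  have "summable (\<lambda>n. norm w ^ Suc n)"
    using assms by (simp only: summable_Suc_iff) (auto intro!: summable_geometric)
  thus "summable (\<lambda>n. norm (1 - w ^ Suc n - 1))"
    by (simp add: norm_mult norm_power)
qed

lemma euler_prod_nonzero:
  assumes "norm w < 1"
  shows "euler_prod w \<noteq> 0"
  unfolding euler_prod_def
proof (rule prodinf_nonzero)
  show "convergent_prod (\<lambda>n. 1 - w ^ Suc n)"
    using abs_convergent_euler_prod[OF assms] abs_convergent_prod_imp_convergent_prod by blast
  show "1 - w ^ Suc n \<noteq> 0" for n
  proof
    assume "1 - w ^ Suc n = 0"
    hence "w ^ Suc n = 1" by simp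
    hence "norm w ^ Suc n = 1" by (metis norm_one norm_power)
    thus False
      using assms power_Suc_less_one[of "norm w" n] norm_ge_zero[of w]
      by (cases "norm w = 0") auto
  qed
qed

lemma euler_prod_LIMSEQ:
  assumes "norm w < 1"
  shows "(\<lambda>n. \<Prod>k<n. 1 - w ^ Suc k) \<longlonglongrightarrow> euler_prod w"
  using abs_convergent_euler_prod[OF assms] abs_convergent_prod_imp_convergent_prod
    convergent_prod_LIMSEQ[of "\<lambda>n. 1 - w ^ Suc n"]
  unfolding euler_prod_def LIMSEQ_lessThan_iff_atMost by blast

text \<open>
  The partial products are compared with the geometric series in \<open>r\<close>; the limit is uniform on
  closed discs, which makes the Euler product holomorphic.
\<close>

lemma uniform_limit_euler_prod:
  assumes "r < 1"
  shows "uniform_limit (cball 0 r) (\<lambda>n w. \<Prod>k<n. 1 - w ^ Suc k) euler_prod sequentially"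
proof (cases "r < 0")
  case False
  have "uniformly_convergent_on (cball 0 r) (\<lambda>N w::complex. \<Sum>n<N. norm (- (w ^ Suc n)))"
  proof (rule Weierstrass_m_test')
    show "norm (norm (- (w ^ Suc n))) \<le> r ^ Suc n" if "w \<in> cball 0 r" for n and w :: complex
      using that power_mono[of "norm w" r "Suc n"] by (simp add: norm_power norm_mult)
    show "summable (\<lambda>n. r ^ Suc n)"
      using assms False by (simp only: summable_Suc_iff) (auto intro!: summable_geometric)
  qed
  hence "uniformly_convergent_on (cball 0 r) (\<lambda>N w::complex. \<Prod>n<N. 1 + - (w ^ Suc n))"
    by (intro uniformly_convergent_on_prod) (auto intro!: continuous_intros)
  then obtain g where g: "uniform_limit (cball 0 r) (\<lambda>n w::complex. \<Prod>k<n. 1 - w ^ Suc k) g sequentially"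
    by (auto simp: uniformly_convergent_on_def)
  have "euler_prod w = g w" if "w \<in> cball 0 r" for w
    using tendsto_uniform_limitI[OF g that] euler_prod_LIMSEQ[of w] that assms LIMSEQ_unique by fastforce
  thus ?thesis using g by (metis (no_types, lifting) uniform_limit_cong')
qed auto

lemma holomorphic_euler_prod: "euler_prod holomorphic_on ball 0 1"
proof (rule holomorphic_uniform_sequence[of _ "\<lambda>n w. \<Prod>k<n. 1 - w ^ Suc k"])
  fix x :: complex assume x: "x \<in> ball 0 1"
  define d where "d = (1 - norm x) / 2"
  have d: "d > 0" "norm x + d < 1" using x by (auto simp: d_def field_simps)
  have sub: "cball x d \<subseteq> cball 0 (norm x + d)"
  proof
    fix y assume "y \<in> cball x d"
    thus "y \<in> cball 0 (norm x + d)" using norm_triangle_ineq3[of y x]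
      by (auto simp: dist_norm norm_minus_commute)
  qed
  show "\<exists>d>0. cball x d \<subseteq> ball 0 1 \<and> uniform_limit (cball x d) (\<lambda>n w. \<Prod>k<n. 1 - w ^ Suc k) euler_prod sequentially"
    using d sub uniform_limit_on_subset[OF uniform_limit_euler_prod[OF d(2)] sub] by force
qed (auto intro!: holomorphic_intros)

lemma euler_prod_0 [simp]: "euler_prod 0 = 1"
  by (simp add: euler_prod_def)

text \<open>
  Every factor but the first has vanishing derivative at \<open>0\<close>. The value is the coefficient of \<open>q\<close>
  in the Euler product, the only coefficient beyond the constant one that the comparison of two
  eta-quotients with a pole at \<open>\<infinity>\<close> needs.
\<close>

lemma euler_prod_deriv_0: "(euler_prod has_field_derivative -1) (at 0)"
proof -
  have D: "((\<lambda>w::complex. \<Prod>k<Suc n. 1 - w ^ Suc k) has_field_derivative -1) (at 0)" for n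
  proof (induction n)
    case 0
    show ?case by (auto intro!: derivative_eq_intros)
  next
    case (Suc n)
    have "((\<lambda>w::complex. (\<Prod>k<Suc n. 1 - w ^ Suc k) * (1 - w ^ Suc (Suc n))) has_field_derivative -1) (at 0)"
      by (rule derivative_eq_intros Suc refl)+ auto
    thus ?case by simp
  qed
  have "(\<lambda>n. deriv (\<lambda>w::complex. \<Prod>k<n. 1 - w ^ Suc k) 0) \<longlonglongrightarrow> deriv euler_prod 0"
  proof (rule deriv_complex_uniform_limit[where A = "ball 0 (1/2)"])
    show "uniform_limit (ball 0 (1/2)) (\<lambda>n w. \<Prod>k<n. 1 - w ^ Suc k) euler_prod sequentially"
      by (rule uniform_limit_on_subset[OF uniform_limit_euler_prod[of "1/2"]]) auto
  qed (auto intro!: holomorphic_intros always_eventually)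
  hence "(\<lambda>n. deriv (\<lambda>w::complex. \<Prod>k<Suc n. 1 - w ^ Suc k) 0) \<longlonglongrightarrow> deriv euler_prod 0"
    by (rule LIMSEQ_Suc)
  hence "(\<lambda>n. -1) \<longlonglongrightarrow> deriv euler_prod 0"
    using DERIV_imp_deriv[OF D] by simp
  hence "deriv euler_prod 0 = -1" by (simp add: LIMSEQ_const_iff)
  moreover have "(euler_prod has_field_derivative deriv euler_prod 0) (at 0)"
    by (rule holomorphic_derivI[OF holomorphic_euler_prod]) auto
  ultimately show ?thesis by simp
qed

lemma open_uhp: "open uhp"
  unfolding uhp_def by (rule open_halfspace_Im_gt)

lemma connected_uhp: "connected uhp"
  unfolding uhp_def by (intro convex_connected convex_halfspace_Im_gt)

lemma norm_nome: "norm (nome z) = exp (- 2 * pi * Im z)"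
  by (simp add: nome_def norm_exp_eq_Re)

lemma norm_nome_less_1: "z \<in> uhp \<Longrightarrow> norm (nome z) < 1"
  by (simp add: norm_nome uhp_def)

lemma nome_add: "nome (z + w) = nome z * nome w"
  by (simp add: nome_def exp_add ring_distribs)

lemma nome_of_int [simp]: "nome (of_int n) = 1"
  unfolding nome_def by (auto simp: exp_eq_1)

lemma nome_of_nat_mult: "nome (of_nat n * z) = nome z ^ n"
  unfolding nome_def by (subst exp_of_nat_mult[symmetric]) (simp add: mult_ac)

lemma nome_powi: "nome z powi n = nome (of_int n * z)"
  unfolding nome_def by (subst exp_power_int) (simp add: mult_ac)

lemma nome_nonzero [simp]: "nome z \<noteq> 0"
  by (simp add: nome_def)

lemma nome_0 [simp]: "nome 0 = 1"
  by (simp add: nome_def)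

lemma holomorphic_nome [holomorphic_intros]: "f holomorphic_on A \<Longrightarrow> (\<lambda>z. nome (f z)) holomorphic_on A"
  unfolding nome_def by (intro holomorphic_intros)

lemma dedekind_eta_altdef: "dedekind_eta z = nome (z / 24) * euler_prod (nome z)"
  by (simp add: dedekind_eta_def euler_prod_def nome_def mult_ac)

lemma dedekind_eta_nonzero: "z \<in> uhp \<Longrightarrow> dedekind_eta z \<noteq> 0"
  by (simp add: dedekind_eta_altdef euler_prod_nonzero norm_nome_less_1)

lemma holomorphic_dedekind_eta: "dedekind_eta holomorphic_on uhp"
proof -
  have "(euler_prod \<circ> nome) holomorphic_on uhp"
    by (rule holomorphic_on_compose_gen[OF _ holomorphic_euler_prod])
       (auto simp: norm_nome_less_1 intro!: holomorphic_on_subset[OF holomorphic_nome[OF holomorphic_on_ident]])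
  thus ?thesis unfolding dedekind_eta_altdef [abs_def] o_def by (intro holomorphic_intros) auto
qed

lemma dedekind_eta_add_1: "dedekind_eta (z + 1) = nome (1 / 24) * dedekind_eta z"
  using nome_of_int[of 1] by (simp add: dedekind_eta_altdef nome_add add_divide_distrib)

section \<open>Inversion of the eta function\<close>

text \<open>
  The logarithmic derivative of Euler's reflection formula, on the imaginary axis.
\<close>

lemma Digamma_reflection_Suc:
  fixes x :: real
  assumes "x > 0"
  shows "Digamma (1 + \<i> * x) - Digamma (1 - \<i> * x) =
           - of_real pi * cot (of_real pi * (\<i> * x)) + 1 / (\<i> * x)"
proof -
  let ?z = "\<i> * of_real x"
  have nz: "?z \<notin> \<int>\<^sub>\<le>\<^sub>0" "1 - ?z \<notin> \<int>\<^sub>\<le>\<^sub>0" "?z \<noteq> 0"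
    using assms by (auto simp: complex_eq_iff elim!: nonpos_Ints_cases)
  have s: "sin (of_real pi * ?z) \<noteq> 0"
  proof
    assume "sin (of_real pi * ?z) = 0"
    then obtain n :: int where "of_real pi * ?z = of_real (of_int n * pi)"
      unfolding sin_eq_0 by auto
    hence "Im (of_real pi * ?z) = Im (complex_of_real (of_int n * pi))" by (rule arg_cong)
    thus False using assms by simp
  qed
  have g: "Gamma ?z \<noteq> 0" "Gamma (1 - ?z) \<noteq> 0"
    using nz by (auto simp: Gamma_eq_zero_iff)
  have "((\<lambda>z. Gamma z * Gamma (1 - z)) has_field_derivative
          Gamma ?z * Gamma (1 - ?z) * (Digamma ?z - Digamma (1 - ?z))) (at ?z)"
    using nz by (auto intro!: derivative_eq_intros simp: algebra_simps)
  moreover have "((\<lambda>z. of_real pi / sin (of_real pi * z)) has_field_derivative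
          (of_real pi / sin (of_real pi * ?z)) * (- of_real pi * cot (of_real pi * ?z))) (at ?z)"
    using s by (auto intro!: derivative_eq_intros simp: cot_def field_simps power2_eq_square)
  ultimately have "Gamma ?z * Gamma (1 - ?z) * (Digamma ?z - Digamma (1 - ?z)) =
      (of_real pi / sin (of_real pi * ?z)) * (- of_real pi * cot (of_real pi * ?z))"
    unfolding Gamma_reflection_complex by (rule DERIV_unique)
  hence "Digamma ?z - Digamma (1 - ?z) = - of_real pi * cot (of_real pi * ?z)"
    unfolding Gamma_reflection_complex by (subst (asm) mult_left_cancel) (use s in auto)
  moreover have "Digamma (1 + ?z) = Digamma ?z + 1 / ?z"
    using Digamma_plus1[of ?z] nz by (simp add: add.commute)
  ultimately show ?thesis by (simp add: algebra_simps)
qed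

lemma cot_ii:
  fixes x :: real
  assumes "x > 0"
  shows "cot (of_real pi * (\<i> * x)) = - \<i> * of_real (1 + 2 / (exp (2 * pi * x) - 1))"
proof -
  define E where "E = exp (pi * x)"
  have E: "E > 1" using assms by (simp add: E_def)
  have e: "exp (2 * pi * x) = E * E" by (simp add: E_def flip: exp_add)
  have c: "cos (of_real pi * (\<i> * x)) = of_real ((E + 1 / E) / 2)"
    by (simp add: cos_exp_eq E_def exp_minus field_simps flip: exp_of_real)
  have s: "sin (of_real pi * (\<i> * x)) = \<i> * of_real ((E - 1 / E) / 2)"
    by (simp add: sin_exp_eq E_def exp_minus field_simps flip: exp_of_real)
  have half: "(A / 2) / (B / 2) = A / B" for A B :: real by simp
  have "E * E > 1" using E less_1_mult by blast
  hence "(E + 1 / E) / (E - 1 / E) = 1 + 2 / (E * E - 1)"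
    using E by (simp add: field_simps)
  moreover have "((E + 1 / E) / 2) / ((E - 1 / E) / 2) = (E + 1 / E) / (E - 1 / E)" using half .
  ultimately have "((E + 1 / E) / 2) / ((E - 1 / E) / 2) = 1 + 2 / (E * E - 1)" by simp
  moreover have "complex_of_real C / (\<i> * of_real S) = - \<i> * of_real (C / S)" for C S :: real
    by (cases "S = 0") (auto simp: field_simps)
  ultimately show ?thesis unfolding cot_def c s e by metis
qed

text \<open>
  The right-hand side is \<open>\<pi> coth (\<pi> x) / 2 - 1 / (2 x)\<close>. The sum is the imaginary part of the
  series of the Digamma function at \<open>1 + \<i> x\<close>.
\<close>

lemma coth_partial_fractions:
  fixes x :: real
  assumes "x > 0"
  shows "(\<lambda>n. x / (x\<^sup>2 + (real n + 1)\<^sup>2)) sums (pi * (1 / (exp (2 * pi * x) - 1) + 1 / 2 - 1 / (2 * pi * x)))"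
proof -
  let ?z = "\<i> * of_real x"
  have nz: "1 + ?z \<noteq> 0" "1 - ?z \<noteq> 0" using assms by (auto simp: complex_eq_iff)
  have "(\<lambda>n. (inverse (of_nat (Suc n)) - inverse (1 + ?z + of_nat n)) -
             (inverse (of_nat (Suc n)) - inverse (1 - ?z + of_nat n))) sums
          ((Digamma (1 + ?z) + euler_mascheroni) - (Digamma (1 - ?z) + euler_mascheroni))"
    using summable_Digamma[OF nz(1)] summable_Digamma[OF nz(2)]
    by (intro sums_diff) (simp_all add: Digamma_def summable_sums)
  also have "((Digamma (1 + ?z) + euler_mascheroni) - (Digamma (1 - ?z) + euler_mascheroni)) =
      2 * \<i> * of_real (pi * (1 / (exp (2 * pi * x) - 1) + 1 / 2 - 1 / (2 * pi * x)))"
  proof -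
    define T where "T = exp (2 * pi * x) - 1"
    have T: "T > 0" using assms by (simp add: T_def)
    have "1 / ?z = - \<i> * of_real (1 / x)" using assms by (simp add: field_simps)
    hence "- of_real pi * cot (of_real pi * ?z) + 1 / ?z = \<i> * of_real (pi * (1 + 2 / T) - 1 / x)"
      unfolding cot_ii[OF assms] T_def by (simp add: algebra_simps)
    also have "pi * (1 + 2 / T) - 1 / x = 2 * (pi * (1 / T + 1 / 2 - 1 / (2 * pi * x)))"
      using T assms by (simp add: field_simps)
    finally show ?thesis using Digamma_reflection_Suc[OF assms] by (simp add: T_def)
  qed
  also have "(\<lambda>n. (inverse (of_nat (Suc n)) - inverse (1 + ?z + of_nat n)) -
             (inverse (of_nat (Suc n)) - inverse (1 - ?z + of_nat n))) =
             (\<lambda>n. 2 * \<i> * of_real (x / (x\<^sup>2 + (real n + 1)\<^sup>2)))"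
  proof
    fix n
    have 1: "1 + ?z + of_nat n \<noteq> 0" "1 - ?z + of_nat n \<noteq> 0" using assms by (auto simp: complex_eq_iff)
    have 2: "(1 + ?z + of_nat n) * (1 - ?z + of_nat n) = of_real (x\<^sup>2 + (real n + 1)\<^sup>2)"
      by (simp add: algebra_simps power2_eq_square)
    have "inverse (1 - ?z + of_nat n) - inverse (1 + ?z + of_nat n) = 
       2 * ?z / ((1 + ?z + of_nat n) * (1 - ?z + of_nat n))"
      using 1 by (simp add: field_simps)
    thus "(inverse (of_nat (Suc n)) - inverse (1 + ?z + of_nat n)) -
             (inverse (of_nat (Suc n)) - inverse (1 - ?z + of_nat n)) = 2 * \<i> * of_real (x / (x\<^sup>2 + (real n + 1)\<^sup>2))"
      unfolding 2 by simp
  qed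
  finally have "(\<lambda>n. complex_of_real (x / (x\<^sup>2 + (real n + 1)\<^sup>2))) sums 
     of_real (pi * (1 / (exp (2 * pi * x) - 1) + 1 / 2 - 1 / (2 * pi * x)))"
    by (subst (asm) sums_mult_iff) auto
  thus ?thesis by (simp only: sums_of_real_iff)
qed

text \<open>
  The summand is the value at \<open>n\<close> of the derivative of \<open>u \<mapsto> arctan (u K / (k L)) / k\<close> and it
  decreases in \<open>n\<close>. The increment \<open>arctan (k / K) / k\<close> of this function from \<open>L\<close> to \<open>\<infinity>\<close> lies
  between the tail and the tail increased by the summand at \<open>L\<close>.
\<close>

lemma arctan_tail_bound:
  fixes k K L :: nat
  assumes "k > 0" "K > 0" "L > 0"
  defines "b \<equiv> \<lambda>n. real L * real K / ((real k * real L)\<^sup>2 + (real n * real K)\<^sup>2)"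
  shows "summable (\<lambda>n. b (Suc (n + L)))"
    and "\<bar>(\<Sum>n. b (Suc (n + L))) - arctan (k / K) / k\<bar> \<le> 1 / (real L * real K)"
proof -
  define \<phi> where "\<phi> = (\<lambda>u::real. arctan (u * K / (real k * L)) / k)"
  have d: "(\<phi> has_real_derivative (L * K / ((real k * L)\<^sup>2 + (u * K)\<^sup>2))) (at u)" for u :: real
  proof -
    have p: "1 + (u * K / (real k * L))\<^sup>2 > 0" by (simp add: add_pos_nonneg)
    have q: "(real k * L)\<^sup>2 + (u * K)\<^sup>2 > 0" using assms by (simp add: add_pos_nonneg)
    have "(real k * L)\<^sup>2 * (1 + (u * K / (real k * L))\<^sup>2) = (real k * L)\<^sup>2 + (u * K)\<^sup>2"
      using assms by (simp add: field_simps power2_eq_square)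
    hence *: "inverse (1 + (u * K / (real k * L))\<^sup>2) * (K / (real k * L)) / k = L * K / ((real k * L)\<^sup>2 + (u * K)\<^sup>2)"
      using p q assms by (simp add: divide_simps power2_eq_square) (simp add: algebra_simps)?
    show ?thesis unfolding \<phi>_def *[symmetric] using assms
      by (auto intro!: derivative_eq_intros)
  qed
  have mvt: "b (Suc n) \<le> \<phi> (Suc n) - \<phi> n \<and> \<phi> (Suc n) - \<phi> n \<le> b n" if "n > 0" for n
  proof -
    obtain u :: real where u: "real n < u" "u < real (Suc n)" "\<phi> (Suc n) - \<phi> n = (real (Suc n) - real n) * (L * K / ((real k * L)\<^sup>2 + (u * K)\<^sup>2))"
      using MVT2[of "real n" "real (Suc n)" \<phi> "\<lambda>u. (L * K / ((real k * L)\<^sup>2 + (u * K)\<^sup>2))", OF _ d]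
      by (metis lessI of_nat_less_iff)
    have "(real k * L)\<^sup>2 + (n * K)\<^sup>2 \<le> (real k * L)\<^sup>2 + (u * K)\<^sup>2"
      "(real k * L)\<^sup>2 + (u * K)\<^sup>2 \<le> (real k * L)\<^sup>2 + (real (Suc n) * K)\<^sup>2"
      using u by (auto intro!: power_mono mult_right_mono)
    moreover have "(real k * L)\<^sup>2 + (n * K)\<^sup>2 > 0" using assms by (simp add: add_pos_nonneg)
    moreover have one: "real (Suc n) - real n = 1" by simp
    ultimately show ?thesis unfolding u(3) one b_def using assms
      by (auto intro!: divide_left_mono mult_pos_pos simp del: of_nat_Suc)
  qed
  have "filterlim (\<lambda>n. real (n + L) * K / (real k * L)) at_top sequentially"
    using assms by real_asymp
  hence "(\<lambda>n. arctan (real (n + L) * K / (real k * L))) \<longlonglongrightarrow> pi / 2"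
    by (rule filterlim_compose[OF tendsto_arctan_at_top])
  hence lim: "(\<lambda>n. \<phi> (n + L)) \<longlonglongrightarrow> pi / 2 / k"
    unfolding \<phi>_def by (intro tendsto_intros) (use assms in auto)
  have tel: "(\<lambda>n. \<phi> (Suc n + L) - \<phi> (n + L)) sums (pi / 2 / k - \<phi> (0 + L))"
    by (rule telescope_sums[OF lim])
  have val: "pi / 2 / k - \<phi> (0 + L) = arctan (k / K) / k"
  proof -
    have "arctan (1 / (real K / k)) = sgn (real K / k) * pi / 2 - arctan (real K / k)"
      using arctan_inverse[of "real K / real k"] assms by simp
    hence "arctan (k / K) = pi / 2 - arctan (K / k)" using assms(1,2) by simp
    thus ?thesis using assms(1-3) by (simp add: \<phi>_def diff_divide_distrib)
  qed
  have b0: "b n \<ge> 0" for n by (simp add: b_def)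
  have le: "b (Suc (n + L)) \<le> \<phi> (Suc n + L) - \<phi> (n + L)" 
       and ge: "\<phi> (Suc n + L) - \<phi> (n + L) \<le> b (n + L)" for n
    using mvt[of "n + L"] assms by auto
  show sm: "summable (\<lambda>n. b (Suc (n + L)))"
    by (rule summable_comparison_test[OF _ sums_summable[OF tel]]) (use b0 le in auto)
  have sm': "summable (\<lambda>n. b (n + L))"
    by (subst summable_Suc_iff[symmetric]) (use sm in simp)
  have 1: "(\<Sum>n. b (Suc (n + L))) \<le> arctan (k / K) / k"
    using suminf_le[OF le sm sums_summable[OF tel]] sums_unique[OF tel] val by simp
  have 2: "arctan (k / K) / k \<le> (\<Sum>n. b (n + L))"
    using suminf_le[OF ge sums_summable[OF tel] sm'] sums_unique[OF tel] val by simp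
  have 3: "(\<Sum>n. b (n + L)) = b L + (\<Sum>n. b (Suc (n + L)))"
    using suminf_split_head[OF sm'] by simp
  have "(real L * K) * (real L * K) \<le> (real k * L)\<^sup>2 + (real L * K)\<^sup>2" by (simp add: power2_eq_square)
  hence *: "(real L * K) * (real L * K) \<le> (real k * L)\<^sup>2 + (real L * K)\<^sup>2" .
  have "b L \<le> 1 / (real L * K)"
  proof -
    have "b L \<le> (real L * K) / ((real L * K) * (real L * K))"
      unfolding b_def using assms(1-3) * by (intro divide_left_mono mult_pos_pos add_pos_nonneg) auto
    thus ?thesis using assms(1-3) by simp
  qed
  thus "\<bar>(\<Sum>n. b (Suc (n + L))) - arctan (k / K) / k\<bar> \<le> 1 / (real L * real K)"
    using 1 2 3 by linarith
qed

text \<open>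
  The limit is needed only through its existence: two families of Riemann sums of the same
  function cancel in \<open>eta_log_sum_inversion\<close>.
\<close>

lemma Riemann_sum_limit:
  fixes f :: "real \<Rightarrow> real"
  assumes "continuous_on {0..1} f"
  obtains I where "(\<lambda>n. (\<Sum>k<n. f (Suc k / n)) / n) \<longlonglongrightarrow> I"
proof -
  obtain g where g: "\<And>x. x \<in> {0..1} \<Longrightarrow> (g has_vector_derivative f x) (at x within {0..1})"
    using antiderivative_continuous[OF assms] by blast
  have contg: "continuous_on {0..1} g"
    unfolding continuous_on_eq_continuous_within using has_vector_derivative_continuous[OF g] by blast
  have unif: "uniformly_continuous_on {0..1} f"
    using assms by (intro compact_uniformly_continuous) auto
  have "(\<lambda>n. (\<Sum>k<n. f (Suc k / n)) / n) \<longlonglongrightarrow> g 1 - g 0"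
  proof (rule LIMSEQ_I)
    fix r :: real assume r: "r > 0"
    obtain d where d: "d > 0" "\<And>x y. x \<in> {0..1} \<Longrightarrow> y \<in> {0..1} \<Longrightarrow> dist x y < d \<Longrightarrow> dist (f x) (f y) < r / 2"
      using unif r unfolding uniformly_continuous_on_def by (metis half_gt_zero dist_commute)
    obtain n0 :: nat where n0: "n0 > 0" "1 / n0 < d" 
      using d(1) by (metis reals_Archimedean[of d] inverse_eq_divide zero_less_Suc)
    show "\<exists>n0. \<forall>n\<ge>n0. norm ((\<Sum>k<n. f (Suc k / n)) / n - (g 1 - g 0)) < r"
    proof (intro exI[of _ n0] allI impI)
      fix n assume n: "n \<ge> n0"
      have np: "n > 0" using n n0 by simp
      have nd: "1 / n < d"
        using n n0 np by (meson frac_le le_less_trans of_nat_0_less_iff of_nat_le_iff order_refl zero_le_one)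
      have key: "\<bar>f (Suc k / n) / n - (g (Suc k / n) - g (k / n))\<bar> \<le> r / 2 / n" if k: "k < n" for k
      proof -
        have kn: "real k / n < Suc k / n" "Suc k / n \<le> 1" "0 \<le> real k / n"
          using k np by (auto simp: divide_simps)
        have "\<exists>x\<in>{real k / n<..<Suc k / n}. g (Suc k / n) - g (k / n) = (Suc k / n - k / n) * f x"
        proof -
          have sub: "{real k / n..Suc k / n} \<subseteq> {0..1}" using kn by auto
          have "\<exists>\<xi>>real k / n. \<xi> < Suc k / n \<and> g (Suc k / n) - g (k / n) = (\<lambda>h. h * f \<xi>) (Suc k / n - k / n)"
          proof (rule mvt[of "real k / n" "Suc k / n" g "\<lambda>x h. h * f x", simplified])
            show "real k / n < (1 + real k) / n" using kn by simp
            show "continuous_on {real k / n..(1 + real k) / n} g"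
              using continuous_on_subset[OF contg sub] by simp
            fix x assume x: "real k / n < x" "x < (1 + real k) / n"
            have "0 < x" "x < 1" using x kn by (simp_all, linarith+)
            have "(g has_vector_derivative f x) (at x within {0..1})" by (rule g) (use \<open>0 < x\<close> \<open>x < 1\<close> in auto)
            moreover have "at x within {0..1} = at x"
              by (rule at_within_interior) (use \<open>0 < x\<close> \<open>x < 1\<close> in auto)
            ultimately show "(g has_derivative (\<lambda>h. h * f x)) (at x)"
              by (simp add: has_vector_derivative_def)
          qed auto
          thus ?thesis by auto
        qed
        then obtain x where x: "x \<in> {real k / n<..<Suc k / n}" "g (Suc k / n) - g (k / n) = (Suc k / n - k / n) * f x" by blast
        have eq: "Suc k / n - k / n = 1 / real n" using np by (simp add: field_simps)
        have "dist (Suc k / n) x < d" using x(1) nd eq by (auto simp: dist_real_def)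
        moreover have "0 \<le> x" using x(1) kn(3) unfolding greaterThanLessThan_iff by linarith
        ultimately have "dist (f (Suc k / n)) (f x) < r / 2" using d(2)[of "Suc k / n" x] x(1) kn by auto
        moreover have "f (Suc k / n) / n - (g (Suc k / n) - g (k / n)) = (f (Suc k / n) - f x) / n"
          unfolding x(2) eq by (simp add: diff_divide_distrib)
        moreover have "\<bar>f (Suc k / n) - f x\<bar> / n \<le> r / 2 / n" if "\<bar>f (Suc k / n) - f x\<bar> < r / 2"
          using that by (intro divide_right_mono) auto
        ultimately show ?thesis by (simp only: dist_real_def abs_divide abs_of_nat)
      qed
      have "g 1 - g 0 = (\<Sum>k<n. g (Suc k / n) - g (k / n))"
        using sum_lessThan_telescope[of "\<lambda>k. g (real k / n)" n] np by simp
      hence "\<bar>(\<Sum>k<n. f (Suc k / n)) / n - (g 1 - g 0)\<bar> = \<bar>\<Sum>k<n. f (Suc k / n) / n - (g (Suc k / n) - g (k / n))\<bar>"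
        by (simp only: sum_subtractf sum_divide_distrib)
      also have "\<dots> \<le> (\<Sum>k<n. r / 2 / n)"
        by (rule order_trans[OF sum_abs sum_mono]) (use key in auto)
      also have "\<dots> < r" using np r by simp
      finally show "norm ((\<Sum>k<n. f (Suc k / n)) / n - (g 1 - g 0)) < r" by simp
    qed
  qed
  thus ?thesis using that by blast
qed

text \<open>
  The double series \<open>- \<Sum>\<^sub>n ln (1 - exp (- 2 \<pi> n y))\<close>, summed first over \<open>n\<close>.
\<close>

definition eta_log_sum :: "real \<Rightarrow> real" where
  "eta_log_sum y = (\<Sum>k. 1 / (real (Suc k) * (exp (2 * pi * (real (Suc k) * y)) - 1)))"

lemma
  assumes y: "y > 0"
  shows summable_eta_log_sum: "summable (\<lambda>k. 1 / (real (Suc k) * (exp (2 * pi * (real (Suc k) * y)) - 1)))"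
    and dedekind_eta_imaginary: "dedekind_eta (\<i> * of_real y) = of_real (exp (- (pi * y / 12) - eta_log_sum y))"
proof -
  define x where "x = exp (- 2 * pi * y)"
  have x: "0 < x" "x < 1" using y by (auto simp: x_def)
  define t where "t = (\<lambda>(k::nat, n::nat). (x ^ Suc n) ^ Suc k / real (Suc k))"
  define h where "h = (\<lambda>k. x ^ Suc k / (1 - x ^ Suc k) / real (Suc k))"
  define g where "g = (\<lambda>n. - ln (1 - x ^ Suc n))"
  have xp: "0 < x ^ Suc k" "x ^ Suc k < 1" "x ^ Suc k \<le> x" for k
    using x power_Suc_less_one[of x k] power_decreasing[of 1 "Suc k" x] by auto
  have h_eq: "h = (\<lambda>k. 1 / (real (Suc k) * (exp (2 * pi * (real (Suc k) * y)) - 1)))"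
  proof
    fix k
    have "x ^ Suc k = inverse (exp (2 * pi * (real (Suc k) * y)))"
      unfolding x_def exp_of_nat_mult[symmetric] exp_minus[symmetric] by (simp add: algebra_simps)
    moreover have "inverse E / (1 - inverse E) / c = 1 / (c * (E - 1))" if "E > 1" for E c :: real
      using that by (simp add: field_simps)
    ultimately show "h k = 1 / (real (Suc k) * (exp (2 * pi * (real (Suc k) * y)) - 1))"
      using y by (simp add: h_def del: power_Suc of_nat_Suc)
  qed
  have h0: "h k \<ge> 0" for k using xp[of k] by (auto simp: h_def)
  have "summable h"
  proof (rule summable_comparison_test'[of _ 0])
    show "summable (\<lambda>k. x ^ Suc k / (1 - x))"
      using x by (intro summable_divide) (simp only: summable_Suc_iff, auto intro!: summable_geometric)
    have "h k \<le> x ^ Suc k / (1 - x) / 1" for k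
      unfolding h_def using xp[of k] x by (intro frac_le) auto
    thus "norm (h k) \<le> x ^ Suc k / (1 - x)" for k using h0 by simp
  qed
  thus "summable (\<lambda>k. 1 / (real (Suc k) * (exp (2 * pi * (real (Suc k) * y)) - 1)))"
    unfolding h_eq .
  have hS: "(h has_sum eta_log_sum y) UNIV"
    using summable_sums[OF \<open>summable h\<close>] h0 unfolding eta_log_sum_def h_eq
    by (intro sums_nonneg_imp_has_sum) auto
  have tk: "((\<lambda>n. t (k, n)) has_sum h k) UNIV" for k
  proof -
    have "(\<lambda>n. (x ^ Suc k) ^ n) sums (1 / (1 - x ^ Suc k))"
      using xp[of k] by (intro geometric_sums) auto
    hence "(\<lambda>n. x ^ Suc k * (x ^ Suc k) ^ n / real (Suc k)) sums (x ^ Suc k * (1 / (1 - x ^ Suc k)) / real (Suc k))"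
      by (intro sums_divide sums_mult)
    moreover have "x ^ Suc k * (x ^ Suc k) ^ n = (x ^ Suc n) ^ Suc k" for n
      by (metis power_Suc power_mult mult.commute)
    ultimately have "(\<lambda>n. t (k, n)) sums h k" by (simp add: t_def h_def del: power_Suc of_nat_Suc)
    thus ?thesis using x by (intro sums_nonneg_imp_has_sum) (auto simp: t_def)
  qed
  have tn: "((\<lambda>k. t (k, n)) has_sum g n) UNIV" for n
  proof -
    have "(\<lambda>k. - ((- (- (x ^ Suc n))) ^ k) / real k) sums ln (1 + - (x ^ Suc n))"
      using xp[of n] by (intro ln_series') auto
    hence "(\<lambda>k. (x ^ Suc n) ^ k / real k) sums g n"
      using sums_minus[of "\<lambda>k. - ((- (- (x ^ Suc n))) ^ k) / real k"] by (simp add: g_def)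
    hence "(\<lambda>k. (x ^ Suc n) ^ Suc k / real (Suc k)) sums g n"
      by (subst sums_Suc_iff) simp
    hence "(\<lambda>k. t (k, n)) sums g n" by (simp add: t_def)
    thus ?thesis using x by (intro sums_nonneg_imp_has_sum) (auto simp: t_def)
  qed
  have "t summable_on (UNIV \<times> UNIV)"
    by (rule summable_on_SigmaI[OF tk]) (use hS x in \<open>auto simp: t_def has_sum_imp_summable\<close>)
  hence "(t has_sum eta_log_sum y) (UNIV \<times> UNIV)"
    by (intro has_sum_SigmaI[OF tk hS])
  hence "((\<lambda>(n, k). t (k, n)) has_sum eta_log_sum y) (UNIV \<times> UNIV)"
    by (subst (asm) has_sum_swap) simp
  hence "(g has_sum eta_log_sum y) UNIV"
    by (rule has_sum_Sigma') (use tn in auto)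
  hence "g sums eta_log_sum y" by (rule has_sum_imp_sums)
  hence "(\<lambda>N. \<Sum>n<N. - g n) \<longlonglongrightarrow> - eta_log_sum y"
    unfolding sums_def sum_negf by (rule tendsto_minus)
  hence "(\<lambda>N. complex_of_real (exp (\<Sum>n<N. - g n))) \<longlonglongrightarrow> of_real (exp (- eta_log_sum y))"
    by (intro tendsto_of_real tendsto_exp)
  moreover have "exp (\<Sum>n<N. - g n) = (\<Prod>n<N. 1 - x ^ Suc n)" for N
    using xp by (subst exp_sum) (auto simp: g_def intro!: prod.cong)
  ultimately have "(\<lambda>N. \<Prod>n<N. 1 - complex_of_real x ^ Suc n) \<longlonglongrightarrow> of_real (exp (- eta_log_sum y))"
    by simp
  moreover have "(\<lambda>N. \<Prod>n<N. 1 - complex_of_real x ^ Suc n) \<longlonglongrightarrow> euler_prod (of_real x)"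
    by (rule euler_prod_LIMSEQ) (use x in auto)
  ultimately have "euler_prod (of_real x) = of_real (exp (- eta_log_sum y))"
    using LIMSEQ_unique by blast
  moreover have "nome (\<i> * of_real y) = of_real x"
    by (simp add: nome_def x_def exp_of_real[symmetric]) (simp add: algebra_simps)
  moreover have "nome (\<i> * of_real y / 24) = of_real (exp (- (pi * y / 12)))"
    by (simp add: nome_def exp_of_real[symmetric])
  ultimately show "dedekind_eta (\<i> * of_real y) = of_real (exp (- (pi * y / 12) - eta_log_sum y))"
    unfolding dedekind_eta_altdef by (simp add: exp_add[symmetric] flip: of_real_mult)
qed

text \<open>
  Each of the first \<open>K\<close> terms of the series at \<open>y = L / K\<close> is expanded by the partial fractions of
  \<open>coth\<close> into a sum over \<open>n\<close>. The part \<open>n \<le> L\<close> gives a double sum that is symmetric under the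
  exchange of \<open>K\<close> and \<open>L\<close>; the rest is close to \<open>arctan (k / K) / k\<close>.
\<close>

lemma eta_log_sum_partial:
  fixes K L :: nat
  assumes "K > 0" "L > 0"
  shows "\<bar>pi * ((\<Sum>k<K. 1 / (real (Suc k) * (exp (2 * pi * (real (Suc k) * (L / K))) - 1)))
            + harm K / 2 - (\<Sum>k<K. 1 / (real k + 1)\<^sup>2) * (K / L) / (2 * pi))
          - (\<Sum>k<K. \<Sum>n<L. real L * real K / ((real (Suc k) * real L)\<^sup>2 + (real (Suc n) * real K)\<^sup>2))
          - (\<Sum>k<K. arctan (Suc k / K) / Suc k)\<bar> \<le> 1 / L"
proof -
  define b where "b = (\<lambda>k n. real L * real K / ((real k * real L)\<^sup>2 + (real n * real K)\<^sup>2))"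
  define tail where "tail = (\<lambda>k. \<Sum>n. b (Suc k) (Suc (n + L)))"
  define y where "y = real L / K"
  have y: "y > 0" using assms by (simp add: y_def)
  have main: "pi / (real (Suc k) * (exp (2 * pi * (real (Suc k) * y)) - 1)) =
          - (pi * inverse (real (Suc k)) / 2) + 1 / (real k + 1)\<^sup>2 / (2 * y) + ((\<Sum>n<L. b (Suc k) (Suc n)) + tail k)" for k
  proof -
    define x where "x = real (Suc k) * y"
    have x: "x > 0" using y by (simp add: x_def)
    have E: "exp (2 * pi * x) - 1 > 0" using x by simp
    have "x / (x\<^sup>2 + (real n + 1)\<^sup>2) / Suc k = b (Suc k) (Suc n)" for n
    proof -
      have "x / (x\<^sup>2 + (real n + 1)\<^sup>2) = (x * K\<^sup>2) / ((x\<^sup>2 + (real n + 1)\<^sup>2) * K\<^sup>2)" using assms by simp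
      also have "x * K\<^sup>2 = Suc k * (real L * K)" using assms by (simp add: x_def y_def power2_eq_square)
      also have "(x\<^sup>2 + (real n + 1)\<^sup>2) * K\<^sup>2 = (real (Suc k) * real L)\<^sup>2 + (real (Suc n) * real K)\<^sup>2"
        using assms by (simp add: x_def y_def power2_eq_square field_simps)
      finally show ?thesis by (simp add: b_def)
    qed
    hence s: "(\<lambda>n. b (Suc k) (Suc n)) sums (pi * (1 / (exp (2 * pi * x) - 1) + 1 / 2 - 1 / (2 * pi * x)) / Suc k)"
      using sums_divide[OF coth_partial_fractions[OF x], of "real (Suc k)"] by simp
    have "(\<Sum>n. b (Suc k) (Suc n)) = tail k + (\<Sum>n<L. b (Suc k) (Suc n))"
      unfolding tail_def using suminf_split_initial_segment[OF sums_summable[OF s], of L] by simp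
    hence "(\<Sum>n<L. b (Suc k) (Suc n)) + tail k = pi * (1 / (exp (2 * pi * x) - 1) + 1 / 2 - 1 / (2 * pi * x)) / Suc k"
      using sums_unique[OF s] by simp
    also have "\<dots> = pi / (real (Suc k) * (exp (2 * pi * x) - 1)) + pi * inverse (real (Suc k)) / 2 - 1 / (real (Suc k) * (2 * x))"
    proof -
      have "pi * (1 / T + 1 / 2 - 1 / (2 * pi * x)) / c = pi / (c * T) + pi * inverse c / 2 - 1 / (c * (2 * x))"
        if "T > 0" "c > 0" for T c :: real using that x by (simp add: field_simps)
      from this[OF E, of "real (Suc k)"] show ?thesis by (simp only: of_nat_0_less_iff zero_less_Suc)
    qed
    also have "real (Suc k) * (2 * x) = (real k + 1)\<^sup>2 * (2 * y)"
      by (simp add: x_def power2_eq_square algebra_simps)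
    finally show ?thesis by (simp add: x_def)
  qed
  have tb: "\<bar>tail k - arctan (Suc k / K) / Suc k\<bar> \<le> 1 / (real L * K)" for k
    unfolding tail_def b_def using arctan_tail_bound(2)[of "Suc k" K L] assms by simp
  have "pi * (\<Sum>k<K. 1 / (real (Suc k) * (exp (2 * pi * (real (Suc k) * y)) - 1))) =
     (\<Sum>k<K. - (pi * inverse (real (Suc k)) / 2) + 1 / (real k + 1)\<^sup>2 / (2 * y) + ((\<Sum>n<L. b (Suc k) (Suc n)) + tail k))"
    unfolding sum_distrib_left by (intro sum.cong refl) (simp only: main[symmetric] times_divide_eq_right mult_1_right)
  also have "\<dots> = - pi * harm K / 2 + (\<Sum>k<K. 1 / (real k + 1)\<^sup>2) / (2 * y) + (\<Sum>k<K. \<Sum>n<L. b (Suc k) (Suc n)) + (\<Sum>k<K. tail k)"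
  proof -
    have h: "harm K = (\<Sum>k<K. inverse (real (Suc k)))"
      unfolding harm_def by (rule sum.reindex_bij_witness[of _ Suc "\<lambda>k. k - 1"]) auto
    show ?thesis unfolding h
      by (simp add: sum.distrib sum_negf sum_subtractf sum_divide_distrib sum_distrib_left del: of_nat_Suc)
  qed
  finally have *: "pi * (\<Sum>k<K. 1 / (real (Suc k) * (exp (2 * pi * (real (Suc k) * y)) - 1))) = \<dots>" .
  have "\<bar>(\<Sum>k<K. tail k) - (\<Sum>k<K. arctan (Suc k / K) / Suc k)\<bar> \<le> (\<Sum>k<K. 1 / (real L * K))"
    unfolding sum_subtractf[symmetric] using tb by (intro order_trans[OF sum_abs sum_mono]) auto
  also have "\<dots> = 1 / L" using assms by simp
  finally have **: "\<bar>(\<Sum>k<K. tail k) - (\<Sum>k<K. arctan (Suc k / K) / Suc k)\<bar> \<le> 1 / L" .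
  have comb: "pi * (P + h / 2 - H * (K / L) / (2 * pi)) - B - R = T - R"
    if "pi * P = - pi * h / 2 + H / (2 * y) + B + T" for P h H B T R
  proof -
    have "pi * (H * (K / L) / (2 * pi)) = H / (2 * y)" using assms by (simp add: y_def)
    thus ?thesis using that by (simp add: distrib_left right_diff_distrib)
  qed
  show ?thesis
    using ** unfolding comb[OF *, of "(\<Sum>k<K. arctan (Suc k / K) / Suc k)", symmetric] unfolding b_def y_def .
qed

text \<open>
  The preceding estimate is applied to \<open>(j K, j L)\<close> and to \<open>(j L, j K)\<close> with \<open>j \<rightarrow> \<infinity>\<close>. In the
  difference the double sums cancel, the sums of \<open>arctan (k / K) / k\<close> are Riemann sums of \<open>arctan
  x / x\<close> with a common limit, the harmonic numbers leave \<open>ln (L / K)\<close>, and the sums of \<open>1 / k\<^sup>2\<close>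
  give the two linear terms.
\<close>

lemma eta_log_sum_inversion:
  fixes K L :: nat
  assumes "K > 0" "L > 0"
  shows "eta_log_sum (L / K) - eta_log_sum (K / L) = ln (L / K) / 2 + pi / 12 * (K / L - L / K)"
proof -
  define S where "S = (\<lambda>(y::real) N. \<Sum>k<N. 1 / (real (Suc k) * (exp (2 * pi * (real (Suc k) * y)) - 1)))"
  define H where "H = (\<lambda>N. \<Sum>k<N. 1 / (real k + 1)\<^sup>2)"
  define B where "B = (\<lambda>K L. \<Sum>k<K. \<Sum>n<L. real L * real K / ((real (Suc k) * real L)\<^sup>2 + (real (Suc n) * real K)\<^sup>2))"
  define R where "R = (\<lambda>K. \<Sum>k<K. arctan (Suc k / K) / Suc k)"
  have B_swap: "B K L = B L K" for K L
    unfolding B_def by (subst sum.swap) (intro sum.cong refl, simp add: algebra_simps)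
  define e where "e = (\<lambda>K L. pi * (S (L / K) K + harm K / 2 - H K * (K / L) / (2 * pi)) - B K L - R K)"
  have e: "\<bar>e K L\<bar> \<le> 1 / L" if "K > 0" "L > 0" for K L :: nat
    using eta_log_sum_partial[OF that] by (simp add: e_def S_def H_def B_def R_def)
  have sub: "filterlim (\<lambda>j. Suc j * K) sequentially sequentially" if "K > 0" for K :: nat
    using that by (auto intro!: filterlim_subseq strict_monoI)
  have S_lim: "(\<lambda>j. S y (Suc j * K)) \<longlonglongrightarrow> eta_log_sum y" if "y > 0" "K > 0" for y and K :: nat
    unfolding S_def eta_log_sum_def
    by (rule filterlim_compose[OF summable_LIMSEQ sub]) (use that summable_eta_log_sum in auto)
  have H_lim: "(\<lambda>j. H (Suc j * K)) \<longlonglongrightarrow> pi\<^sup>2 / 6" if "K > 0" for K :: nat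
    unfolding H_def using filterlim_compose[OF inverse_squares_sums[unfolded sums_def] sub[OF that]]
    by (simp add: add_ac)
  have h_lim: "(\<lambda>j. harm (Suc j * K) - ln (real (Suc j * K))) \<longlonglongrightarrow> euler_mascheroni" if "K > 0" for K :: nat
    by (rule filterlim_compose[OF euler_mascheroni_LIMSEQ sub[OF that]])
  define \<phi> where "\<phi> = (\<lambda>x::real. if x = 0 then 1 else arctan x / x)"
  have "continuous_on {0..1} \<phi>"
    unfolding continuous_on_eq_continuous_within
  proof
    fix x :: real assume "x \<in> {0..1}"
    show "continuous (at x within {0..1}) \<phi>"
    proof (cases "x = 0")
      case True
      have "(arctan has_real_derivative inverse (1 + 0\<^sup>2)) (at 0)" by (rule DERIV_arctan)
      hence "((\<lambda>h. arctan h / h) \<longlongrightarrow> 1) (at 0)" by (simp add: DERIV_def)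
      hence "(\<phi> \<longlongrightarrow> 1) (at 0)"
        by (rule Lim_transform_eventually) (auto simp: \<phi>_def eventually_at_filter)
      hence "isCont \<phi> 0" by (simp add: isCont_def \<phi>_def)
      thus ?thesis using True continuous_at_imp_continuous_at_within by blast
    next
      case False
      have "((\<lambda>x. arctan x / x) \<longlongrightarrow> \<phi> x) (at x)"
        using False by (auto simp: \<phi>_def intro!: tendsto_intros)
      moreover have "\<forall>\<^sub>F t in at x. arctan t / t = \<phi> t"
        using eventually_neq_at_within[of 0 x UNIV] by eventually_elim (simp add: \<phi>_def)
      ultimately have "(\<phi> \<longlongrightarrow> \<phi> x) (at x)" by (rule Lim_transform_eventually)
      hence "isCont \<phi> x" by (simp add: isCont_def)
      thus ?thesis using continuous_at_imp_continuous_at_within by blast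
    qed
  qed
  then obtain I where I: "(\<lambda>n. (\<Sum>k<n. \<phi> (Suc k / n)) / n) \<longlonglongrightarrow> I"
    using Riemann_sum_limit by blast
  have "(\<Sum>k<n. \<phi> (Suc k / n)) / n = R n" for n
    unfolding R_def sum_divide_distrib by (intro sum.cong) (auto simp: \<phi>_def)
  hence "R \<longlonglongrightarrow> I" using I by presburger
  hence R_lim: "(\<lambda>j. R (Suc j * K)) \<longlonglongrightarrow> I" if "K > 0" for K :: nat
    using filterlim_compose[OF _ sub[OF that]] by blast
  have e_lim: "(\<lambda>j. e (Suc j * K) (Suc j * L)) \<longlonglongrightarrow> 0" if "K > 0" "L > 0" for K L :: nat
  proof (rule Lim_null_comparison)
    show "\<forall>\<^sub>F j in sequentially. norm (e (Suc j * K) (Suc j * L)) \<le> 1 / real (Suc j)"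
    proof (intro always_eventually allI)
      fix j
      have "\<bar>e (Suc j * K) (Suc j * L)\<bar> \<le> 1 / (Suc j * L)" by (rule e) (use that in auto)
      also have "real (Suc j) \<le> real (Suc j * L)" unfolding of_nat_le_iff using mult_le_mono2[of 1 L "Suc j"] that by simp
      hence "1 / real (Suc j * L) \<le> 1 / Suc j" by (intro frac_le) simp_all
      finally show "norm (e (Suc j * K) (Suc j * L)) \<le> 1 / real (Suc j)" by simp
    qed
    show "(\<lambda>j. 1 / real (Suc j)) \<longlonglongrightarrow> 0" by (rule LIMSEQ_Suc[OF lim_1_over_n])
  qed
  define y where "y = real L / K"
  have y: "y > 0" "real K / L = 1 / y" using assms by (auto simp: y_def)
  have eq: "S (L / K) (Suc j * K) - S (K / L) (Suc j * L) =
       - ((harm (Suc j * K) - ln (real (Suc j * K))) - (harm (Suc j * L) - ln (real (Suc j * L))) - ln y) / 2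
       + H (Suc j * K) * (K / L) / (2 * pi) - H (Suc j * L) * (L / K) / (2 * pi)
       + (e (Suc j * K) (Suc j * L) - e (Suc j * L) (Suc j * K) + R (Suc j * K) - R (Suc j * L)) / pi" for j
  proof -
    have r: "real (Suc j * L) / real (Suc j * K) = L / K"
      unfolding of_nat_mult by (rule mult_divide_mult_cancel_left) simp
    have r': "real (Suc j * K) / real (Suc j * L) = K / L"
      unfolding of_nat_mult by (rule mult_divide_mult_cancel_left) simp
    have "ln (real (Suc j * L) / real (Suc j * K)) = ln (real (Suc j * L)) - ln (real (Suc j * K))"
      by (rule ln_divide_pos) (use assms in \<open>simp_all add: add_pos_nonneg\<close>)
    hence ln: "ln y = ln (real (Suc j * L)) - ln (real (Suc j * K))" unfolding r y_def .
    have gen: "S1 - S2 = - ((h1 - l1) - (h2 - l2) - (l2 - l1)) / 2 + A1 - A2 +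
       ((pi * (S1 + h1 / 2 - A1) - B' - R1) - (pi * (S2 + h2 / 2 - A2) - B' - R2) + R1 - R2) / pi"
       for S1 S2 h1 h2 l1 l2 A1 A2 B' R1 R2 :: real
    proof -
      have "(pi * (S1 + h1 / 2 - A1) - B' - R1) - (pi * (S2 + h2 / 2 - A2) - B' - R2) + R1 - R2 =
            pi * ((S1 + h1 / 2 - A1) - (S2 + h2 / 2 - A2))" by (simp add: algebra_simps)
      thus ?thesis by (simp add: diff_divide_distrib)
    qed
    show ?thesis unfolding e_def r r' ln B_swap[of "Suc j * L" "Suc j * K"] by (rule gen)
  qed
  have "(\<lambda>j. - ((harm (Suc j * K) - ln (real (Suc j * K))) - (harm (Suc j * L) - ln (real (Suc j * L))) - ln y) / 2
       + H (Suc j * K) * (K / L) / (2 * pi) - H (Suc j * L) * (L / K) / (2 * pi)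
       + (e (Suc j * K) (Suc j * L) - e (Suc j * L) (Suc j * K) + R (Suc j * K) - R (Suc j * L)) / pi)
     \<longlonglongrightarrow> - (euler_mascheroni - euler_mascheroni - ln y) / 2
       + pi\<^sup>2 / 6 * (K / L) / (2 * pi) - pi\<^sup>2 / 6 * (L / K) / (2 * pi) + (0 - 0 + I - I) / pi"
    by (intro tendsto_intros h_lim H_lim e_lim R_lim assms) auto
  hence "(\<lambda>j. S (L / K) (Suc j * K) - S (K / L) (Suc j * L)) \<longlonglongrightarrow> - (euler_mascheroni - euler_mascheroni - ln y) / 2
       + pi\<^sup>2 / 6 * (K / L) / (2 * pi) - pi\<^sup>2 / 6 * (L / K) / (2 * pi) + (0 - 0 + I - I) / pi"
    unfolding eq .
  moreover have "(\<lambda>j. S (L / K) (Suc j * K) - S (K / L) (Suc j * L)) \<longlonglongrightarrow> eta_log_sum (L / K) - eta_log_sum (K / L)"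
    by (intro tendsto_diff S_lim) (use assms in auto)
  ultimately have "eta_log_sum (L / K) - eta_log_sum (K / L) = - (euler_mascheroni - euler_mascheroni - ln y) / 2
       + pi\<^sup>2 / 6 * (K / L) / (2 * pi) - pi\<^sup>2 / 6 * (L / K) / (2 * pi) + (0 - 0 + I - I) / pi"
    using LIMSEQ_unique by blast
  moreover have pt: "pi\<^sup>2 / 6 * t / (2 * pi) = pi / 12 * t" for t by (simp add: power2_eq_square)
  ultimately show ?thesis unfolding pt by (simp add: y_def right_diff_distrib)
qed

text \<open>
  For \<open>z = \<i> y\<close> with rational \<open>y\<close> this is the exponential of \<open>eta_log_sum_inversion\<close>. Such points
  accumulate at \<open>\<i>\<close>, and the identity theorem extends the formula to the upper half plane.
\<close>

theorem dedekind_eta_inversion: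
  assumes "z \<in> uhp"
  shows "dedekind_eta (- (1 / z)) ^ 2 = - \<i> * z * dedekind_eta z ^ 2"
proof -
  define f where "f = (\<lambda>z. dedekind_eta (- (1 / z)) ^ 2 + \<i> * z * dedekind_eta z ^ 2)"
  have inv: "- (1 / z) \<in> uhp" if "z \<in> uhp" for z
    using that by (auto simp: uhp_def Im_divide intro!: divide_pos_pos add_nonneg_pos)
  have nz: "z \<noteq> 0" if "z \<in> uhp" for z using that by (auto simp: uhp_def)
  have [simp]: "0 \<notin> uhp" by (simp add: uhp_def)
  have "(dedekind_eta \<circ> (\<lambda>z. - (1 / z))) holomorphic_on uhp"
    by (rule holomorphic_on_compose_gen[OF _ holomorphic_dedekind_eta])
       (auto intro!: holomorphic_intros simp: nz inv)
  hence holf: "f holomorphic_on uhp"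
    unfolding f_def o_def by (intro holomorphic_intros holomorphic_dedekind_eta)
  \<comment> \<open>Rational points of the imaginary axis different from \<open>\<i>\<close> that converge to \<open>\<i>\<close>.\<close>
  define U where "U = (\<lambda>j::nat. \<i> * of_real (real (Suc (Suc j)) / real (Suc j))) ` UNIV"
  have fU: "f w = 0" if wU: "w \<in> U" for w
  proof -
    obtain j where w: "w = \<i> * of_real (real (Suc (Suc j)) / real (Suc j))" using wU unfolding U_def by (elim imageE)
    define K L where "K = Suc j" and "L = Suc (Suc j)"
    define y where "y = real L / real K"
    have KL: "K > 0" "L > 0" by (auto simp: K_def L_def)
    have y: "y > 0" "1 / y = real K / real L" using KL by (auto simp: y_def)
    have "- (pi * (1 / y) / 12) - eta_log_sum (1 / y) = - (pi * y / 12) - eta_log_sum y + ln y / 2"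
    proof -
      have "eta_log_sum y - eta_log_sum (1 / y) = ln y / 2 + pi / 12 * (1 / y - y)"
        using eta_log_sum_inversion[OF KL] by (simp only: y_def[symmetric] y(2)[symmetric])
      moreover have "pi / 12 * (1 / y - y) = pi * (1 / y) / 12 - pi * y / 12" by (simp add: right_diff_distrib)
      ultimately show ?thesis by linarith
    qed
    hence "exp (- (pi * (1 / y) / 12) - eta_log_sum (1 / y)) ^ 2 = exp (- (pi * y / 12) - eta_log_sum y) ^ 2 * exp (ln y)"
      by (simp add: exp_add power2_eq_square flip: exp_add)
    hence "complex_of_real (exp (- (pi * (1 / y) / 12) - eta_log_sum (1 / y))) ^ 2 =
           of_real (exp (- (pi * y / 12) - eta_log_sum y)) ^ 2 * of_real y"
      using y by (metis of_real_power of_real_mult exp_ln)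
    hence "dedekind_eta (\<i> * of_real (1 / y)) ^ 2 = dedekind_eta (\<i> * of_real y) ^ 2 * of_real y"
    proof -
      have "1 / y > 0" using y(1) by simp
      show ?thesis unfolding dedekind_eta_imaginary[OF y(1)] dedekind_eta_imaginary[OF \<open>1 / y > 0\<close>] by fact
    qed
    moreover have wy: "w = \<i> * of_real y" by (simp add: w y_def K_def L_def)
    moreover have "- (1 / (\<i> * of_real y)) = \<i> * of_real (1 / y)" using y by (simp add: field_simps)
    ultimately have "f w = dedekind_eta (\<i> * of_real y) ^ 2 * of_real y + \<i> * (\<i> * of_real y) * dedekind_eta (\<i> * of_real y) ^ 2"
      by (simp only: f_def)
    also have "\<dots> = (of_real y + \<i> * (\<i> * of_real y)) * dedekind_eta (\<i> * of_real y) ^ 2"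
      by (simp only: ring_distribs mult.commute)
    also have "of_real y + \<i> * (\<i> * of_real y) = 0" by (simp flip: mult.assoc)
    finally show ?thesis by simp
  qed
  have lim: "(\<lambda>j. \<i> * of_real (real (Suc (Suc j)) / real (Suc j))) \<longlonglongrightarrow> \<i> * of_real 1"
    by (intro tendsto_intros) real_asymp
  have "\<i> islimpt U"
    unfolding islimpt_sequential
  proof (intro exI conjI)
    show "\<forall>n. \<i> * of_real (real (Suc (Suc n)) / real (Suc n)) \<in> U - {\<i>}"
      by (auto simp: U_def complex_eq_iff field_simps)
  qed (use lim in simp)
  moreover have "U \<subseteq> uhp" by (auto simp: U_def uhp_def)
  ultimately have "f z = 0"
    using analytic_continuation[OF holf open_uhp connected_uhp, of U \<i> z] fU assms by (auto simp: uhp_def)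
  thus ?thesis by (simp add: f_def add_eq_0_iff)
qed

section \<open>The multiplier of the square of the eta function\<close>

text \<open>
  For a matrix in \<open>SL\<^sub>2(\<int>)\<close> with rows \<open>(a, b)\<close> and \<open>(c, d)\<close>, the multiplier of \<open>\<eta>\<^sup>8\<close> is \<open>exp (2 \<pi>
  \<i> x / 3)\<close>, with \<open>x\<close> given by \<open>eta_exp3\<close>, and that of \<open>\<eta>\<^sup>6\<close> is \<open>exp (2 \<pi> \<i> y / 4)\<close>, with \<open>y\<close>
  given by \<open>eta_exp4\<close>. By the Chinese remainder theorem, \<open>\<eta>\<^sup>2\<close> has the multiplier \<open>exp (2 \<pi> \<i> (4 x
  - 3 y) / 12)\<close>. That the exponent is an integer polynomial in the entries, the same for all
  matrices, allows substitutions modulo \<open>p - 1\<close>, \<open>3\<close> and \<open>4\<close>.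
\<close>

definition eta_exp3 :: "int \<Rightarrow> int \<Rightarrow> int \<Rightarrow> int \<Rightarrow> int" where
  "eta_exp3 a b c d = (1 - c\<^sup>2) * b * d + c * (a + d)"

definition eta_exp4 :: "int \<Rightarrow> int \<Rightarrow> int \<Rightarrow> int \<Rightarrow> int" where
  "eta_exp4 a b c d = (1 - c\<^sup>2) * (b * d + 3 * (c - 1) * d + c + 3) + c * (a + d - 3)"

definition eta_exp :: "int \<Rightarrow> int \<Rightarrow> int \<Rightarrow> int \<Rightarrow> int" where
  "eta_exp a b c d = 4 * eta_exp3 a b c d - 3 * eta_exp4 a b c d"

lemma eta_exp4_cong:
  assumes "[a = a'] (mod m)" "[b = b'] (mod m)" "[c = c'] (mod m)" "[d = d'] (mod m)"
  shows "[eta_exp4 a b c d = eta_exp4 a' b' c' d'] (mod m)"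
  unfolding eta_exp4_def by (intro cong_add cong_mult cong_diff cong_pow cong_refl assms)

lemma eta_exp3_cong:
  assumes "[a = a'] (mod m)" "[b = b'] (mod m)" "[c = c'] (mod m)" "[d = d'] (mod m)"
  shows "[eta_exp3 a b c d = eta_exp3 a' b' c' d'] (mod m)"
  unfolding eta_exp3_def by (intro cong_add cong_mult cong_diff cong_pow cong_refl assms)

lemma eta_exp_cong:
  assumes "[a = a'] (mod m)" "[b = b'] (mod m)" "[c = c'] (mod m)" "[d = d'] (mod m)"
  shows "[eta_exp a b c d = eta_exp a' b' c' d'] (mod m)"
  unfolding eta_exp_def by (intro cong_mult cong_diff cong_refl eta_exp3_cong eta_exp4_cong assms)

lemma eta_exp3_T: "a * d - b * c = 1 \<Longrightarrow> [eta_exp3 a (a + b) c (c + d) = eta_exp3 a b c d + 1] (mod 3)"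
proof -
  assume "a * d - b * c = 1"
  hence ad: "a * d = 1 + b * c" by simp
  have "eta_exp3 a (a + b) c (c + d) - (eta_exp3 a b c d + 1) = (1 - c\<^sup>2) * (a * c + a * d + b * c - 1)"
    by (simp add: eta_exp3_def algebra_simps power2_eq_square)
  also have "\<dots> = - ((c - 1) * c * (c + 1)) * (a + 2 * b)"
    unfolding ad by (simp add: algebra_simps power2_eq_square)
  also have "3 dvd \<dots>"
  proof -
    have "3 dvd (c - 1) * c * (c + 1)"
    proof -
      have "c mod 3 = 0 \<or> c mod 3 = 1 \<or> c mod 3 = 2" by presburger
      hence "3 dvd c \<or> 3 dvd c - 1 \<or> 3 dvd c + 1" by presburger
      thus ?thesis by auto
    qed
    thus ?thesis by simp
  qed
  finally show ?thesis by (simp add: cong_iff_dvd_diff)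
qed

lemma eta_exp3_S: "a * d - b * c = 1 \<Longrightarrow> [eta_exp3 b (- a) d (- c) = eta_exp3 a b c d] (mod 3)"
proof -
  assume 1: "a * d - b * c = 1"
  have "eta_exp3 b (- a) d (- c) - eta_exp3 a b c d = - c * d * (a * d - b * c) - 2 * c * d"
    by (simp add: eta_exp3_def algebra_simps power2_eq_square)
  also have "\<dots> = 3 * (- c * d)" unfolding 1 by simp
  finally show ?thesis by (simp add: cong_iff_dvd_diff)
qed

text \<open>
  The three relations hold only modulo \<open>4\<close>, for matrices of determinant \<open>1\<close> modulo \<open>4\<close>; they are
  checked on all residues.
\<close>

lemma eta_exp4_table:
  "\<forall>a\<in>{0, 1, 2, 3::int}. \<forall>b\<in>{0, 1, 2, 3::int}. \<forall>c\<in>{0, 1, 2, 3::int}. \<forall>d\<in>{0, 1, 2, 3::int}. (a * d - b * c) mod 4 = 1 \<longrightarrow>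
     (eta_exp4 a (a + b) c (c + d) - eta_exp4 a b c d) mod 4 = 1 \<and>
     (eta_exp4 b (- a) d (- c) - eta_exp4 a b c d) mod 4 = 1 \<and>
     (eta_exp4 a (- b) (- c) d + eta_exp4 a b c d) mod 4 = 0"
  by (simp add: eta_exp4_def)

lemma eta_exp4_relations:
  assumes "a * d - b * c = 1"
  shows "[eta_exp4 a (a + b) c (c + d) = eta_exp4 a b c d + 1] (mod 4)"
    and "[eta_exp4 b (- a) d (- c) = eta_exp4 a b c d - 3] (mod 4)"
    and "[eta_exp4 a (- b) (- c) d = - eta_exp4 a b c d] (mod 4)"
proof -
  define A B C D where "A = a mod 4" "B = b mod 4" "C = c mod 4" "D = d mod 4"
  have cong: "[a = A] (mod 4)" "[b = B] (mod 4)" "[c = C] (mod 4)" "[d = D] (mod 4)"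
    by (auto simp: A_B_C_D_def cong_def)
  have "x mod 4 = 0 \<or> x mod 4 = 1 \<or> x mod 4 = 2 \<or> x mod 4 = 3" for x :: int by presburger
  note r4 = this
  have "x mod 4 \<in> {0, 1, 2, 3}" for x :: int using r4[of x] by blast
  note r4 = this
  have "A \<in> {0, 1, 2, 3}" "B \<in> {0, 1, 2, 3}" "C \<in> {0, 1, 2, 3}" "D \<in> {0, 1, 2, 3}"
    unfolding A_B_C_D_def by (rule r4)+
  note mem = this
  have "[A * D - B * C = a * d - b * c] (mod 4)"
    by (intro cong_diff cong_mult cong[THEN cong_sym])
  hence "(A * D - B * C) mod 4 = 1" unfolding assms by (simp add: cong_def)
  from eta_exp4_table[rule_format, OF mem this] have *: "(eta_exp4 A (A + B) C (C + D) - eta_exp4 A B C D) mod 4 = 1"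
    "(eta_exp4 B (- A) D (- C) - eta_exp4 A B C D) mod 4 = 1"
    "(eta_exp4 A (- B) (- C) D + eta_exp4 A B C D) mod 4 = 0"
    by blast+
  have "[eta_exp4 a (a + b) c (c + d) - eta_exp4 a b c d = eta_exp4 A (A + B) C (C + D) - eta_exp4 A B C D] (mod 4)"
    by (intro cong_diff eta_exp4_cong cong_add cong)
  with *(1) show "[eta_exp4 a (a + b) c (c + d) = eta_exp4 a b c d + 1] (mod 4)"
    unfolding cong_def by presburger
  have "[eta_exp4 b (- a) d (- c) - eta_exp4 a b c d = eta_exp4 B (- A) D (- C) - eta_exp4 A B C D] (mod 4)"
    by (intro cong_diff eta_exp4_cong cong_minus_minus_iff[THEN iffD2] cong)
  with *(2) show "[eta_exp4 b (- a) d (- c) = eta_exp4 a b c d - 3] (mod 4)"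
    unfolding cong_def by presburger
  have "[eta_exp4 a (- b) (- c) d + eta_exp4 a b c d = eta_exp4 A (- B) (- C) D + eta_exp4 A B C D] (mod 4)"
    by (intro cong_add eta_exp4_cong cong_minus_minus_iff[THEN iffD2] cong)
  with *(3) show "[eta_exp4 a (- b) (- c) d = - eta_exp4 a b c d] (mod 4)"
    unfolding cong_def by presburger
qed

lemma cong_12_combine:
  fixes x y :: int
  assumes "[x' = x + s] (mod 3)" "[y' = y + t] (mod 4)"
  shows "[4 * x' - 3 * y' = 4 * x - 3 * y + (4 * s - 3 * t)] (mod 12)"
proof -
  obtain k l where "x' - (x + s) = 3 * k" "y' - (y + t) = 4 * l"
    using assms by (auto simp: cong_iff_dvd_diff elim!: dvdE)
  hence "4 * x' - 3 * y' - (4 * x - 3 * y + (4 * s - 3 * t)) = 12 * (k - l)" by (simp add: algebra_simps)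
  thus ?thesis by (simp add: cong_iff_dvd_diff)
qed

lemma eta_exp_T:
  assumes "a * d - b * c = 1"
  shows "[eta_exp a (a + b) c (c + d) = eta_exp a b c d + 1] (mod 12)"
  using cong_12_combine[OF eta_exp3_T[OF assms] eta_exp4_relations(1)[OF assms]] by (simp add: eta_exp_def)

lemma eta_exp_S:
  assumes "a * d - b * c = 1"
  shows "[eta_exp b (- a) d (- c) = eta_exp a b c d + 9] (mod 12)"
  using cong_12_combine[of _ _ 0, OF _ eta_exp4_relations(2)[OF assms, unfolded diff_conv_add_uminus]] eta_exp3_S[OF assms]
  by (simp add: eta_exp_def)

definition eta2 :: "complex \<Rightarrow> complex" where
  "eta2 z = dedekind_eta z ^ 2"

lemma eta2_add_1: "eta2 (z + 1) = nome (1 / 12) * eta2 z"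
proof -
  have "nome (1 / 24) ^ 2 = nome (1 / 12)"
    using nome_of_nat_mult[of 2 "1/24"] by simp
  thus ?thesis by (simp add: eta2_def dedekind_eta_add_1 power_mult_distrib)
qed

lemma eta2_inversion: "z \<in> uhp \<Longrightarrow> eta2 (- (1 / z)) = nome (9 / 12) * z * eta2 z"
proof -
  assume "z \<in> uhp"
  have "nome (9 / 12) = exp (\<i> * of_real (3 / 2 * pi))" by (simp add: nome_def field_simps)
  also have "\<dots> = cis (3 / 2 * pi)" by (simp add: cis_conv_exp)
  also have "3 / 2 * pi = pi / 2 + pi" by simp
  also have "cis (pi / 2 + pi) = - \<i>" unfolding cis_mult[symmetric] by simp
  finally show ?thesis using dedekind_eta_inversion[OF \<open>z \<in> uhp\<close>] by (simp add: eta2_def)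
qed

lemma nome_cong_12:
  assumes "[m = n] (mod 12)"
  shows "nome (of_int m / 12) = nome (of_int n / 12)"
proof -
  obtain k where "m = n + 12 * k" using assms by (metis cong_iff_lin cong_sym)
  hence "of_int m / 12 = of_int n / 12 + (of_int k :: complex)" by (simp add: field_simps)
  thus ?thesis by (simp only: nome_add nome_of_int mult_1_right)
qed

lemma uhp_lin_nonzero:
  assumes "z \<in> uhp" "a * d - b * c = (1::int)"
  shows "of_int c * z + of_int d \<noteq> 0"
proof
  assume *: "of_int c * z + of_int d = 0"
  from arg_cong[OF *, of Im] have "c = 0" using assms(1) by (simp add: uhp_def)
  moreover from this * have "d = 0" by simp
  ultimately show False using assms(2) by simp
qed

lemma uhp_moebius:
  assumes "z \<in> uhp" "a * d - b * c = (1::int)"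
  shows "Im ((of_int a * z + of_int b) / (of_int c * z + of_int d)) = Im z / norm (of_int c * z + of_int d) ^ 2"
    and "(of_int a * z + of_int b) / (of_int c * z + of_int d) \<in> uhp"
proof -
  have nz: "of_int c * z + of_int d \<noteq> 0" by (rule uhp_lin_nonzero[OF assms])
  have "Im ((of_int a * z + of_int b) / (of_int c * z + of_int d)) =
      (of_int a * of_int d - of_int b * of_int c) * Im z / norm (of_int c * z + of_int d) ^ 2"
    by (simp add: Im_divide cmod_power2 algebra_simps)
  also have "(of_int a * of_int d - of_int b * of_int c :: real) = of_int (a * d - b * c)" by simp
  finally show *: "Im ((of_int a * z + of_int b) / (of_int c * z + of_int d)) = Im z / norm (of_int c * z + of_int d) ^ 2"
    using assms(2) by simp
  show "(of_int a * z + of_int b) / (of_int c * z + of_int d) \<in> uhp"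
    unfolding uhp_def mem_Collect_eq * using assms(1) nz by (simp add: uhp_def)
qed

definition eta2_law :: "int \<Rightarrow> int \<Rightarrow> int \<Rightarrow> int \<Rightarrow> bool" where
  "eta2_law a b c d \<longleftrightarrow> (\<forall>z\<in>uhp. eta2 ((of_int a * z + of_int b) / (of_int c * z + of_int d)) =
     nome (of_int (eta_exp a b c d) / 12) * (of_int c * z + of_int d) * eta2 z)"

text \<open>
  Translation on the right: the exponent grows by \<open>1\<close>, as \<open>\<eta>\<^sup>2\<close> does under \<open>z \<mapsto> z + 1\<close>.
\<close>

lemma eta2_law_T:
  assumes "a * d - b * c = 1"
  shows "eta2_law a (a + b) c (c + d) \<longleftrightarrow> eta2_law a b c d"
proof -
  have e: "nome (of_int (eta_exp a (a + b) c (c + d)) / 12) = nome (of_int (eta_exp a b c d) / 12) * nome (1 / 12)"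
    using nome_cong_12[OF eta_exp_T[OF assms]] by (simp add: nome_add add_divide_distrib)
  have "eta2_law a (a + b) c (c + d) \<longleftrightarrow> (\<forall>z\<in>uhp. eta2 ((of_int a * (z + 1) + of_int b) / (of_int c * (z + 1) + of_int d)) =
     nome (of_int (eta_exp a b c d) / 12) * (of_int c * (z + 1) + of_int d) * eta2 (z + 1))"
    unfolding eta2_law_def e eta2_add_1 by (simp add: algebra_simps)
  also have "\<dots> \<longleftrightarrow> eta2_law a b c d"
  proof -
    have shift: "(\<forall>z\<in>uhp. P (z + 1)) \<longleftrightarrow> (\<forall>z\<in>uhp. P z)" for P :: "complex \<Rightarrow> bool"
    proof (intro iffI ballI)
      fix z assume "\<forall>z\<in>uhp. P (z + 1)" "z \<in> uhp"
      moreover from this have "z - 1 \<in> uhp" by (simp add: uhp_def)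
      ultimately have "P ((z - 1) + 1)" by blast
      thus "P z" by simp
    qed (auto simp: uhp_def)
    show ?thesis unfolding eta2_law_def
      by (rule shift[of "\<lambda>z. eta2 ((of_int a * z + of_int b) / (of_int c * z + of_int d)) =
        nome (of_int (eta_exp a b c d) / 12) * (of_int c * z + of_int d) * eta2 z"])
  qed
  finally show ?thesis .
qed

lemma eta2_law_T_int:
  assumes "a * d - b * c = 1"
  shows "eta2_law a (n * a + b) c (n * c + d) \<longleftrightarrow> eta2_law a b c d"
proof (induction n rule: int_induct[of _ 0])
  case (step1 i)
  have "a * (i * c + d) - (i * a + b) * c = 1" using assms by (simp add: algebra_simps)
  from eta2_law_T[OF this] step1 show ?case by (simp add: algebra_simps)
next
  case (step2 i)
  have "a * ((i - 1) * c + d) - ((i - 1) * a + b) * c = 1" using assms by (simp add: algebra_simps)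
  from eta2_law_T[OF this] step2 show ?case by (simp add: algebra_simps)
qed simp

text \<open>
  Inversion on the right: by \<open>dedekind_eta_inversion\<close> the exponent grows by \<open>9\<close>. Four inversions
  are the identity, which gives the converse.
\<close>

lemma eta2_law_S:
  assumes "a * d - b * c = 1"
  shows "eta2_law b (- a) d (- c) \<longleftrightarrow> eta2_law a b c d"
proof -
  have imp: "eta2_law b (- a) d (- c)" if "eta2_law a b c d" "a * d - b * c = 1" for a b c d
    unfolding eta2_law_def
  proof
    fix z assume z: "z \<in> uhp"
    hence z0: "z \<noteq> 0" by (auto simp: uhp_def)
    have z': "- (1 / z) \<in> uhp"
      using z by (auto simp: uhp_def Im_divide intro!: divide_pos_pos add_nonneg_pos)
    have e: "nome (of_int (eta_exp b (- a) d (- c)) / 12) = nome (of_int (eta_exp a b c d) / 12) * nome (9 / 12)"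
    proof -
      from nome_cong_12[OF eta_exp_S[OF that(2)]] show ?thesis by (simp add: nome_add add_divide_distrib)
    qed
    have "(of_int b * z + of_int (- a)) / (of_int d * z + of_int (- c)) =
          (of_int a * (- (1 / z)) + of_int b) / (of_int c * (- (1 / z)) + of_int d)"
    proof -
      have "(of_int a * (- (1 / z)) + of_int b) / (of_int c * (- (1 / z)) + of_int d) =
         ((of_int a * (- (1 / z)) + of_int b) * z) / ((of_int c * (- (1 / z)) + of_int d) * z)" using z0 by simp
      also have "\<dots> = (of_int b * z + of_int (- a)) / (of_int d * z + of_int (- c))"
        using z0 by (simp add: algebra_simps)
      finally show ?thesis by simp
    qed
    hence "eta2 ((of_int b * z + of_int (- a)) / (of_int d * z + of_int (- c))) =
      nome (of_int (eta_exp a b c d) / 12) * (of_int c * (- (1 / z)) + of_int d) * eta2 (- (1 / z))"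
      using bspec[OF that(1)[unfolded eta2_law_def] z'] by (simp only:)
    also have "\<dots> = nome (of_int (eta_exp b (- a) d (- c)) / 12) * ((of_int c * (- (1 / z)) + of_int d) * z) * eta2 z"
      unfolding eta2_inversion[OF z] e by (simp add: algebra_simps)
    also have "(of_int c * (- (1 / z)) + of_int d) * z = of_int d * z + of_int (- c)"
      using z0 by (simp add: algebra_simps)
    finally show "eta2 ((of_int b * z + of_int (- a)) / (of_int d * z + of_int (- c))) =
      nome (of_int (eta_exp b (- a) d (- c)) / 12) * (of_int d * z + of_int (- c)) * eta2 z" .
  qed
  show ?thesis
  proof
    assume "eta2_law b (- a) d (- c)"
    from imp[OF imp[OF imp[OF this]]] show "eta2_law a b c d"
      using assms by (simp add: algebra_simps)
  qed (use imp assms in blast)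
qed

text \<open>
  Translation and inversion on the right carry out the Euclidean algorithm on the bottom row \<open>(c,
  d)\<close> until \<open>c = 0\<close>.
\<close>

theorem eta2_transformation:
  assumes "a * d - b * c = 1"
  shows "eta2_law a b c d"
  using assms
proof (induction "nat \<bar>c\<bar>" arbitrary: a b c d rule: less_induct)
  case less
  show ?case
  proof (cases "c = 0")
    case False
    \<comment> \<open>The translation that replaces \<open>d\<close> by its remainder modulo \<open>c\<close>.\<close>
    define n where "n = - (d div c)"
    have r: "n * c + d = d mod c" by (simp add: n_def minus_div_mult_eq_mod[symmetric])
    have "\<bar>d mod c\<bar> < \<bar>c\<bar>" using False by (rule abs_mod_less)
    hence lt: "nat \<bar>n * c + d\<bar> < nat \<bar>c\<bar>" unfolding r by linarith
    have det: "a * (n * c + d) - (n * a + b) * c = 1" using less.prems by (simp add: algebra_simps)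
    have "eta2_law (n * a + b) (- a) (n * c + d) (- c)"
      by (rule less.hyps[OF lt]) (use det in \<open>simp add: algebra_simps\<close>)
    thus ?thesis using eta2_law_S[OF det] eta2_law_T_int[OF less.prems] by simp
  next
    case True
    hence ad: "a * d = 1" using less.prems by simp
    hence "a = 1 \<and> d = 1 \<or> a = - 1 \<and> d = - 1" by (metis pos_zmult_eq_1_iff_lemma zmult_eq_1_iff)
    hence "b = (b * a) * a + 0" "d = (b * a) * c + d" "a = d" "d = 1 \<or> d = - 1" using True by auto
    have base: "eta2_law d 0 0 d"
      using \<open>d = 1 \<or> d = - 1\<close>
    proof
      assume "d = 1" thus ?thesis by (simp add: eta2_law_def eta_exp_def eta_exp3_def eta_exp4_def)
    next
      assume d: "d = - 1"
      have "nome (of_int (eta_exp (- 1) 0 0 (- 1)) / 12) = nome (of_int 6 / 12)"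
        by (rule nome_cong_12) (simp add: eta_exp_def eta_exp3_def eta_exp4_def cong_def)
      also have "\<dots> = - 1" by (simp add: nome_def)
      finally show ?thesis using d by (simp add: eta2_law_def)
    qed
    have "eta2_law a ((b * a) * a + 0) 0 ((b * a) * 0 + d) \<longleftrightarrow> eta2_law a 0 0 d"
      by (rule eta2_law_T_int) (use ad in simp)
    moreover have "(b * a) * a + 0 = b" "(b * a) * 0 + d = d" using \<open>a = d\<close> ad by (simp_all add: mult.assoc)
    ultimately show ?thesis using base \<open>a = d\<close> True by (simp only:)
  qed
qed

section \<open>Behaviour near the cusps\<close>

abbreviation mob :: "int \<Rightarrow> int \<Rightarrow> int \<Rightarrow> int \<Rightarrow> complex \<Rightarrow> complex" where
  "mob a b c d z \<equiv> (of_int a * z + of_int b) / (of_int c * z + of_int d)"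

definition mat2 :: "int \<Rightarrow> int \<Rightarrow> int \<Rightarrow> int \<Rightarrow> int^2^2" where
  "mat2 a b c d = vector [vector [a, b], vector [c, d]]"

lemma mat2_entries [simp]:
  "mat2 a b c d $ 1 $ 1 = a" "mat2 a b c d $ 1 $ 2 = b"
  "mat2 a b c d $ 2 $ 1 = c" "mat2 a b c d $ 2 $ 2 = d"
  by (simp_all add: mat2_def)

lemma mat2_exhaust: obtains a b c d where "M = mat2 a b c d"
proof -
  have "M = mat2 (M $ 1 $ 1) (M $ 1 $ 2) (M $ 2 $ 1) (M $ 2 $ 2)"
    by (simp add: vec_eq_iff forall_2)
  thus ?thesis using that by blast
qed

lemma mat2_SL2Z: "mat2 a b c d \<in> SL2Z \<longleftrightarrow> a * d - b * c = 1"
  by (simp add: SL2Z_def det_2)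

lemma mat2_Gamma0: "mat2 a b c d \<in> Gamma0 N \<longleftrightarrow> a * d - b * c = 1 \<and> int N dvd c"
  by (simp add: Gamma0_def mat2_SL2Z)

lemma slash_mat2: "slash k f (mat2 a b c d) z = (of_int c * z + of_int d) powi (- k) * f (mob a b c d z)"
  by (simp add: slash_def automorphy_def moebius_act_def)

text \<open>
  Neighbourhoods of \<open>\<i>\<infinity>\<close>: the half planes above a horizontal line.
\<close>

definition ii_inf :: "complex filter" where
  "ii_inf = filtercomap Im at_top"

lemma eventually_ii_inf: "eventually P ii_inf \<longleftrightarrow> (\<exists>y. \<forall>z. Im z > y \<longrightarrow> P z)"
  unfolding ii_inf_def by (rule eventually_filtercomap_at_top_dense)

lemma ii_inf_neq_bot [simp]: "ii_inf \<noteq> bot"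
proof
  assume "ii_inf = bot"
  hence "eventually (\<lambda>_. False) ii_inf" by simp
  then obtain y where "\<And>z. \<not> Im z > y" by (auto simp: eventually_ii_inf)
  from this[of "Complex 0 (y + 1)"] show False by simp
qed

lemma filterlim_Im_ii_inf: "filterlim Im at_top ii_inf"
  unfolding ii_inf_def by (rule filterlim_filtercomap)

lemma eventually_uhp: "eventually (\<lambda>z. z \<in> uhp) ii_inf"
  unfolding eventually_ii_inf uhp_def by auto

lemma filterlim_nome:
  assumes "r > 0"
  shows "filterlim (\<lambda>z. nome (of_real r * z + c)) (at 0) ii_inf"
  unfolding filterlim_at
proof
  have "filterlim (\<lambda>z. 2 * pi * r * Im z + 2 * pi * Im c) at_top ii_inf"
    unfolding add.commute[of _ "2 * pi * Im c"]
    by (intro filterlim_tendsto_add_at_top[OF tendsto_const] filterlim_tendsto_pos_mult_at_top[OF tendsto_const _ filterlim_Im_ii_inf])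
       (use assms in auto)
  hence "((\<lambda>z. exp (- (2 * pi * r * Im z + 2 * pi * Im c))) \<longlongrightarrow> 0) ii_inf"
    by (intro filterlim_compose[OF exp_at_bot] filterlim_compose[OF filterlim_uminus_at_bot_at_top])
  hence "((\<lambda>z. norm (nome (of_real r * z + c))) \<longlongrightarrow> 0) ii_inf"
    by (simp add: norm_nome algebra_simps)
  thus "((\<lambda>z. nome (of_real r * z + c)) \<longlongrightarrow> 0) ii_inf"
    by (simp add: tendsto_norm_zero_iff)
qed simp

lemma nome_eq_iff: "nome x = nome y \<longleftrightarrow> (\<exists>n. x = y + of_int n)"
proof -
  have "nome x = nome y \<longleftrightarrow> (\<exists>n::int. 2 * of_real pi * \<i> * x = 2 * of_real pi * \<i> * y + (of_int (2 * n) * pi) * \<i>)"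
    unfolding nome_def exp_eq by (simp add: mult_ac)
  also have "\<dots> \<longleftrightarrow> (\<exists>n::int. 2 * of_real pi * \<i> * x = 2 * of_real pi * \<i> * (y + of_int n))"
    by (simp add: algebra_simps)
  finally show ?thesis by simp
qed

lemma nome_surj:
  assumes "w \<noteq> 0"
  obtains z where "nome z = w" "Im z = - ln (norm w) / (2 * pi)"
proof
  show "nome (Ln w / (2 * of_real pi * \<i>)) = w" using assms by (simp add: nome_def)
  show "Im (Ln w / (2 * of_real pi * \<i>)) = - ln (norm w) / (2 * pi)"
    using assms by (simp add: Im_divide power2_eq_square)
qed

text \<open>
  A periodic holomorphic function factors through the exponential. Around the branch cut of the
  logarithm, the other branch \<open>Ln (-w) + \<pi> \<i>\<close> is used.
\<close>

lemma periodic_factorization: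
  fixes N :: nat
  assumes N: "N > 0" and hol: "g holomorphic_on uhp"
    and per: "\<And>z. z \<in> uhp \<Longrightarrow> g (z + of_nat N) = g z"
  obtains F where "F holomorphic_on ball 0 1 - {0}" "\<And>z. z \<in> uhp \<Longrightarrow> g z = F (nome (z / of_nat N))"
proof -
  have per': "g (z + of_nat N * of_int n) = g z" if "z \<in> uhp" for z n
  proof -
    have z: "z + of_nat N * of_int n \<in> uhp" for n using that by (simp add: uhp_def)
    show ?thesis
    proof (induction n rule: int_induct[of _ 0])
      case (step1 i)
      thus ?case using per[OF z[of i]] by (simp add: algebra_simps)
    next
      case (step2 i)
      thus ?case using per[OF z[of "i - 1"]] by (simp add: algebra_simps)
    qed simp
  qed
  have eqI: "g z = g z'" if zz': "nome (z / of_nat N) = nome (z' / of_nat N)" "z' \<in> uhp" for z z'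
  proof -
    obtain n where "z / of_nat N = z' / of_nat N + of_int n" using zz'(1) unfolding nome_eq_iff by blast
    hence "z = z' + of_nat N * of_int n" using N by (simp add: field_simps)
    thus ?thesis using per'[OF zz'(2)] by simp
  qed
  define L where "L = (\<lambda>w. of_nat N * (Ln w / (2 * of_real pi * \<i>)))"
  define L' where "L' = (\<lambda>w. of_nat N * ((Ln (- w) + \<i> * of_real pi) / (2 * of_real pi * \<i>)))"
  define F where "F = (\<lambda>w. g (L w))"
  have nL: "nome (L w / of_nat N) = w" "nome (L' w / of_nat N) = w" if "w \<noteq> 0" for w
    using that N by (auto simp: L_def L'_def nome_def exp_add)
  have "norm w = exp (- 2 * pi * Im (L w) / N)" "norm w = exp (- 2 * pi * Im (L' w) / N)" if "w \<noteq> 0" for w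
    using arg_cong[OF nL(1)[OF that], of norm] arg_cong[OF nL(2)[OF that], of norm] by (simp_all add: norm_nome)
  hence L: "L w \<in> uhp" "L' w \<in> uhp" if "w \<in> ball 0 1 - {0}" for w
    using that N by (auto simp: uhp_def zero_less_mult_iff divide_less_0_iff zero_less_divide_iff)
  have F_eq: "F w = g (L' w)" if "w \<in> ball 0 1 - {0}" for w
    unfolding F_def by (rule eqI) (use that nL L in auto)
  have "(g \<circ> L) holomorphic_on (ball 0 1 - {0} - \<real>\<^sub>\<le>\<^sub>0)"
  proof (rule holomorphic_on_compose_gen[OF _ hol])
    show "L holomorphic_on (ball 0 1 - {0} - \<real>\<^sub>\<le>\<^sub>0)"
      unfolding L_def by (intro holomorphic_intros) auto
    show "L ` (ball 0 1 - {0} - \<real>\<^sub>\<le>\<^sub>0) \<subseteq> uhp" using L(1) by blast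
  qed
  hence 1: "F holomorphic_on (ball 0 1 - {0} - \<real>\<^sub>\<le>\<^sub>0)" by (simp add: F_def o_def)
  have neg: "- w \<notin> \<real>\<^sub>\<le>\<^sub>0" if "w \<notin> \<real>\<^sub>\<ge>\<^sub>0" for w :: complex
    using that by (auto simp: complex_nonpos_Reals_iff complex_nonneg_Reals_iff)
  have "(g \<circ> L') holomorphic_on (ball 0 1 - {0} - \<real>\<^sub>\<ge>\<^sub>0)"
  proof (rule holomorphic_on_compose_gen[OF _ hol])
    show "L' holomorphic_on (ball 0 1 - {0} - \<real>\<^sub>\<ge>\<^sub>0)"
      unfolding L'_def by (intro holomorphic_intros) (use neg in auto)
    show "L' ` (ball 0 1 - {0} - \<real>\<^sub>\<ge>\<^sub>0) \<subseteq> uhp" using L(2) by blast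
  qed
  hence 2: "F holomorphic_on (ball 0 1 - {0} - \<real>\<^sub>\<ge>\<^sub>0)"
    by (rule holomorphic_transform) (use F_eq in \<open>auto simp: o_def\<close>)
  have op: "open (ball (0::complex) 1 - {0} - \<real>\<^sub>\<le>\<^sub>0)" "open (ball (0::complex) 1 - {0} - \<real>\<^sub>\<ge>\<^sub>0)"
    by (intro open_Diff closed_nonpos_Reals_complex closed_nonneg_Reals_complex; simp)+
  have "F holomorphic_on ((ball 0 1 - {0} - \<real>\<^sub>\<le>\<^sub>0) \<union> (ball 0 1 - {0} - \<real>\<^sub>\<ge>\<^sub>0))"
    by (rule holomorphic_on_Un[OF 1 2 op])
  also have "(ball 0 1 - {0} - \<real>\<^sub>\<le>\<^sub>0) \<union> (ball 0 1 - {0} - \<real>\<^sub>\<ge>\<^sub>0) = ball 0 1 - {0::complex}"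
    by (auto simp: complex_nonpos_Reals_iff complex_nonneg_Reals_iff complex_eq_iff)
  finally have "F holomorphic_on ball 0 1 - {0}" .
  moreover have "g z = F (nome (z / of_nat N))" if "z \<in> uhp" for z
  proof -
    have "nome (z / of_nat N) \<in> ball 0 1 - {0}" using that N by (auto simp: norm_nome uhp_def)
    hence "g (L (nome (z / of_nat N))) = g z" by (intro eqI) (use that nL in auto)
    thus ?thesis by (simp add: F_def)
  qed
  ultimately show ?thesis using that by blast
qed

text \<open>
  Boundedness near \<open>\<i>\<infinity>\<close> makes the singularity of the factor at \<open>0\<close> removable.
\<close>

lemma periodic_bounded_extension:
  fixes N :: nat
  assumes N: "N > 0" and hol: "g holomorphic_on uhp"
    and per: "\<And>z. z \<in> uhp \<Longrightarrow> g (z + of_nat N) = g z"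
    and bd: "eventually (\<lambda>z. norm (g z) \<le> C) ii_inf"
  obtains F where "F holomorphic_on ball 0 1" "\<And>z. z \<in> uhp \<Longrightarrow> g z = F (nome (z / of_nat N))"
proof -
  obtain F where F: "F holomorphic_on ball 0 1 - {0}" "\<And>z. z \<in> uhp \<Longrightarrow> g z = F (nome (z / of_nat N))"
    using periodic_factorization[OF N hol per] by metis
  obtain y where y: "\<And>z. Im z > y \<Longrightarrow> norm (g z) \<le> C" using bd by (auto simp: eventually_ii_inf)
  define r where "r = min 1 (exp (- 2 * pi * y / N))"
  have r: "r > 0" by (simp add: r_def)
  have "norm (F w) \<le> C" if w: "w \<noteq> 0" "norm w < r" for w
  proof -
    obtain z where z: "nome z = w" "Im z = - ln (norm w) / (2 * pi)" using nome_surj[OF w(1)] by metis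
    have "ln (norm w) < ln (exp (- 2 * pi * y / N))" 
      using w by (subst ln_less_cancel_iff) (auto simp: r_def)
    hence "N * Im z > y" using N by (simp add: z(2) field_simps)
    moreover have "Im z > 0" using w by (auto simp: z(2) r_def field_simps)
    ultimately show ?thesis
      using y[of "of_nat N * z"] F(2)[of "of_nat N * z"] N by (simp add: uhp_def z(1))
  qed
  hence "eventually (\<lambda>w. norm (F w) \<le> C) (at 0)"
    unfolding eventually_at by (intro exI[of _ r]) (use r in auto)
  then obtain G where G: "G holomorphic_on ball 0 1" "\<And>w. w \<in> ball 0 1 - {0} \<Longrightarrow> G w = F w"
    using holomorphic_on_extend_bounded[OF F(1)] by auto
  have "g z = G (nome (z / of_nat N))" if "z \<in> uhp" for z
    using that F(2)[OF that] G(2)[of "nome (z / of_nat N)"] N by (auto simp: norm_nome uhp_def)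
  thus ?thesis using that G(1) by blast
qed

lemma holomorphic_at_ii_infinityI:
  assumes "N > 0" "g holomorphic_on uhp" "\<And>z. z \<in> uhp \<Longrightarrow> g (z + of_nat N) = g z"
    "eventually (\<lambda>z. norm (g z) \<le> C) ii_inf"
  shows "holomorphic_at_ii_infinity N g"
proof -
  obtain F where F: "F holomorphic_on ball 0 1" "\<And>z. z \<in> uhp \<Longrightarrow> g z = F (nome (z / of_nat N))"
    using periodic_bounded_extension[OF assms] by metis
  have "F analytic_on {0}" using F(1) by (auto simp: analytic_at intro!: exI[of _ "ball 0 1"])
  thus ?thesis unfolding holomorphic_at_ii_infinity_def
    by (intro exI[of _ F] exI[of _ 0]) (use F(2) in \<open>auto simp: uhp_def nome_def\<close>)
qed

text \<open>
  Multiplication by a power of the local parameter makes the function bounded.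
\<close>

lemma meromorphic_at_ii_infinityI:
  assumes N: "N > 0" and hol: "g holomorphic_on uhp" and per: "\<And>z. z \<in> uhp \<Longrightarrow> g (z + of_nat N) = g z"
    and bd: "eventually (\<lambda>z. norm (g z) \<le> C * exp (K * Im z)) ii_inf"
  shows "meromorphic_at_ii_infinity N g"
proof -
  define m where "m = nat \<lceil>\<bar>K\<bar> * N / (2 * pi)\<rceil>"
  have "m \<ge> \<bar>K\<bar> * N / (2 * pi)" unfolding m_def by linarith
  hence m: "2 * pi * m / N \<ge> \<bar>K\<bar>" using N by (simp add: field_simps)
  have bd': "eventually (\<lambda>z. norm (g z * nome (z / of_nat N) ^ m) \<le> \<bar>C\<bar>) ii_inf"
    using bd eventually_uhp
  proof eventually_elim
    case (elim z)
    have "Im z > 0" using elim by (simp add: uhp_def)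
    have "norm (g z * nome (z / of_nat N) ^ m) = norm (g z) * exp (- (2 * pi * m / N) * Im z)"
      by (simp add: norm_mult norm_power norm_nome exp_of_nat_mult[symmetric] mult_ac)
    also have "\<dots> \<le> (C * exp (K * Im z)) * exp (- (2 * pi * m / N) * Im z)"
      using elim by (intro mult_right_mono) auto
    also have "\<dots> \<le> \<bar>C\<bar> * (exp (K * Im z) * exp (- (2 * pi * m / N) * Im z))"
      by (simp add: mult_right_mono mult.assoc)
    also have "exp (K * Im z) * exp (- (2 * pi * m / N) * Im z) = exp ((K - 2 * pi * m / N) * Im z)"
      by (simp add: exp_add[symmetric] algebra_simps)
    also have "\<bar>C\<bar> * \<dots> \<le> \<bar>C\<bar> * 1"
      using m \<open>Im z > 0\<close> by (intro mult_left_mono) (auto intro!: mult_nonpos_nonneg)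
    finally show ?case by simp
  qed
  have hol': "(\<lambda>z. g z * nome (z / of_nat N) ^ m) holomorphic_on uhp"
    using N by (intro holomorphic_intros hol) auto
  have "nome ((z + of_nat N) / of_nat N) = nome (z / of_nat N)" for z
    using N nome_of_int[of 1] by (simp add: add_divide_distrib nome_add)
  hence per': "g (z + of_nat N) * nome ((z + of_nat N) / of_nat N) ^ m = g z * nome (z / of_nat N) ^ m" if "z \<in> uhp" for z
    using per[OF that] by simp
  obtain F where F: "F holomorphic_on ball 0 1" "\<And>z. z \<in> uhp \<Longrightarrow> g z * nome (z / of_nat N) ^ m = F (nome (z / of_nat N))"
    using periodic_bounded_extension[OF N hol' per' bd'] by blast
  have "F analytic_on {0}" using F(1) by (auto simp: analytic_at intro!: exI[of _ "ball 0 1"])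
  hence "(\<lambda>w. F w / w ^ m) meromorphic_on {0}"
    by (intro meromorphic_intros analytic_on_imp_meromorphic_on)
  moreover have "g z = F (nome (z / of_nat N)) / nome (z / of_nat N) ^ m" if "Im z > 0" for z
    using F(2)[of z] that by (simp add: uhp_def field_simps)
  ultimately show ?thesis unfolding meromorphic_at_ii_infinity_def
    by (intro exI[of _ "\<lambda>w. F w / w ^ m"] exI[of _ 0]) (auto simp: nome_def)
qed

lemma holomorphic_at_ii_infinityD:
  assumes "holomorphic_at_ii_infinity N g" "N > 0"
  shows "\<exists>C. eventually (\<lambda>z. norm (g z) \<le> C) ii_inf"
proof -
  obtain F y where F: "F analytic_on {0}" "\<And>z. Im z > y \<Longrightarrow> g z = F (nome (z / of_nat N))"
    using assms by (auto simp: holomorphic_at_ii_infinity_def nome_def)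
  have "filterlim (\<lambda>z. nome (z / of_nat N)) (at 0) ii_inf"
    using filterlim_nome[of "1 / N" 0] assms(2) by simp
  moreover have "isCont F 0" using F(1) analytic_at_imp_isCont by blast
  ultimately have "((\<lambda>z. F (nome (z / of_nat N))) \<longlongrightarrow> F 0) ii_inf"
    by (auto simp: isCont_def intro: filterlim_compose)
  hence "((\<lambda>z. norm (F (nome (z / of_nat N)))) \<longlongrightarrow> norm (F 0)) ii_inf" by (rule tendsto_norm)
  hence "eventually (\<lambda>z. norm (F (nome (z / of_nat N))) < norm (F 0) + 1) ii_inf"
    by (rule order_tendstoD) simp
  moreover have "eventually (\<lambda>z. g z = F (nome (z / of_nat N))) ii_inf"
    using F(2) by (auto simp: eventually_ii_inf)
  ultimately have "eventually (\<lambda>z. norm (g z) \<le> norm (F 0) + 1) ii_inf"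
    by eventually_elim simp
  thus ?thesis by blast
qed

section \<open>Membership in the spaces of modular forms\<close>

definition invariant_form :: "int \<Rightarrow> nat \<Rightarrow> (complex \<Rightarrow> complex) \<Rightarrow> bool" where
  "invariant_form k N f \<longleftrightarrow> (\<forall>a b c d. a * d - b * c = 1 \<longrightarrow> int N dvd c \<longrightarrow>
     (\<forall>z\<in>uhp. f (mob a b c d z) = (of_int c * z + of_int d) powi k * f z))"

lemma invariant_formD:
  "invariant_form k N f \<Longrightarrow> a * d - b * c = 1 \<Longrightarrow> int N dvd c \<Longrightarrow> z \<in> uhp \<Longrightarrow>
     f (mob a b c d z) = (of_int c * z + of_int d) powi k * f z"
  unfolding invariant_form_def by blast

text \<open>
  The cusp \<open>a / c\<close> is equivalent to \<open>\<infinity>\<close> under \<open>\<Gamma>\<^sub>0(N)\<close> exactly if \<open>N\<close> divides \<open>c\<close>. The conditions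
  at the cusps thereby become conditions on all unimodular matrices, in terms of the lower left
  entry.
\<close>

lemma moebius_infinity_in_cusp_infinity_iff:
  assumes "a * d - b * c = 1"
  shows "moebius_infinity (mat2 a b c d) \<in> cusp_infinity N \<longleftrightarrow> int N dvd c"
proof
  assume "int N dvd c"
  thus "moebius_infinity (mat2 a b c d) \<in> cusp_infinity N"
    using assms by (auto simp: cusp_infinity_def mat2_Gamma0)
next
  assume "moebius_infinity (mat2 a b c d) \<in> cusp_infinity N"
  then obtain M where M: "M \<in> Gamma0 N" "moebius_infinity (mat2 a b c d) = moebius_infinity M"
    by (auto simp: cusp_infinity_def)
  obtain a' b' c' d' where M': "M = mat2 a' b' c' d'" by (rule mat2_exhaust)
  have G: "a' * d' - b' * c' = 1" "int N dvd c'" using M(1) by (auto simp: M' mat2_Gamma0)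
  show "int N dvd c"
  proof (cases "c' = 0 \<or> c = 0")
    case True
    thus ?thesis using M(2) by (auto simp: M' moebius_infinity_def split: if_splits)
  next
    case False
    hence "(of_int a / of_int c :: rat) = of_int a' / of_int c'"
      using M(2) by (simp add: M' moebius_infinity_def)
    hence "(of_int (a * c') :: rat) = of_int (a' * c)" using False by (simp add: field_simps)
    hence eq: "a * c' = a' * c" by (simp only: of_int_eq_iff)
    have "coprime c' a'"
    proof (rule coprimeI)
      fix x assume "x dvd c'" "x dvd a'"
      hence "x dvd a' * d' - b' * c'" by simp
      thus "is_unit x" using G(1) by simp
    qed
    moreover have "c' dvd a' * c" by (metis eq dvd_triv_right)
    ultimately have "c' dvd c" by (simp add: coprime_dvd_mult_right_iff)
    thus ?thesis using G(2) dvd_trans by blast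
  qed
qed

lemma weakly_holomorphic_forms_iff:
  "f \<in> weakly_holomorphic_forms k N \<longleftrightarrow> (\<forall>z. z \<notin> uhp \<longrightarrow> f z = 0) \<and> f holomorphic_on uhp \<and>
     invariant_form k N f \<and>
     (\<forall>a b c d. a * d - b * c = 1 \<longrightarrow> meromorphic_at_ii_infinity N (slash k f (mat2 a b c d)))"
proof -
  have "(\<forall>M \<in> Gamma0 N. \<forall>z \<in> uhp. f (moebius_act M z) = automorphy M z powi k * f z) \<longleftrightarrow> invariant_form k N f"
    unfolding invariant_form_def
    by (metis automorphy_def mat2_Gamma0 mat2_entries mat2_exhaust moebius_act_def)
  moreover have "(\<forall>s. meromorphic_at_cusp k N f s) \<longleftrightarrow>
     (\<forall>a b c d. a * d - b * c = 1 \<longrightarrow> meromorphic_at_ii_infinity N (slash k f (mat2 a b c d)))"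
    unfolding meromorphic_at_cusp_def by (metis mat2_SL2Z mat2_exhaust)
  ultimately show ?thesis unfolding weakly_holomorphic_forms_def by simp
qed

lemma R_space_iff:
  "f \<in> R_space k N \<longleftrightarrow> (\<forall>z. z \<notin> uhp \<longrightarrow> f z = 0) \<and> f holomorphic_on uhp \<and>
     invariant_form k N f \<and>
     (\<forall>a b c d. a * d - b * c = 1 \<longrightarrow> meromorphic_at_ii_infinity N (slash k f (mat2 a b c d))) \<and>
     (\<forall>a b c d. a * d - b * c = 1 \<longrightarrow> \<not> int N dvd c \<longrightarrow> holomorphic_at_ii_infinity N (slash k f (mat2 a b c d)))"
proof -
  have "(\<forall>s. s \<notin> cusp_infinity N \<longrightarrow> holomorphic_at_cusp k N f s) \<longleftrightarrow>
     (\<forall>a b c d. a * d - b * c = 1 \<longrightarrow> \<not> int N dvd c \<longrightarrow> holomorphic_at_ii_infinity N (slash k f (mat2 a b c d)))"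
    unfolding holomorphic_at_cusp_def
    by (metis mat2_SL2Z mat2_exhaust moebius_infinity_in_cusp_infinity_iff)
  thus ?thesis unfolding R_space_def using weakly_holomorphic_forms_iff by auto
qed

lemma holomorphic_slash:
  assumes "f holomorphic_on uhp" "a * d - b * c = 1"
  shows "slash k f (mat2 a b c d) holomorphic_on uhp"
proof -
  have "(f \<circ> mob a b c d) holomorphic_on uhp"
    by (rule holomorphic_on_compose_gen[OF _ assms(1)])
       (use uhp_lin_nonzero[OF _ assms(2)] uhp_moebius(2)[OF _ assms(2)] in \<open>auto intro!: holomorphic_intros\<close>)
  thus ?thesis unfolding slash_mat2[abs_def] o_def
    using uhp_lin_nonzero[OF _ assms(2)] by (intro holomorphic_intros) auto
qed

text \<open>
  The matrix conjugates the translation by \<open>N\<close> into an element of \<open>\<Gamma>\<^sub>0(N)\<close>.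
\<close>

lemma slash_periodic:
  assumes inv: "invariant_form k N f" and det: "a * d - b * c = 1" and z: "z \<in> uhp"
  shows "slash k f (mat2 a b c d) (z + of_nat N) = slash k f (mat2 a b c d) z"
proof -
  define n where "n = int N"
  define w where "w = mob a b c d z"
  define J where "J = of_int c * z + of_int d"
  define J' where "J' = of_int c * (z + of_int n) + of_int d"
  have nz: "J \<noteq> 0" "J' \<noteq> 0"
    using uhp_lin_nonzero[OF z det] uhp_lin_nonzero[OF _ det, of "z + of_int n"] z by (auto simp: J_def J'_def uhp_def)
  have w: "w \<in> uhp" unfolding w_def by (rule uhp_moebius(2)[OF z det])
  have wJ: "w = (of_int a * z + of_int b) / J" by (simp add: w_def J_def)
  have detC: "of_int a * of_int d - of_int b * of_int c = (1::complex)"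
    using det by (metis of_int_1 of_int_diff of_int_mult)
  have den: "of_int (- n * c * c) * w + of_int (1 + n * a * c) = J' / J"
  proof -
    have "(of_int (- n * c * c) * w + of_int (1 + n * a * c)) * J = of_int (- n * c * c) * (of_int a * z + of_int b) + of_int (1 + n * a * c) * J"
      unfolding wJ distrib_right mult.assoc using nz(1) by simp
    also have "\<dots> = J + of_int n * of_int c * (of_int a * of_int d - of_int b * of_int c)"
      by (simp add: J_def algebra_simps)
    also have "\<dots> = J'" unfolding detC by (simp add: J_def J'_def algebra_simps)
    finally show ?thesis using nz(1) by (simp add: field_simps)
  qed
  have num: "of_int (1 - n * a * c) * w + of_int (n * a * a) = (of_int a * (z + of_int n) + of_int b) / J"
  proof -
    have "(of_int (1 - n * a * c) * w + of_int (n * a * a)) * J = of_int (1 - n * a * c) * (of_int a * z + of_int b) + of_int (n * a * a) * J"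
      unfolding wJ distrib_right mult.assoc using nz(1) by simp
    also have "\<dots> = of_int a * z + of_int b + of_int n * of_int a * (of_int a * of_int d - of_int b * of_int c)"
      by (simp add: J_def algebra_simps)
    also have "\<dots> = of_int a * (z + of_int n) + of_int b" unfolding detC by (simp add: algebra_simps)
    finally show ?thesis using nz(1) by (simp add: field_simps)
  qed
  have "mob (1 - n * a * c) (n * a * a) (- n * c * c) (1 + n * a * c) w = mob a b c d (z + of_int n)"
    unfolding num den J'_def[symmetric] using nz by simp
  moreover have "f (mob (1 - n * a * c) (n * a * a) (- n * c * c) (1 + n * a * c) w) = (J' / J) powi k * f w"
    unfolding den[symmetric] by (rule invariant_formD[OF inv _ _ w]) (auto simp: n_def algebra_simps)
  ultimately have "f (mob a b c d (z + of_int n)) = (J' / J) powi k * f w" by simp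
  hence "slash k f (mat2 a b c d) (z + of_int n) = J' powi (- k) * ((J' / J) powi k * f w)"
    by (simp only: slash_mat2 J'_def)
  also have "\<dots> = J powi (- k) * f w"
    using nz by (simp add: power_int_minus power_int_divide_distrib field_simps)
  finally show ?thesis by (simp add: slash_mat2 J_def w_def n_def)
qed

lemma slash_ii_infinityI:
  assumes "N > 0" "f holomorphic_on uhp" "invariant_form k N f" "a * d - b * c = 1"
  shows "eventually (\<lambda>z. norm (slash k f (mat2 a b c d) z) \<le> C) ii_inf \<Longrightarrow>
           holomorphic_at_ii_infinity N (slash k f (mat2 a b c d))"
    and "eventually (\<lambda>z. norm (slash k f (mat2 a b c d) z) \<le> C * exp (K * Im z)) ii_inf \<Longrightarrow>
           meromorphic_at_ii_infinity N (slash k f (mat2 a b c d))"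
  using assms holomorphic_at_ii_infinityI[OF assms(1) holomorphic_slash[OF assms(2,4)]]
    meromorphic_at_ii_infinityI[OF assms(1) holomorphic_slash[OF assms(2,4)]]
    slash_periodic[OF assms(3,4)] by blast+

section \<open>Growth of eta-quotients\<close>

text \<open>
  The real number \<open>\<alpha>\<close> is the order of \<open>g\<close> at \<open>\<i>\<infinity>\<close> measured in \<open>q\<close>; it can be fractional, and the
  leading coefficient is determined only in modulus.
\<close>

definition ii_growth :: "(complex \<Rightarrow> complex) \<Rightarrow> real \<Rightarrow> bool" where
  "ii_growth g \<alpha> \<longleftrightarrow> (\<exists>C>0. ((\<lambda>z. norm (g z) * exp (2 * pi * \<alpha> * Im z)) \<longlongrightarrow> C) ii_inf)"

lemma ii_growth_const: "c \<noteq> 0 \<Longrightarrow> ii_growth (\<lambda>z. c) 0"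
  unfolding ii_growth_def by (intro exI[of _ "norm c"]) auto

lemma ii_growth_mult:
  assumes "ii_growth f \<alpha>" "ii_growth g \<beta>"
  shows "ii_growth (\<lambda>z. f z * g z) (\<alpha> + \<beta>)"
proof -
  obtain C D where "C > 0" "D > 0" "((\<lambda>z. norm (f z) * exp (2 * pi * \<alpha> * Im z)) \<longlongrightarrow> C) ii_inf"
    "((\<lambda>z. norm (g z) * exp (2 * pi * \<beta> * Im z)) \<longlongrightarrow> D) ii_inf"
    using assms by (auto simp: ii_growth_def)
  moreover from tendsto_mult[OF this(3,4)]
  have "((\<lambda>z. norm (f z * g z) * exp (2 * pi * (\<alpha> + \<beta>) * Im z)) \<longlongrightarrow> C * D) ii_inf"
    by (simp add: norm_mult exp_add distrib_left distrib_right mult_ac)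
  ultimately show ?thesis unfolding ii_growth_def by (intro exI[of _ "C * D"]) auto
qed

lemma ii_growth_powi:
  assumes "ii_growth f \<alpha>"
  shows "ii_growth (\<lambda>z. f z powi n) (\<alpha> * of_int n)"
proof -
  obtain C where C: "C > 0" "((\<lambda>z. norm (f z) * exp (2 * pi * \<alpha> * Im z)) \<longlongrightarrow> C) ii_inf"
    using assms by (auto simp: ii_growth_def)
  have "((\<lambda>z. (norm (f z) * exp (2 * pi * \<alpha> * Im z)) powi n) \<longlongrightarrow> C powi n) ii_inf"
    by (rule tendsto_power_int[OF C(2)]) (use C in auto)
  moreover have "(norm (f z) * exp (2 * pi * \<alpha> * Im z)) powi n = norm (f z powi n) * exp (2 * pi * (\<alpha> * of_int n) * Im z)" for z
    by (simp add: power_int_mult_distrib norm_power_int exp_power_int mult_ac)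
  ultimately show ?thesis unfolding ii_growth_def using C(1) by (intro exI[of _ "C powi n"]) auto
qed

lemma ii_growth_prod:
  assumes "finite A" "\<And>x. x \<in> A \<Longrightarrow> ii_growth (f x) (\<alpha> x)"
  shows "ii_growth (\<lambda>z. \<Prod>x\<in>A. f x z) (\<Sum>x\<in>A. \<alpha> x)"
  using assms
proof (induction A rule: finite_induct)
  case empty
  show ?case using ii_growth_const[of 1] by simp
next
  case (insert x A)
  thus ?case using ii_growth_mult[of "f x" "\<alpha> x"] by simp
qed

lemma ii_growth_cong:
  assumes "eventually (\<lambda>z. f z = g z) ii_inf" "ii_growth f \<alpha>"
  shows "ii_growth g \<alpha>"
proof -
  obtain C where C: "C > 0" "((\<lambda>z. norm (f z) * exp (2 * pi * \<alpha> * Im z)) \<longlongrightarrow> C) ii_inf"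
    using assms by (auto simp: ii_growth_def)
  have "((\<lambda>z. norm (g z) * exp (2 * pi * \<alpha> * Im z)) \<longlongrightarrow> C) ii_inf"
    by (rule Lim_transform_eventually[OF C(2)]) (use assms(1) in \<open>auto elim: eventually_mono\<close>)
  thus ?thesis using C(1) by (auto simp: ii_growth_def)
qed

lemma ii_growth_bound:
  assumes "ii_growth g \<alpha>"
  shows "\<exists>C>0. eventually (\<lambda>z. norm (g z) \<le> C * exp (- (2 * pi * \<alpha>) * Im z)) ii_inf"
proof -
  obtain C where C: "C > 0" "((\<lambda>z. norm (g z) * exp (2 * pi * \<alpha> * Im z)) \<longlongrightarrow> C) ii_inf"
    using assms by (auto simp: ii_growth_def)
  have "eventually (\<lambda>z. norm (g z) * exp (2 * pi * \<alpha> * Im z) < C + 1) ii_inf"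
    by (rule order_tendstoD(2)[OF C(2)]) simp
  hence "eventually (\<lambda>z. norm (g z) \<le> (C + 1) * exp (- (2 * pi * \<alpha>) * Im z)) ii_inf"
  proof eventually_elim
    case (elim z)
    have "norm (g z) = (norm (g z) * exp (2 * pi * \<alpha> * Im z)) * exp (- (2 * pi * \<alpha>) * Im z)"
      by (simp add: exp_minus field_simps)
    also have "\<dots> \<le> (C + 1) * exp (- (2 * pi * \<alpha>) * Im z)" using elim by (intro mult_right_mono) auto
    finally show ?case .
  qed
  thus ?thesis using C(1) by (intro exI[of _ "C + 1"]) auto
qed

lemma ii_growth_bounded:
  assumes "ii_growth g \<alpha>" "\<alpha> \<ge> 0"
  shows "\<exists>C>0. eventually (\<lambda>z. norm (g z) \<le> C) ii_inf"
proof -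
  obtain C where C: "C > 0" "eventually (\<lambda>z. norm (g z) \<le> C * exp (- (2 * pi * \<alpha>) * Im z)) ii_inf"
    using ii_growth_bound[OF assms(1)] by blast
  have "eventually (\<lambda>z. norm (g z) \<le> C) ii_inf"
    using C(2) eventually_uhp
  proof eventually_elim
    case (elim z)
    have "C * exp (- (2 * pi * \<alpha>) * Im z) \<le> C * 1"
      using C(1) assms(2) elim by (intro mult_left_mono) (auto simp: uhp_def)
    thus ?case using elim by simp
  qed
  thus ?thesis using C(1) by blast
qed

lemma ii_growth_eta2:
  assumes "r > 0"
  shows "ii_growth (\<lambda>z. eta2 (of_real r * z + c)) (r / 12)"
proof -
  have "isCont euler_prod 0"
    using euler_prod_deriv_0 DERIV_isCont by blast
  hence "((\<lambda>z. euler_prod (nome (of_real r * z + c))) \<longlongrightarrow> 1) ii_inf"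
    using filterlim_compose[OF _ filterlim_nome[OF assms], of euler_prod "nhds 1"] by (simp add: isCont_def)
  hence "((\<lambda>z. norm (euler_prod (nome (of_real r * z + c))) ^ 2 * exp (- (pi * Im c / 6))) \<longlongrightarrow> norm (1::complex) ^ 2 * exp (- (pi * Im c / 6))) ii_inf"
    by (intro tendsto_intros)
  moreover have "norm (euler_prod (nome (of_real r * z + c))) ^ 2 * exp (- (pi * Im c / 6)) =
      norm (eta2 (of_real r * z + c)) * exp (2 * pi * (r / 12) * Im z)" for z
    by (simp add: eta2_def dedekind_eta_altdef norm_mult norm_power norm_nome power_mult_distrib exp_add[symmetric]
        exp_of_nat_mult[symmetric] field_simps)
  ultimately show ?thesis unfolding ii_growth_def by (intro exI[of _ "exp (- (pi * Im c / 6))"]) auto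
qed

text \<open>
  The map \<open>z \<mapsto> \<delta> M z\<close> has a matrix of determinant \<open>\<delta>\<close>, the product of a unimodular matrix and the
  triangular matrix with rows \<open>(A, B)\<close> and \<open>(0, D)\<close>, where \<open>A = gcd \<delta> c\<close> and \<open>A D = \<delta>\<close>. The law
  for \<open>\<eta>\<^sup>2\<close> applies to the unimodular factor.
\<close>

lemma eta2_scaled_moebius:
  fixes \<delta> :: nat
  assumes "\<delta> > 0" and det: "a * d - b * c = 1"
  obtains K e where "K \<noteq> 0" "\<And>z. z \<in> uhp \<Longrightarrow> eta2 (of_nat \<delta> * mob a b c d z) =
    K * (of_int c * z + of_int d) * eta2 (of_real (real_of_int (gcd (int \<delta>) c) ^ 2 / \<delta>) * z + of_real e)"
proof -
  define A where "A = gcd (int \<delta>) c"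
  have A: "A > 0" using assms(1) by (simp add: A_def)
  obtain D where D: "int \<delta> = A * D" unfolding A_def by (metis dvdE gcd_dvd1)
  obtain c' where c': "c = A * c'" unfolding A_def by (metis dvdE gcd_dvd2)
  have Dpos: "D > 0" using D A assms(1) by (metis of_nat_0_less_iff zero_less_mult_pos)
  have "coprime D c'"
  proof -
    have "gcd (A * D) (A * c') = A" using A_def D c' by simp
    hence "A * gcd D c' = A" using A gcd_mult_distrib_int[of A D c'] by linarith
    hence "gcd D c' = 1" using A by simp
    thus ?thesis by (simp only: coprime_iff_gcd_eq_1)
  qed
  then obtain u v where uv: "u * D + v * c' = 1" by (metis bezout_int coprime_iff_gcd_eq_1)
  define d' B where "d' = u * d" and "B = v * d"
  have d': "c' * B + d' * D = d" 
  proof -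
    have "c' * B + d' * D = d * (u * D + v * c')" by (simp add: d'_def B_def algebra_simps)
    thus ?thesis by (simp add: uv)
  qed
  have det': "(a * D) * d' - (b * A - a * B) * c' = 1"
  proof -
    have "(a * D) * d' - (b * A - a * B) * c' = a * (c' * B + d' * D) - b * (A * c')" by (simp add: algebra_simps)
    thus ?thesis using det by (simp add: d' c'[symmetric])
  qed
  define K where "K = nome (of_int (eta_exp (a * D) (b * A - a * B) c' d') / 12) / of_int D"
  have "eta2 (of_nat \<delta> * mob a b c d z) =
    K * (of_int c * z + of_int d) * eta2 (of_real (real_of_int A ^ 2 / \<delta>) * z + of_real (real_of_int B / D))" if z: "z \<in> uhp" for z
  proof -
    define w where "w = (of_int A * z + of_int B) / of_int D"
    have w_eq: "of_real (real_of_int A ^ 2 / \<delta>) * z + of_real (real_of_int B / D) = w"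
    proof -
      have "real \<delta> = real_of_int A * real_of_int D" using D by (metis of_int_mult of_int_of_nat_eq)
      thus ?thesis using A Dpos by (simp add: w_def power2_eq_square add_divide_distrib)
    qed
    have w: "w \<in> uhp" using z A assms(1) unfolding w_eq[symmetric] by (simp add: uhp_def)
    have den: "of_int c' * w + of_int d' = (of_int c * z + of_int d) / of_int D"
    proof -
      have "(of_int c' * w + of_int d') * of_int D = of_int c' * (of_int A * z + of_int B) + of_int d' * of_int D"
        using Dpos by (simp add: w_def distrib_right)
      also have "\<dots> = of_int (A * c') * z + of_int (c' * B + d' * D)" by (simp add: algebra_simps)
      also have "\<dots> = of_int c * z + of_int d" unfolding d' c'[symmetric] by simp
      finally show ?thesis by (subst eq_divide_eq) (use Dpos in simp)
    qed
    have num: "of_int (a * D) * w + of_int (b * A - a * B) = of_int A * (of_int a * z + of_int b)"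
    proof -
      have "of_int D * w = of_int A * z + of_int B" using Dpos by (simp add: w_def)
      moreover have "of_int (a * D) * w = of_int a * (of_int D * w)" by simp
      ultimately show ?thesis by (simp add: algebra_simps)
    qed
    have "complex_of_nat \<delta> = of_int A * of_int D" using D by (metis of_int_mult of_int_of_nat_eq)
    hence "of_nat \<delta> * mob a b c d z = mob (a * D) (b * A - a * B) c' d' w"
      unfolding num den using Dpos by simp
    hence "eta2 (of_nat \<delta> * mob a b c d z) = nome (of_int (eta_exp (a * D) (b * A - a * B) c' d') / 12) * (of_int c' * w + of_int d') * eta2 w"
      using bspec[OF eta2_transformation[OF det', unfolded eta2_law_def] w] by (simp only:)
    thus ?thesis unfolding w_eq den by (simp add: K_def)
  qed
  moreover have "K \<noteq> 0" using Dpos by (simp add: K_def)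
  ultimately show ?thesis using that unfolding A_def by blast
qed

text \<open>
  Twelve times the order, measured in \<open>q\<close>, of the eta-quotient with exponents \<open>2 s\<close> at a cusp with
  denominator \<open>c\<close> (Ligozat's formula).
\<close>

definition cusp_sum :: "nat \<Rightarrow> (nat \<Rightarrow> int) \<Rightarrow> int \<Rightarrow> real" where
  "cusp_sum N s c = (\<Sum>\<delta> | \<delta> dvd N. of_int (s \<delta>) * of_int (gcd (int \<delta>) c) ^ 2 / of_nat \<delta>)"

lemma eta_quotient_even:
  "z \<in> uhp \<Longrightarrow> eta_quotient N (\<lambda>\<delta>. 2 * s \<delta>) z = (\<Prod>\<delta> | \<delta> dvd N. eta2 (of_nat \<delta> * z) powi s \<delta>)"
  by (simp add: eta_quotient_def eta2_def power_int_mult)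

lemma dvd_scale_uhp: "\<delta> dvd N \<Longrightarrow> N > 0 \<Longrightarrow> z \<in> uhp \<Longrightarrow> of_nat \<delta> * z \<in> uhp"
  by (auto simp: uhp_def dvd_pos_nat)

lemma holomorphic_eta_quotient:
  assumes "N > 0"
  shows "eta_quotient N r holomorphic_on uhp"
proof -
  have "(\<lambda>z. \<Prod>\<delta> | \<delta> dvd N. dedekind_eta (of_nat \<delta> * z) powi r \<delta>) holomorphic_on uhp"
  proof (rule holomorphic_on_prod)
    fix \<delta> assume "\<delta> \<in> {\<delta>. \<delta> dvd N}"
    hence d: "of_nat \<delta> * z \<in> uhp" if "z \<in> uhp" for z using dvd_scale_uhp assms that by blast
    have "(dedekind_eta \<circ> (\<lambda>z. of_nat \<delta> * z)) holomorphic_on uhp"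
      by (rule holomorphic_on_compose_gen[OF _ holomorphic_dedekind_eta]) (auto intro!: holomorphic_intros d)
    hence h: "(\<lambda>z. dedekind_eta (of_nat \<delta> * z)) holomorphic_on uhp" by (simp add: o_def)
    have "dedekind_eta (of_nat \<delta> * z) \<noteq> 0" if "z \<in> uhp" for z using dedekind_eta_nonzero d that by blast
    thus "(\<lambda>z. dedekind_eta (of_nat \<delta> * z) powi r \<delta>) holomorphic_on uhp"
      using h by (intro holomorphic_on_power_int) auto
  qed
  thus ?thesis by (rule holomorphic_transform) (simp add: eta_quotient_def)
qed

lemma eta_quotient_nonzero:
  assumes "N > 0" "z \<in> uhp"
  shows "eta_quotient N r z \<noteq> 0"
  using assms by (auto simp: eta_quotient_def power_int_eq_0_iff dedekind_eta_nonzero dvd_scale_uhp)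

text \<open>
  Each factor \<open>\<eta>(\<delta> z)\<^sup>2\<close>, moved by the matrix, is again \<open>\<eta>\<^sup>2\<close> at a scaled and shifted argument, so
  that its order is the scaling factor divided by \<open>12\<close>.
\<close>

lemma slash_eta_quotient_growth:
  assumes N: "N > 0" and det: "a * d - b * c = 1" and k: "(\<Sum>\<delta> | \<delta> dvd N. s \<delta>) = k"
  shows "ii_growth (slash k (eta_quotient N (\<lambda>\<delta>. 2 * s \<delta>)) (mat2 a b c d)) (cusp_sum N s c / 12)"
proof -
  have "\<exists>K e. K \<noteq> 0 \<and> (\<forall>z\<in>uhp. eta2 (of_nat \<delta> * mob a b c d z) =
    K * (of_int c * z + of_int d) * eta2 (of_real (real_of_int (gcd (int \<delta>) c) ^ 2 / \<delta>) * z + of_real e))"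
    if "\<delta> dvd N" for \<delta>
    using eta2_scaled_moebius[OF dvd_pos_nat[OF N that] det] by metis
  then obtain K e where Ke: "\<And>\<delta>. \<delta> dvd N \<Longrightarrow> K \<delta> \<noteq> (0::complex)"
    "\<And>\<delta> z. \<delta> dvd N \<Longrightarrow> z \<in> uhp \<Longrightarrow> eta2 (of_nat \<delta> * mob a b c d z) =
    K \<delta> * (of_int c * z + of_int d) * eta2 (of_real (real_of_int (gcd (int \<delta>) c) ^ 2 / \<delta>) * z + of_real (e \<delta>))"
    by metis
  define E where "E = (\<lambda>\<delta> z. eta2 (of_real (real_of_int (gcd (int \<delta>) c) ^ 2 / \<delta>) * z + of_real (e \<delta>)))"
  define P where "P = (\<Prod>\<delta> | \<delta> dvd N. K \<delta> powi s \<delta>)"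
  have fin: "finite {\<delta>. \<delta> dvd N}" using N by simp
  have eq: "slash k (eta_quotient N (\<lambda>\<delta>. 2 * s \<delta>)) (mat2 a b c d) z = P * (\<Prod>\<delta> | \<delta> dvd N. E \<delta> z powi s \<delta>)" if z: "z \<in> uhp" for z
  proof -
    define J where "J = of_int c * z + of_int d"
    have J: "J \<noteq> 0" unfolding J_def by (rule uhp_lin_nonzero[OF z det])
    have "eta_quotient N (\<lambda>\<delta>. 2 * s \<delta>) (mob a b c d z) = (\<Prod>\<delta> | \<delta> dvd N. (K \<delta> * J * E \<delta> z) powi s \<delta>)"
      using Ke(2) z by (subst eta_quotient_even[OF uhp_moebius(2)[OF z det]]) (auto simp: J_def E_def intro!: prod.cong)
    also have "\<dots> = P * (\<Prod>\<delta> | \<delta> dvd N. J powi s \<delta>) * (\<Prod>\<delta> | \<delta> dvd N. E \<delta> z powi s \<delta>)"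
      by (simp add: P_def power_int_mult_distrib prod.distrib)
    also have "(\<Prod>\<delta> | \<delta> dvd N. J powi s \<delta>) = J powi k"
      unfolding k[symmetric] using fin by (induction rule: finite_induct) (auto simp: power_int_add J)
    finally have *: "eta_quotient N (\<lambda>\<delta>. 2 * s \<delta>) (mob a b c d z) = P * J powi k * (\<Prod>\<delta> | \<delta> dvd N. E \<delta> z powi s \<delta>)" .
    show ?thesis unfolding slash_mat2 * unfolding J_def[symmetric] using J by (simp add: power_int_minus)
  qed
  have "ii_growth (\<lambda>z. P * (\<Prod>\<delta> | \<delta> dvd N. E \<delta> z powi s \<delta>))
      (0 + (\<Sum>\<delta> | \<delta> dvd N. (real_of_int (gcd (int \<delta>) c) ^ 2 / \<delta>) / 12 * of_int (s \<delta>)))"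
  proof (intro ii_growth_mult ii_growth_const ii_growth_prod[OF fin] ii_growth_powi)
    show "P \<noteq> 0" unfolding P_def using fin Ke(1) by (auto simp: power_int_eq_0_iff)
    fix \<delta> assume "\<delta> \<in> {\<delta>. \<delta> dvd N}"
    hence "\<delta> > 0" using N by (auto intro: dvd_pos_nat)
    thus "ii_growth (E \<delta>) ((real_of_int (gcd (int \<delta>) c) ^ 2 / \<delta>) / 12)"
      unfolding E_def by (intro ii_growth_eta2) (auto intro!: divide_pos_pos)
  qed
  also have "0 + (\<Sum>\<delta> | \<delta> dvd N. (real_of_int (gcd (int \<delta>) c) ^ 2 / \<delta>) / 12 * of_int (s \<delta>)) = cusp_sum N s c / 12"
    unfolding cusp_sum_def sum_divide_distrib by (simp add: mult_ac)
  finally show ?thesis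
    by (rule ii_growth_cong[rotated]) (use eventually_uhp in \<open>eventually_elim, simp add: eq\<close>)
qed

text \<open>
  The map \<open>z \<mapsto> \<delta> z\<close> conjugates the matrix with rows \<open>(a, b)\<close> and \<open>(c, d)\<close> into the one with rows
  \<open>(a, \<delta> b)\<close> and \<open>(c / \<delta>, d)\<close>. The sum is therefore the exponent of the multiplier on \<open>\<Gamma>\<^sub>0(N)\<close> of
  the eta-quotient with exponents \<open>2 s\<close>.
\<close>

definition trivial_multiplier :: "nat \<Rightarrow> (nat \<Rightarrow> int) \<Rightarrow> bool" where
  "trivial_multiplier N s \<longleftrightarrow> (\<forall>a b c d. a * d - b * c = 1 \<longrightarrow> int N dvd c \<longrightarrow>
     12 dvd (\<Sum>\<delta> | \<delta> dvd N. s \<delta> * eta_exp a (int \<delta> * b) (c div int \<delta>) d))"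

lemma invariant_eta_quotient:
  assumes N: "N > 0" and k: "(\<Sum>\<delta> | \<delta> dvd N. s \<delta>) = k" and triv: "trivial_multiplier N s"
  shows "invariant_form k N (eta_quotient N (\<lambda>\<delta>. 2 * s \<delta>))"
  unfolding invariant_form_def
proof (intro allI impI ballI)
  fix a b c d z assume det: "a * d - b * c = 1" and c: "int N dvd c" and z: "z \<in> uhp"
  define J where "J = of_int c * z + of_int d"
  have J: "J \<noteq> 0" unfolding J_def by (rule uhp_lin_nonzero[OF z det])
  have fin: "finite {\<delta>. \<delta> dvd N}" using N by simp
  define \<psi> where "\<psi> = (\<lambda>\<delta>. eta_exp a (int \<delta> * b) (c div int \<delta>) d)"
  have e: "eta2 (of_nat \<delta> * mob a b c d z) = nome (of_int (\<psi> \<delta>) / 12) * J * eta2 (of_nat \<delta> * z)" if "\<delta> dvd N" for \<delta>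
  proof -
    have "int \<delta> dvd c" using that c by (meson dvd_trans int_dvd_int_iff)
    then obtain c' where c': "c = int \<delta> * c'" by blast
    have \<delta>: "\<delta> > 0" using that N by (auto intro: dvd_pos_nat)
    hence "c div int \<delta> = c'" by (simp add: c')
    have "a * d - (int \<delta> * b) * c' = 1" using det by (simp add: c' mult_ac)
    from bspec[OF eta2_transformation[OF this, unfolded eta2_law_def] dvd_scale_uhp[OF that N z]]
    have "eta2 (mob a (int \<delta> * b) c' d (of_nat \<delta> * z)) =
      nome (of_int (eta_exp a (int \<delta> * b) c' d) / 12) * (of_int c' * (of_nat \<delta> * z) + of_int d) * eta2 (of_nat \<delta> * z)" .
    moreover have "of_int c' * (of_nat \<delta> * z) + of_int d = J" by (simp add: J_def c')
    moreover have "mob a (int \<delta> * b) c' d (of_nat \<delta> * z) = of_nat \<delta> * mob a b c d z"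
      unfolding \<open>of_int c' * (of_nat \<delta> * z) + of_int d = J\<close> J_def[symmetric] by (simp add: algebra_simps)
    ultimately show ?thesis by (simp add: \<psi>_def \<open>c div int \<delta> = c'\<close>)
  qed
  have "eta_quotient N (\<lambda>\<delta>. 2 * s \<delta>) (mob a b c d z) = (\<Prod>\<delta> | \<delta> dvd N. (nome (of_int (\<psi> \<delta>) / 12) * J * eta2 (of_nat \<delta> * z)) powi s \<delta>)"
    using e by (subst eta_quotient_even[OF uhp_moebius(2)[OF z det]]) (auto intro!: prod.cong)
  also have "\<dots> = (\<Prod>\<delta> | \<delta> dvd N. nome (of_int (\<psi> \<delta>) / 12) powi s \<delta>) * (\<Prod>\<delta> | \<delta> dvd N. J powi s \<delta>) * eta_quotient N (\<lambda>\<delta>. 2 * s \<delta>) z"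
    by (simp add: eta_quotient_even[OF z] power_int_mult_distrib prod.distrib)
  also have "(\<Prod>\<delta> | \<delta> dvd N. J powi s \<delta>) = J powi k"
    unfolding k[symmetric] using fin by (induction rule: finite_induct) (auto simp: power_int_add J)
  also have "(\<Prod>\<delta> | \<delta> dvd N. nome (of_int (\<psi> \<delta>) / 12) powi s \<delta>) = nome (of_int (\<Sum>\<delta> | \<delta> dvd N. s \<delta> * \<psi> \<delta>) / 12)"
    using fin by (induction rule: finite_induct) (auto simp: nome_powi nome_add add_divide_distrib)
  also have "\<dots> = nome (of_int 0 / 12)"
  proof (rule nome_cong_12)
    have "12 dvd (\<Sum>\<delta> | \<delta> dvd N. s \<delta> * \<psi> \<delta>)"
      using triv det c unfolding trivial_multiplier_def \<psi>_def by blast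
    thus "[\<Sum>\<delta> | \<delta> dvd N. s \<delta> * \<psi> \<delta> = 0] (mod 12)" by (simp add: cong_0_iff)
  qed
  finally show "eta_quotient N (\<lambda>\<delta>. 2 * s \<delta>) (mob a b c d z) = (of_int c * z + of_int d) powi k * eta_quotient N (\<lambda>\<delta>. 2 * s \<delta>) z"
    by (simp add: J_def)
qed

theorem eta_quotient_in_R_space:
  assumes N: "N > 0" and k: "(\<Sum>\<delta> | \<delta> dvd N. s \<delta>) = k" and triv: "trivial_multiplier N s"
    and cusps: "\<And>c. \<not> int N dvd c \<Longrightarrow> cusp_sum N s c \<ge> 0"
  shows "eta_quotient N (\<lambda>\<delta>. 2 * s \<delta>) \<in> R_space k N"
  unfolding R_space_iff
proof (intro conjI allI impI)
  note hol = holomorphic_eta_quotient[OF N] and inv = invariant_eta_quotient[OF N k triv]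
  show "eta_quotient N (\<lambda>\<delta>. 2 * s \<delta>) z = 0" if "z \<notin> uhp" for z using that by (simp add: eta_quotient_def)
  show "eta_quotient N (\<lambda>\<delta>. 2 * s \<delta>) holomorphic_on uhp" by (rule hol)
  show "invariant_form k N (eta_quotient N (\<lambda>\<delta>. 2 * s \<delta>))" by (rule inv)
  fix a b c d :: int assume det: "a * d - b * c = 1"
  show "meromorphic_at_ii_infinity N (slash k (eta_quotient N (\<lambda>\<delta>. 2 * s \<delta>)) (mat2 a b c d))"
    using ii_growth_bound[OF slash_eta_quotient_growth[OF N det k]]
      slash_ii_infinityI(2)[OF N hol inv det] by blast
  assume "\<not> int N dvd c"
  thus "holomorphic_at_ii_infinity N (slash k (eta_quotient N (\<lambda>\<delta>. 2 * s \<delta>)) (mat2 a b c d))"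
    using ii_growth_bounded[OF slash_eta_quotient_growth[OF N det k]] cusps
      slash_ii_infinityI(1)[OF N hol inv det] by fastforce
qed

section \<open>A fundamental domain and forms of level one\<close>

lemma bottom_row_extension:
  fixes c d :: int
  assumes "coprime c d"
  obtains a b where "a * d - b * c = 1"
proof -
  obtain u v where "u * c + v * d = 1" using assms by (metis bezout_int coprime_iff_gcd_eq_1)
  thus ?thesis using that[of v "- u"] by (simp add: algebra_simps)
qed

lemma det_coprime: "a * d - b * c = (1::int) \<Longrightarrow> coprime c d"
proof (rule coprimeI)
  fix x assume "a * d - b * c = 1" "x dvd c" "x dvd d"
  hence "x dvd a * d - b * c" by (intro dvd_diff dvd_mult)
  thus "is_unit x" unfolding \<open>a * d - b * c = 1\<close> .
qed

text \<open>
  The imaginary part of \<open>c z + d\<close> bounds \<open>c\<close>, and then the real part bounds \<open>d\<close>.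
\<close>

lemma finite_bottom_rows:
  assumes "z \<in> uhp"
  shows "finite {(c::int, d::int). norm (of_int c * z + of_int d) \<le> r}"
proof (rule finite_subset)
  define C where "C = \<lceil>r / Im z\<rceil>"
  define D where "D = \<lceil>r + r / Im z * norm z\<rceil>"
  have y: "Im z > 0" using assms by (simp add: uhp_def)
  show "{(c::int, d::int). norm (of_int c * z + of_int d) \<le> r} \<subseteq> {-C..C} \<times> {-D..D}"
  proof clarify
    fix c d :: int assume *: "norm (of_int c * z + of_int d) \<le> r"
    have "\<bar>of_int c * Im z\<bar> \<le> r" using abs_Im_le_cmod[of "of_int c * z + of_int d"] * by simp
    hence c: "\<bar>real_of_int c\<bar> \<le> r / Im z" using y by (simp add: abs_mult field_simps)
    have "\<bar>real_of_int d\<bar> = norm ((of_int c * z + of_int d) - of_int c * z)" by simp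
    also have "\<dots> \<le> norm (of_int c * z + of_int d) + norm (of_int c * z)" by (rule norm_triangle_ineq4)
    also have "\<dots> \<le> r + r / Im z * norm z" using * c by (intro add_mono) (simp_all only: norm_mult norm_of_int mult_right_mono norm_ge_zero)
    finally have d: "\<bar>real_of_int d\<bar> \<le> r + r / Im z * norm z" .
    have "\<bar>c\<bar> \<le> C" "\<bar>d\<bar> \<le> D" using c d unfolding C_def D_def by linarith+
    thus "c \<in> {-C..C} \<and> d \<in> {-D..D}" by auto
  qed
qed auto

text \<open>
  A bottom row of minimal \<open>\<bar>c z + d\<bar>\<close> maximises the imaginary part; a translation makes the real
  part small. Minimality against the top row gives a point of modulus at least \<open>1\<close>.
\<close>

lemma fundamental_domain:
  assumes z: "z \<in> uhp"
  obtains a b c d where "a * d - b * c = 1" "Im (mob a b c d z) \<ge> 1 / 2" "\<bar>Re (mob a b c d z)\<bar> \<le> 1 / 2"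
proof -
  define P where "P = {(c::int, d::int). norm (of_int c * z + of_int d) \<le> 1} \<inter> {(c, d). coprime c d}"
  have fin: "finite P" unfolding P_def using finite_bottom_rows[OF z, of 1] by blast
  have P0: "(0, 1) \<in> P" by (simp add: P_def)
  define m where "m = (\<lambda>(c::int, d::int). norm (of_int c * z + of_int d))"
  obtain cd where cd: "cd \<in> P" "\<And>x. x \<in> P \<Longrightarrow> m cd \<le> m x"
    using ex_is_arg_min_if_finite[OF fin, of m] P0 by (auto simp: is_arg_min_linorder)
  obtain c d where cd_eq: "cd = (c, d)" by force
  have min: "norm (of_int c * z + of_int d) \<le> norm (of_int c' * z + of_int d')" if "coprime c' d'" for c' d'
  proof (cases "(c', d') \<in> P")
    case True
    thus ?thesis using cd(2)[OF True] by (simp add: cd_eq m_def)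
  next
    case False
    thus ?thesis using cd(2)[OF P0] that by (auto simp: cd_eq m_def P_def)
  qed
  have "coprime c d" using cd(1) by (auto simp: P_def cd_eq)
  from bottom_row_extension[OF this] obtain a b where det: "a * d - b * c = 1" by blast
  define n where "n = round (Re (mob a b c d z))"
  define J where "J = of_int c * z + of_int d"
  have J: "J \<noteq> 0" unfolding J_def by (rule uhp_lin_nonzero[OF z det])
  have det': "(a - n * c) * d - (b - n * d) * c = 1" using det by (simp add: algebra_simps)
  define w where "w = mob (a - n * c) (b - n * d) c d z"
  have "w = (of_int a * z + of_int b - of_int n * J) / J" by (simp add: w_def J_def algebra_simps)
  also have "\<dots> = mob a b c d z - of_int n" using J by (simp add: J_def[symmetric] diff_divide_distrib)
  finally have w_eq: "w = mob a b c d z - of_int n" .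
  have re: "\<bar>Re w\<bar> \<le> 1 / 2"
    using of_int_round_abs_le[of "Re (mob a b c d z)"] by (simp add: w_eq n_def abs_minus_commute)
  have uhp: "w \<in> uhp" unfolding w_def by (rule uhp_moebius(2)[OF z det'])
  have "coprime (a - n * c) (b - n * d)"
    by (rule det_coprime[of "- c" _ "- d"]) (use det' in \<open>simp add: algebra_simps\<close>)
  from min[OF this] have "norm J \<le> norm (of_int (a - n * c) * z + of_int (b - n * d))" by (simp only: J_def)
  also have "\<dots> = norm w * norm J" using J unfolding w_def J_def by (simp add: norm_divide)
  finally have "norm w \<ge> 1" using J by simp
  have "Im w \<ge> 1 / 2"
  proof (rule ccontr)
    assume "\<not> Im w \<ge> 1 / 2"
    hence "\<bar>Im w\<bar> \<le> 1 / 2" using uhp by (simp add: uhp_def)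
    have "norm w ^ 2 = (Re w)\<^sup>2 + (Im w)\<^sup>2" by (rule cmod_power2)
    also have "\<dots> \<le> (1 / 2)\<^sup>2 + (1 / 2)\<^sup>2"
      using re \<open>\<bar>Im w\<bar> \<le> 1 / 2\<close> by (intro add_mono) (metis abs_ge_zero power2_abs power_mono)+
    also have "\<dots> < 1" by (simp add: power2_eq_square)
    finally have "norm w ^ 2 < 1" .
    thus False using one_le_power[OF \<open>norm w \<ge> 1\<close>, of 2] by simp
  qed
  thus ?thesis using that[OF det'] re unfolding w_def by blast
qed

text \<open>
  As a function of \<open>q\<close>, the modulus attains its supremum on the compact disc that comes from the
  fundamental domain. By the maximum principle the function is constant, and its value at \<open>q = 0\<close>
  is \<open>0\<close>.
\<close>

lemma level_one_vanishing:
  assumes hol: "f holomorphic_on uhp"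
    and inv: "\<And>a b c d z. a * d - b * c = 1 \<Longrightarrow> z \<in> uhp \<Longrightarrow> f (mob a b c d z) = f z"
    and lim: "(f \<longlongrightarrow> 0) ii_inf" and z: "z \<in> uhp"
  shows "f z = 0"
proof -
  have "eventually (\<lambda>z. norm (f z) \<le> 1) ii_inf"
    using order_tendstoD(2)[OF tendsto_norm[OF lim], of 1] by (auto elim: eventually_mono)
  moreover have "f (z + of_nat 1) = f z" if "z \<in> uhp" for z
    using inv[of 1 1 1 0 z] that by simp
  ultimately obtain F where F: "F holomorphic_on ball 0 1" "\<And>z. z \<in> uhp \<Longrightarrow> f z = F (nome (z / of_nat 1))"
    using periodic_bounded_extension[of 1 f 1] hol by auto
  hence F2: "f z = F (nome z)" if "z \<in> uhp" for z using that by simp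
  have contF: "continuous_on (ball 0 1) F" using F(1) by (rule holomorphic_on_imp_continuous_on)
  have "isCont F 0" using contF by (simp add: continuous_on_eq_continuous_at)
  hence "((\<lambda>z. F (nome z)) \<longlongrightarrow> F 0) ii_inf"
    using filterlim_compose[OF _ filterlim_nome[of 1 0], of F "nhds (F 0)"] by (simp add: isCont_def)
  moreover have "((\<lambda>z. F (nome z)) \<longlongrightarrow> 0) ii_inf"
    by (rule Lim_transform_eventually[OF lim]) (use eventually_uhp in \<open>eventually_elim, simp add: F2\<close>)
  ultimately have F0: "F 0 = 0" using tendsto_unique ii_inf_neq_bot by blast
  define \<rho> where "\<rho> = exp (- pi)"
  have \<rho>: "0 < \<rho>" "\<rho> < 1" by (auto simp: \<rho>_def)
  have "continuous_on (cball 0 \<rho>) (\<lambda>q. norm (F q))"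
    by (intro continuous_on_norm continuous_on_subset[OF contF]) (use \<rho> in auto)
  moreover have "cball (0::complex) \<rho> \<noteq> {}" using \<rho> by auto
  ultimately obtain q0 where q0: "q0 \<in> cball 0 \<rho>" "\<And>q. q \<in> cball 0 \<rho> \<Longrightarrow> norm (F q) \<le> norm (F q0)"
    using continuous_attains_sup[of "cball (0::complex) \<rho>" "\<lambda>q. norm (F q)"] by auto
  have max: "norm (F q) \<le> norm (F q0)" if "norm q < 1" for q
  proof (cases "q = 0")
    case True
    thus ?thesis using F0 by simp
  next
    case False
    obtain z where zq: "nome z = q" "Im z = - ln (norm q) / (2 * pi)" using nome_surj[OF False] by metis
    have zu: "z \<in> uhp" using that False by (simp add: uhp_def zq(2) field_simps)
    obtain a b c d where M: "a * d - b * c = 1" "Im (mob a b c d z) \<ge> 1 / 2"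
      using fundamental_domain[OF zu] by metis
    have "F q = f (mob a b c d z)" using F2[OF zu] zq(1) inv[OF M(1) zu] by simp
    also have "\<dots> = F (nome (mob a b c d z))" by (rule F2[OF uhp_moebius(2)[OF zu M(1)]])
    finally have *: "F q = F (nome (mob a b c d z))" .
    have "norm (nome (mob a b c d z)) = exp (- (2 * pi * Im (mob a b c d z)))" by (simp only: norm_nome mult_minus_left)
    also have "\<dots> \<le> exp (- pi)" using mult_left_mono[OF M(2), of "2 * pi"] by simp
    finally show ?thesis unfolding * by (intro q0(2)) (simp add: \<rho>_def)
  qed
  have q01: "norm q0 < 1" using q0(1) \<rho> by simp
  have "F constant_on ball 0 1"
    by (rule Schwarz2[OF F(1), of "1 - norm q0" q0])
       (use q01 max in \<open>auto simp: dist_norm intro: norm_triangle_lt\<close>, (smt (verit) norm_triangle_ineq2 norm_minus_commute)+)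
  hence "F (nome z) = F 0" using norm_nome_less_1[OF z] by (auto simp: constant_on_def)
  thus ?thesis using F0 F2[OF z] by simp
qed

text \<open>
  For counting objects by data that determine them but that come without a canonical choice.
\<close>

lemma finite_via_relation:
  assumes "finite X" "\<And>y. y \<in> Y \<Longrightarrow> \<exists>x\<in>X. R x y" "\<And>x y y'. x \<in> X \<Longrightarrow> R x y \<Longrightarrow> R x y' \<Longrightarrow> y = y'"
  shows "finite Y"
proof -
  obtain f where f: "\<And>y. y \<in> Y \<Longrightarrow> f y \<in> X \<and> R (f y) y" using assms(2) by metis
  have "inj_on f Y" using f assms(3) by (metis inj_onI)
  moreover have "f ` Y \<subseteq> X" using f by blast
  ultimately show ?thesis using assms(1) inj_on_finite by blast
qed

lemma mob_compose:
  assumes z: "z \<in> uhp" and det: "a' * d' - b' * c' = 1"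
  shows "mob a b c d (mob a' b' c' d' z) = mob (a * a' + b * c') (a * b' + b * d') (c * a' + d * c') (c * b' + d * d') z"
proof -
  define J where "J = of_int c' * z + of_int d'"
  have J: "J \<noteq> 0" unfolding J_def by (rule uhp_lin_nonzero[OF z det])
  have e: "(of_int x * ((of_int a' * z + of_int b') / J) + of_int y) = (of_int (x * a' + y * c') * z + of_int (x * b' + y * d')) / J" for x y
    using J by (simp add: field_simps) (simp add: J_def algebra_simps)
  show ?thesis unfolding J_def[symmetric] e using J by simp
qed

text \<open>
  A factor that is not identically zero has no zeros on some open set, where the other factors
  must account for the vanishing of the product.
\<close>

lemma holomorphic_prod_zero:
  assumes "finite S" "open A" "connected A" "A \<noteq> {}" "\<And>h. h \<in> S \<Longrightarrow> h holomorphic_on A"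
    and "\<And>z. z \<in> A \<Longrightarrow> (\<Prod>h\<in>S. h z) = (0::complex)"
  shows "\<exists>h\<in>S. \<forall>z\<in>A. h z = 0"
  using assms(1,5,6)
proof (induction S rule: finite_induct)
  case empty
  thus ?case using assms(4) by auto
next
  case (insert g S)
  show ?case
  proof (cases "\<forall>z\<in>A. g z = 0")
    case False
    then obtain z0 where z0: "z0 \<in> A" "g z0 \<noteq> 0" by blast
    have "continuous_on A g" using insert.prems(1) holomorphic_on_imp_continuous_on by blast
    hence op: "open (A \<inter> g -` (- {0}))"
      using assms(2) by (intro continuous_open_preimage) auto
    have "(\<Prod>h\<in>S. h z) = 0" if "z \<in> A" for z
    proof (rule analytic_continuation_open[of "A \<inter> g -` (- {0})" A "\<lambda>z. \<Prod>h\<in>S. h z" "\<lambda>_. 0"])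
      show "(\<lambda>z. \<Prod>h\<in>S. h z) holomorphic_on A"
        using insert.prems(1) by (intro holomorphic_on_prod) auto
      show "(\<Prod>h\<in>S. h z) = 0" if "z \<in> A \<inter> g -` (- {0})" for z
        using insert.prems(2)[of z] insert.hyps that by simp
    qed (use op assms z0 that in auto)
    thus ?thesis using insert by auto
  qed auto
qed

text \<open>
  The function \<open>H \<circ> M\<close> depends only on the bottom row of \<open>M\<close> modulo \<open>N\<close>, so there are finitely
  many such functions, and the modular group permutes them. Their product has level one. It
  vanishes at \<open>\<i>\<infinity>\<close>, because the factor \<open>H\<close> does and the others are bounded; hence it is zero, and
  so is one of its factors.
\<close>

lemma bounded_invariant_vanishing:
  assumes N: "N > 0" and hol: "H holomorphic_on uhp"
    and inv: "\<And>a b c d z. a * d - b * c = 1 \<Longrightarrow> int N dvd c \<Longrightarrow> z \<in> uhp \<Longrightarrow> H (mob a b c d z) = H z"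
    and bd: "\<And>a b c d. a * d - b * c = 1 \<Longrightarrow> \<exists>C. eventually (\<lambda>z. norm (H (mob a b c d z)) \<le> C) ii_inf"
    and lim: "(H \<longlongrightarrow> 0) ii_inf" and z: "z \<in> uhp"
  shows "H z = 0"
proof -
  define T where "T = (\<lambda>a b c d z. if z \<in> uhp then H (mob a b c d z) else 0)"
  define S where "S = {T a b c d | a b c d. a * d - b * c = 1}"
  have detc: "(a * a' + b * c') * (c * b' + d * d') - (a * b' + b * d') * (c * a' + d * c') = 1"
    if "a * d - b * c = 1" "a' * d' - b' * c' = (1::int)" for a b c d a' b' c' d'
  proof -
    have "(a * a' + b * c') * (c * b' + d * d') - (a * b' + b * d') * (c * a' + d * c') = (a * d - b * c) * (a' * d' - b' * c')"
      by (simp add: algebra_simps)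
    thus ?thesis using that by simp
  qed
  have T_eq: "T a b c d = T a' b' c' d'"
    if det: "a * d - b * c = 1" "a' * d' - b' * c' = 1" and cong: "c mod int N = c' mod int N" "d mod int N = d' mod int N" for a b c d a' b' c' d'
  proof
    fix z
    show "T a b c d z = T a' b' c' d' z"
    proof (cases "z \<in> uhp")
      case True
      define x y u v where "x = a' * d - b' * c" "y = b' * a - a' * b" "u = c' * d - d' * c" "v = d' * a - c' * b"
      note d = this
      have "[c' * d - d' * c = c * d - d * c] (mod int N)"
        using cong by (intro cong_diff cong_mult) (auto simp: cong_def)
      hence "int N dvd u" by (simp add: d cong_0_iff mult.commute)
      moreover have dxy: "x * v - y * u = 1"
      proof -
        have "x * v - y * u = (a' * d' - b' * c') * (a * d - b * c)" by (simp add: d algebra_simps)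
        thus ?thesis using det by simp
      qed
      ultimately have "H (mob x y u v (mob a b c d z)) = H (mob a b c d z)"
        by (intro inv uhp_moebius(2)[OF True det(1)])
      moreover have "mob x y u v (mob a b c d z) = mob a' b' c' d' z"
      proof -
        have e: "x * a + y * c = a' * (a * d - b * c)" "x * b + y * d = b' * (a * d - b * c)"
             "u * a + v * c = c' * (a * d - b * c)" "u * b + v * d = d' * (a * d - b * c)"
          by (simp_all add: d algebra_simps)
        show ?thesis unfolding mob_compose[OF True det(1)] e det(1) by simp
      qed
      ultimately show ?thesis using True by (simp add: T_def)
    qed (simp add: T_def)
  qed
  define R where "R = (\<lambda>(x, y) h. \<exists>a b c d. a * d - b * c = 1 \<and> c mod int N = x \<and> d mod int N = y \<and> h = T a b c d)"
  have "finite S"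
  proof (rule finite_via_relation[of "{0..<int N} \<times> {0..<int N}" _ R])
    show "finite ({0..<int N} \<times> {0..<int N})" by simp
    show "\<exists>x\<in>{0..<int N} \<times> {0..<int N}. R x h" if hS: "h \<in> S" for h
    proof -
      obtain a b c d where h: "h = T a b c d" "a * d - b * c = 1" using hS by (auto simp: S_def)
      have "R (c mod int N, d mod int N) h" unfolding R_def split using h by blast
      thus ?thesis by (rule bexI) (use N in simp)
    qed
    show "h = h'" if hh: "R x h" "R x h'" for x h h'
    proof -
      obtain m n where x: "x = (m, n)" by (cases x)
      obtain a b c d where 1: "a * d - b * c = 1" "c mod int N = m" "d mod int N = n" "h = T a b c d"
        using hh(1) unfolding x R_def split by blast
      obtain a' b' c' d' where 2: "a' * d' - b' * c' = 1" "c' mod int N = m" "d' mod int N = n" "h' = T a' b' c' d'"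
        using hh(2) unfolding x R_def split by blast
      show ?thesis unfolding 1(4) 2(4) by (rule T_eq[OF 1(1) 2(1)]) (simp_all only: 1(2,3) 2(2,3))
    qed
  qed
  have holS: "h holomorphic_on uhp" if hS: "h \<in> S" for h
  proof -
    obtain a b c d where h: "h = T a b c d" "a * d - b * c = 1" using hS by (auto simp: S_def)
    have "(H \<circ> mob a b c d) holomorphic_on uhp"
      by (rule holomorphic_on_compose_gen[OF _ hol])
         (use uhp_lin_nonzero[OF _ h(2)] uhp_moebius(2)[OF _ h(2)] in \<open>auto intro!: holomorphic_intros\<close>)
    thus ?thesis by (rule holomorphic_transform) (simp add: h(1) T_def o_def)
  qed
  define act where "act = (\<lambda>a b c d (h :: complex \<Rightarrow> complex) z. if z \<in> uhp then h (mob a b c d z) else 0)"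
  have act_T: "act a b c d (T a' b' c' d') = T (a' * a + b' * c) (a' * b + b' * d) (c' * a + d' * c) (c' * b + d' * d)"
    if "a * d - b * c = 1" "a' * d' - b' * c' = 1" for a b c d a' b' c' d'
  proof
    fix z
    show "act a b c d (T a' b' c' d') z = T (a' * a + b' * c) (a' * b + b' * d) (c' * a + d' * c) (c' * b + d' * d) z"
    proof (cases "z \<in> uhp")
      case True
      show ?thesis unfolding act_def T_def using True uhp_moebius(2)[OF True that(1)]
        by (simp only: if_True mob_compose[OF True that(1)])
    qed (simp add: act_def T_def)
  qed
  have act_S: "act a b c d h \<in> S" if det: "a * d - b * c = 1" and hS: "h \<in> S" for a b c d h
  proof -
    obtain a' b' c' d' where h: "h = T a' b' c' d'" "a' * d' - b' * c' = 1" using hS by (auto simp: S_def)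
    show ?thesis unfolding h(1) act_T[OF det h(2)] S_def using detc[OF h(2) det] by blast
  qed
  have act_inv: "act d (- b) (- c) a (act a b c d h) = h" "act a b c d (act d (- b) (- c) a h) = h"
    if det: "a * d - b * c = 1" and hS: "h \<in> S" for a b c d h
  proof -
    obtain a' b' c' d' where h: "h = T a' b' c' d'" "a' * d' - b' * c' = 1" using hS by (auto simp: S_def)
    have zero: "h z = 0" if "z \<notin> uhp" for z using that by (simp add: h(1) T_def)
    have d': "d * a - (- b) * (- c) = 1" using det by (simp add: algebra_simps)
    have "mob a b c d (mob d (- b) (- c) a z) = z" "mob d (- b) (- c) a (mob a b c d z) = z" if z: "z \<in> uhp" for z
    proof -
      have e: "a * d + b * - c = 1" "a * - b + b * a = 0" "c * d + d * - c = 0" "c * - b + d * a = 1"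
        "d * a + - b * c = 1" "d * b + - b * d = 0" "- c * a + a * c = 0" "- c * b + a * d = 1"
        using \<open>a * d - b * c = 1\<close> by (simp_all add: algebra_simps)
      show "mob a b c d (mob d (- b) (- c) a z) = z" unfolding mob_compose[OF z d'] e by simp
      show "mob d (- b) (- c) a (mob a b c d z) = z" unfolding mob_compose[OF z \<open>a * d - b * c = 1\<close>] e by simp
    qed
    thus "act d (- b) (- c) a (act a b c d h) = h" "act a b c d (act d (- b) (- c) a h) = h"
      using zero uhp_moebius(2)[OF _ det] uhp_moebius(2)[OF _ d'] by (auto simp: act_def fun_eq_iff)
  qed
  define J where "J = (\<lambda>z. \<Prod>h\<in>S. h z)"
  have TI: "T 1 0 0 1 \<in> S" unfolding S_def by (intro CollectI exI[of _ 1] exI[of _ 0]) auto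
  have "J z = 0" if "z \<in> uhp" for z
  proof (rule level_one_vanishing[OF _ _ _ that])
    show "J holomorphic_on uhp" unfolding J_def by (intro holomorphic_on_prod holS)
    show "J (mob a b c d z) = J z" if det: "a * d - b * c = 1" and z: "z \<in> uhp" for a b c d z
    proof -
      have det': "d * a - (- b) * (- c) = 1" using det by (simp add: algebra_simps)
      have "J (mob a b c d z) = (\<Prod>h\<in>S. act a b c d h z)" using z by (simp add: J_def act_def)
      also have "\<dots> = (\<Prod>h\<in>S. h z)"
        by (rule prod.reindex_bij_witness[of _ "act d (- b) (- c) a" "act a b c d"])
           (use act_inv[OF det] act_S[OF det] act_S[OF det'] in auto)
      finally show ?thesis by (simp add: J_def)
    qed
    have "Bfun (\<lambda>z. \<Prod>h\<in>S - {T 1 0 0 1}. h z) ii_inf"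
    proof -
      have each: "Bfun h ii_inf" if hS: "h \<in> S" for h
      proof -
        obtain a b c d where h: "h = T a b c d" "a * d - b * c = 1" using hS by (auto simp: S_def)
        obtain C where "eventually (\<lambda>z. norm (H (mob a b c d z)) \<le> C) ii_inf" using bd[OF h(2)] by blast
        hence "eventually (\<lambda>z. norm (h z) \<le> C) ii_inf"
          using eventually_uhp by eventually_elim (simp add: h T_def)
        thus ?thesis by (rule BfunI)
      qed
      have "Bfun (\<lambda>z. \<Prod>h\<in>S'. h z) ii_inf" if "finite S'" "S' \<subseteq> S" for S'
        using that
      proof (induction S' rule: finite_induct)
        case (insert h S')
        obtain C where C: "eventually (\<lambda>z. norm (h z) \<le> C) ii_inf" using each insert.prems by (auto simp: Bfun_def)
        obtain D where D: "eventually (\<lambda>z. norm (\<Prod>h\<in>S'. h z) \<le> D) ii_inf" using insert by (auto simp: Bfun_def)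
        have "eventually (\<lambda>z. norm (\<Prod>h\<in>insert h S'. h z) \<le> \<bar>C\<bar> * \<bar>D\<bar>) ii_inf"
          using C D by eventually_elim (use insert.hyps in \<open>auto simp: norm_mult intro!: mult_mono\<close>)
        thus ?case by (rule BfunI)
      qed (auto intro: BfunI)
      thus ?thesis using \<open>finite S\<close> by auto
    qed
    moreover have "Zfun (T 1 0 0 1) ii_inf"
    proof -
      have "(T 1 0 0 1 \<longlongrightarrow> 0) ii_inf"
        by (rule Lim_transform_eventually[OF lim]) (use eventually_uhp in \<open>eventually_elim, simp add: T_def\<close>)
      thus ?thesis by (simp add: tendsto_Zfun_iff)
    qed
    ultimately have "Zfun (\<lambda>z. T 1 0 0 1 z * (\<Prod>h\<in>S - {T 1 0 0 1}. h z)) ii_inf"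
      by (intro bounded_bilinear.Zfun_prod_Bfun[OF bounded_bilinear_mult])
    moreover have "T 1 0 0 1 z * (\<Prod>h\<in>S - {T 1 0 0 1}. h z) = J z" for z
      unfolding J_def using \<open>finite S\<close> TI by (simp add: prod.remove)
    ultimately show "(J \<longlongrightarrow> 0) ii_inf" by (simp add: tendsto_Zfun_iff)
  qed
  hence "\<exists>h\<in>S. \<forall>z\<in>uhp. h z = 0"
    using holomorphic_prod_zero[OF \<open>finite S\<close> open_uhp connected_uhp _ holS] z unfolding J_def by blast
  then obtain h where h0: "h \<in> S" "\<And>z. z \<in> uhp \<Longrightarrow> h z = 0" by blast
  then obtain a b c d where h: "h = T a b c d" "a * d - b * c = 1" by (auto simp: S_def)
  have d': "d * a - (- b) * (- c) = 1" using h(2) by (simp add: algebra_simps)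
  have "act d (- b) (- c) a h z = 0" using h0(2) uhp_moebius(2)[OF z d'] by (simp add: act_def)
  moreover have "act d (- b) (- c) a h = T (a * d + b * - c) (a * - b + b * a) (c * d + d * - c) (c * - b + d * a)"
    unfolding h(1) by (rule act_T[OF d' h(2)])
  moreover have "a * d + b * - c = 1" "a * - b + b * a = 0" "c * d + d * - c = 0" "c * - b + d * a = 1"
    using h(2) by (simp_all add: algebra_simps)
  ultimately have "T 1 0 0 1 z = 0" by simp
  thus ?thesis using z by (simp add: T_def)
qed

section \<open>Orders at infinity\<close>

text \<open>
  The order at \<open>\<i>\<infinity>\<close> as a relation: the zero function has no order.
\<close>

definition has_order :: "(complex \<Rightarrow> complex) \<Rightarrow> int \<Rightarrow> bool" where
  "has_order f n \<longleftrightarrow> (\<exists>c. c \<noteq> 0 \<and> ((\<lambda>z. f z * nome z powi (- n)) \<longlongrightarrow> c) ii_inf)"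

lemma nome_tendsto_0: "(nome \<longlongrightarrow> 0) ii_inf"
  using filterlim_nome[of 1 0] by (simp add: filterlim_at)

lemma has_order_mult:
  assumes "has_order f n" "has_order g m"
  shows "has_order (\<lambda>z. f z * g z) (n + m)"
proof -
  obtain c d where cd: "c \<noteq> 0" "d \<noteq> 0" "((\<lambda>z. f z * nome z powi (- n)) \<longlongrightarrow> c) ii_inf"
    "((\<lambda>z. g z * nome z powi (- m)) \<longlongrightarrow> d) ii_inf" using assms by (auto simp: has_order_def)
  have "nome z powi (- (n + m)) = nome z powi (- n) * nome z powi (- m)" for z
    using power_int_add[of "nome z" "- n" "- m"] by simp
  hence "(f z * nome z powi (- n)) * (g z * nome z powi (- m)) = (f z * g z) * nome z powi (- (n + m))" for z
    by (simp only: mult_ac)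
  hence "((\<lambda>z. (f z * g z) * nome z powi (- (n + m))) \<longlongrightarrow> c * d) ii_inf"
    using tendsto_mult[OF cd(3,4)] by (simp only:)
  thus ?thesis unfolding has_order_def using cd by (intro exI[of _ "c * d"] conjI) simp_all
qed

lemma has_order_1: "has_order (\<lambda>z. 1) 0"
  unfolding has_order_def by (intro exI[of _ 1]) auto

lemma has_order_power: "has_order f n \<Longrightarrow> has_order (\<lambda>z. f z ^ m) (int m * n)"
  by (induction m) (auto intro: has_order_1 dest: has_order_mult simp: algebra_simps)

lemma has_order_cong:
  assumes "has_order f n" "eventually (\<lambda>z. f z = g z) ii_inf"
  shows "has_order g n"
proof -
  obtain c where "c \<noteq> 0" "((\<lambda>z. f z * nome z powi (- n)) \<longlongrightarrow> c) ii_inf" using assms by (auto simp: has_order_def)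
  thus ?thesis unfolding has_order_def
    using assms(2) by (intro exI[of _ c] conjI) (auto intro: Lim_transform_eventually elim: eventually_mono)
qed

lemma has_order_vanish:
  assumes "has_order f n" "m < n"
  shows "((\<lambda>z. f z * nome z powi (- m)) \<longlongrightarrow> 0) ii_inf"
proof -
  obtain c where "((\<lambda>z. f z * nome z powi (- n)) \<longlongrightarrow> c) ii_inf" using assms by (auto simp: has_order_def)
  hence "((\<lambda>z. (f z * nome z powi (- n)) * nome z ^ nat (n - m)) \<longlongrightarrow> c * 0 ^ nat (n - m)) ii_inf"
    by (intro tendsto_intros nome_tendsto_0)
  moreover have "(f z * nome z powi (- n)) * nome z ^ nat (n - m) = f z * nome z powi (- m)" for z
  proof -
    have "nome z ^ nat (n - m) = nome z powi (n - m)" using assms(2) by (simp add: power_int_def)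
    hence "nome z powi (- n) * nome z ^ nat (n - m) = nome z powi (- m)" by (simp flip: power_int_add)
    thus ?thesis by (simp add: mult.assoc)
  qed
  moreover have "c * 0 ^ nat (n - m) = 0" using assms(2) by (simp add: power_0_left)
  ultimately show ?thesis by (simp only:)
qed

lemma vanish_has_order:
  assumes "has_order f n" "((\<lambda>z. f z * nome z powi (- m)) \<longlongrightarrow> 0) ii_inf"
  shows "m < n"
proof (rule ccontr)
  assume "\<not> m < n"
  obtain c where c: "c \<noteq> 0" "((\<lambda>z. f z * nome z powi (- n)) \<longlongrightarrow> c) ii_inf" using assms by (auto simp: has_order_def)
  have "((\<lambda>z. f z * nome z powi (- n)) \<longlongrightarrow> 0) ii_inf"
  proof (cases "m = n")
    case False
    hence lt: "n < m" using \<open>\<not> m < n\<close> by simp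
    have "((\<lambda>z. (f z * nome z powi (- m)) * nome z ^ nat (m - n)) \<longlongrightarrow> 0 * 0 ^ nat (m - n)) ii_inf"
      by (intro tendsto_intros nome_tendsto_0 assms(2))
    moreover have "(f z * nome z powi (- m)) * nome z ^ nat (m - n) = f z * nome z powi (- n)" for z
    proof -
      have "nome z ^ nat (m - n) = nome z powi (m - n)" using lt by (simp add: power_int_def)
      hence "nome z powi (- m) * nome z ^ nat (m - n) = nome z powi (- n)" by (simp flip: power_int_add)
      thus ?thesis by (simp add: mult.assoc)
    qed
    ultimately show ?thesis by simp
  qed (use assms(2) in simp)
  thus False using c tendsto_unique[OF ii_inf_neq_bot] by blast
qed

lemma has_order_unique: "has_order f n \<Longrightarrow> has_order f m \<Longrightarrow> n = m"
  using has_order_vanish vanish_has_order by (metis linorder_neqE less_irrefl)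

lemma has_order_add:
  assumes "has_order f n" "((\<lambda>z. g z * nome z powi (- n)) \<longlongrightarrow> 0) ii_inf"
  shows "has_order (\<lambda>z. f z + g z) n"
proof -
  obtain c where "c \<noteq> 0" "((\<lambda>z. f z * nome z powi (- n)) \<longlongrightarrow> c) ii_inf" using assms by (auto simp: has_order_def)
  thus ?thesis unfolding has_order_def
    using tendsto_add[of "\<lambda>z. f z * nome z powi (- n)" c ii_inf "\<lambda>z. g z * nome z powi (- n)" 0] assms(2)
    by (intro exI[of _ c]) (auto simp: distrib_right)
qed

lemma has_order_scale: "has_order f n \<Longrightarrow> c \<noteq> 0 \<Longrightarrow> has_order (\<lambda>z. c * f z) n"
  unfolding has_order_def
proof (elim exE conjE)
  fix d assume "c \<noteq> 0" "d \<noteq> 0" "((\<lambda>z. f z * nome z powi (- n)) \<longlongrightarrow> d) ii_inf"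
  thus "\<exists>ca. ca \<noteq> 0 \<and> ((\<lambda>z. c * f z * nome z powi (- n)) \<longlongrightarrow> ca) ii_inf"
    using tendsto_mult_left[of "\<lambda>z. f z * nome z powi (- n)" d ii_inf c] by (intro exI[of _ "c * d"]) (auto simp: mult.assoc)
qed

text \<open>
  Two functions of the same order differ, after scaling, by a function of larger order.
\<close>

lemma has_order_cancel:
  assumes "has_order f n" "has_order g n"
  obtains c where "((\<lambda>z. (f z - c * g z) * nome z powi (- n)) \<longlongrightarrow> 0) ii_inf"
proof -
  obtain c d where cd: "c \<noteq> 0" "d \<noteq> 0" "((\<lambda>z. f z * nome z powi (- n)) \<longlongrightarrow> c) ii_inf"
    "((\<lambda>z. g z * nome z powi (- n)) \<longlongrightarrow> d) ii_inf" using assms by (auto simp: has_order_def)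
  have "((\<lambda>z. f z * nome z powi (- n) - c / d * (g z * nome z powi (- n))) \<longlongrightarrow> c - c / d * d) ii_inf"
    by (intro tendsto_intros cd)
  hence "((\<lambda>z. (f z - c / d * g z) * nome z powi (- n)) \<longlongrightarrow> 0) ii_inf"
    using cd by (simp add: left_diff_distrib mult.assoc)
  thus ?thesis using that by blast
qed

lemma slash_identity: "slash k f (mat2 1 0 0 1) = f"
  by (simp add: fun_eq_iff slash_mat2)

lemma R_space_translation:
  assumes "f \<in> R_space k N" "z \<in> uhp"
  shows "f (z + 1) = f z"
  using invariant_formD[of k N f 1 1 1 0 z] assms by (auto simp: R_space_iff)

text \<open>
  The definition of \<open>R_space\<close> gives an expansion in \<open>q\<^sup>1\<^sup>/\<^sup>N\<close>. Invariance under \<open>z \<mapsto> z + 1\<close> makes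
  the leading exponent a multiple of \<open>N\<close>.
\<close>

lemma R_space_has_order:
  assumes N: "N > 0" and f: "f \<in> R_space k N" and nz: "f z0 \<noteq> 0"
  obtains n where "has_order f n"
proof -
  have hol: "f holomorphic_on uhp" and zero: "\<And>z. z \<notin> uhp \<Longrightarrow> f z = 0" using f by (auto simp: R_space_iff)
  have z0: "z0 \<in> uhp" using zero nz by blast
  have "meromorphic_at_ii_infinity N (slash k f (mat2 1 0 0 1))" using f unfolding R_space_iff by simp
  then obtain F y where F: "F meromorphic_on {0}" "\<And>z. Im z > y \<Longrightarrow> f z = F (nome (z / of_nat N))"
    unfolding slash_identity meromorphic_at_ii_infinity_def nome_def by auto
  have lim: "filterlim (\<lambda>z. nome (z / of_nat N)) (at 0) ii_inf"
    using filterlim_nome[of "1 / N" 0] N by simp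
  have ev: "eventually (\<lambda>z. f z = F (nome (z / of_nat N))) ii_inf"
    using F(2) by (auto simp: eventually_ii_inf)
  have "\<exists>\<^sub>F w in at 0. F w \<noteq> 0"
  proof (rule ccontr)
    assume "\<not> (\<exists>\<^sub>F w in at 0. F w \<noteq> 0)"
    hence "eventually (\<lambda>w. F w = 0) (at 0)" by (simp add: frequently_def)
    hence "eventually (\<lambda>z. F (nome (z / of_nat N)) = 0) ii_inf"
      using lim by (auto simp: filterlim_iff)
    hence "eventually (\<lambda>z. f z = 0 \<and> z \<in> uhp) ii_inf" using ev eventually_uhp by eventually_elim simp
    then obtain y' where y': "\<And>z. Im z > y' \<Longrightarrow> f z = 0 \<and> z \<in> uhp" by (auto simp: eventually_ii_inf)
    have "f z0 = 0"
    proof (rule analytic_continuation_open[of "{z. Im z > y'}" uhp f "\<lambda>_. 0"])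
      show "open {z. Im z > y'}" by (rule open_halfspace_Im_gt)
      have "Im (\<i> * of_real (y' + 1)) > y'" by simp
      thus "{z. Im z > y'} \<noteq> {}" by blast
    qed (use y' open_uhp connected_uhp hol z0 in auto)
    thus False using nz by contradiction
  qed
  moreover have "isolated_singularity_at F 0" "not_essential F 0" using F(1) by (auto simp: meromorphic_at_iff)
  ultimately obtain n g r where g: "r > 0" "g holomorphic_on cball 0 r" "g 0 \<noteq> 0"
    "\<And>w. w \<in> cball 0 r - {0} \<Longrightarrow> F w = g w * w powi n"
    using holomorphic_factor_puncture[of F 0] by auto
  have "isCont g 0"
    using holomorphic_on_imp_continuous_on[OF g(2)] g(1) by (intro continuous_on_interior[of "cball 0 r"]) auto
  hence "((\<lambda>z. g (nome (z / of_nat N))) \<longlongrightarrow> g 0) ii_inf"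
    using filterlim_compose[OF _ lim, of g "nhds (g 0)"] by (simp add: isCont_def)
  moreover have "eventually (\<lambda>w. w \<in> cball 0 r - {0}) (at 0)"
    using g(1) by (auto simp: eventually_at dist_commute intro!: exI[of _ r])
  hence "eventually (\<lambda>z. nome (z / of_nat N) \<in> cball 0 r - {0}) ii_inf" using lim by (auto simp: filterlim_iff)
  hence ev2: "eventually (\<lambda>z. g (nome (z / of_nat N)) = f z * nome (z / of_nat N) powi (- n)) ii_inf"
    using ev by eventually_elim (simp add: g(4) power_int_minus field_simps)
  ultimately have L: "((\<lambda>z. f z * nome (z / of_nat N) powi (- n)) \<longlongrightarrow> g 0) ii_inf"
    by (rule Lim_transform_eventually)
  have shift: "filterlim (\<lambda>z. z + 1) ii_inf ii_inf"
    unfolding ii_inf_def by (simp add: filterlim_filtercomap_iff o_def filterlim_filtercomap)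
  have "((\<lambda>z. f (z + 1) * nome ((z + 1) / of_nat N) powi (- n)) \<longlongrightarrow> g 0) ii_inf"
    by (rule filterlim_compose[OF L shift])
  moreover have "eventually (\<lambda>z. f (z + 1) * nome ((z + 1) / of_nat N) powi (- n) = (f z * nome (z / of_nat N) powi (- n)) * nome (1 / of_nat N) powi (- n)) ii_inf"
    using eventually_uhp by eventually_elim
      (simp add: R_space_translation[OF f] add_divide_distrib nome_add power_int_mult_distrib)
  ultimately have lim1: "((\<lambda>z. (f z * nome (z / of_nat N) powi (- n)) * nome (1 / of_nat N) powi (- n)) \<longlongrightarrow> g 0) ii_inf"
    by (rule Lim_transform_eventually)
  have lim2: "((\<lambda>z. (f z * nome (z / of_nat N) powi (- n)) * nome (1 / of_nat N) powi (- n)) \<longlongrightarrow> g 0 * nome (1 / of_nat N) powi (- n)) ii_inf"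
    by (intro tendsto_mult L tendsto_const)
  define \<zeta> where "\<zeta> = nome (1 / of_nat N) powi (- n)"
  have "g 0 * \<zeta> = g 0" unfolding \<zeta>_def by (rule tendsto_unique[OF ii_inf_neq_bot lim2 lim1])
  hence "\<zeta> = 1" using g(3) by simp
  hence "nome (of_int (- n) * (1 / of_nat N)) = nome 0" unfolding \<zeta>_def nome_powi by (simp only: nome_0)
  then obtain m where "of_int (- n) * (1 / of_nat N) = (0 :: complex) + of_int m" unfolding nome_eq_iff ..
  hence "(of_int (- n) :: complex) = of_int (int N * m)" using N by (simp add: field_simps)
  hence nm: "n = int N * (- m)" by (simp only: of_int_eq_iff)
  have "nome (z / of_nat N) powi (- n) = nome z powi (- (- m))" for z
    unfolding nome_powi using N by (simp add: nm)
  hence "has_order f (- m)" using L g(3) unfolding has_order_def by auto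
  thus ?thesis using that by blast
qed

text \<open>
  The leading term of a function is removed with an element of \<open>U\<close> of the same order. Orders grow
  in this way and are bounded above, so this ends. Only the orders between the two bounds may be
  missing in \<open>U\<close>, and one function for each of them completes \<open>U\<close>.
\<close>

theorem finite_codimension_of_orders:
  assumes N: "N > 0" and U: "fun_space.subspace U" "U \<subseteq> R_space k N"
    and upper: "\<And>f n. f \<in> R_space k N \<Longrightarrow> has_order f n \<Longrightarrow> n \<le> K"
    and lower: "\<And>n. n \<le> m0 \<Longrightarrow> \<exists>e\<in>U. has_order e n"
  shows "finite_codimension_in U (R_space k N)"
proof -
  let ?V = "R_space k N"
  note V = subspace_R_space[of k N]
  define I where "I = {n \<in> {m0<..K}. \<exists>f\<in>?V. has_order f n}"
  define b where "b = (\<lambda>n. SOME f. f \<in> ?V \<and> has_order f n)"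
  have b: "b n \<in> ?V" "has_order (b n) n" if "n \<in> I" for n
    using someI_ex[of "\<lambda>f. f \<in> ?V \<and> has_order f n"] that unfolding b_def I_def by auto
  define B where "B = b ` I"
  have "finite I" by (rule finite_subset[of _ "{m0<..K}"]) (auto simp: I_def)
  hence B: "finite B" "B \<subseteq> ?V" using b by (auto simp: B_def)
  have span_sub: "fun_space.span B \<subseteq> ?V" by (rule fun_space.span_minimal[OF B(2) V])
  define W where "W = {g + e | g e. g \<in> fun_space.span B \<and> e \<in> U}"
  have W: "fun_space.subspace W"
    unfolding W_def by (rule fun_space.subspace_sums[OF fun_space.subspace_span U(1)])
  have WI: "g \<in> W" if "g \<in> fun_space.span B \<or> g \<in> U" for g
    using that fun_space.subspace_0[OF U(1)] fun_space.span_zero[of B] unfolding W_def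
    by (metis (mono_tags, lifting) add.left_neutral add.right_neutral mem_Collect_eq)
  have main: "f \<in> W" if "f \<in> ?V" "has_order f n" for f n
    using that
  proof (induction "nat (K - n)" arbitrary: f n rule: less_induct)
    case less
    have "\<exists>w\<in>W. w \<in> ?V \<and> has_order w n"
    proof (cases "n \<le> m0")
      case True
      thus ?thesis using lower[OF True] WI U(2) by blast
    next
      case False
      hence "n \<in> I" using upper[OF less.prems] less.prems by (auto simp: I_def)
      hence "b n \<in> fun_space.span B" by (auto simp: B_def intro: fun_space.span_base)
      thus ?thesis using WI b[OF \<open>n \<in> I\<close>] by blast
    qed
    then obtain w where w: "w \<in> W" "w \<in> ?V" "has_order w n" by blast
    obtain c where c: "((\<lambda>z. (f z - c * w z) * nome z powi (- n)) \<longlongrightarrow> 0) ii_inf"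
      using has_order_cancel[OF less.prems(2) w(3)] by blast
    define h where "h = f - fun_scale c w"
    have hV: "h \<in> ?V" unfolding h_def
      by (intro fun_space.subspace_diff[OF V] fun_space.subspace_scale[OF V] less.prems(1) w(2))
    have "h \<in> W"
    proof (cases "\<exists>z0. h z0 \<noteq> 0")
      case True
      then obtain m where m: "has_order h m" using R_space_has_order[OF N hV] by blast
      have "n < m" by (rule vanish_has_order[OF m]) (use c in \<open>simp add: h_def fun_scale_def\<close>)
      moreover have "m \<le> K" by (rule upper[OF hV m])
      ultimately have "nat (K - m) < nat (K - n)" by simp
      from less.hyps[OF this hV m] show ?thesis .
    next
      case False
      hence "h = 0" by (auto simp: fun_eq_iff)
      thus ?thesis using fun_space.subspace_0[OF W] by simp
    qed
    moreover have "f = h + fun_scale c w" by (simp add: h_def)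
    ultimately show "f \<in> W"
      using fun_space.subspace_add[OF W] fun_space.subspace_scale[OF W] w(1) by metis
  qed
  have VW: "f \<in> W" if fV: "f \<in> ?V" for f
  proof (cases "\<exists>z0. f z0 \<noteq> 0")
    case True
    then obtain n where "has_order f n" using R_space_has_order[OF N fV] by blast
    thus ?thesis using main fV by blast
  next
    case False
    hence "f = 0" by (auto simp: fun_eq_iff)
    thus ?thesis using fun_space.subspace_0[OF W] by simp
  qed
  have coset: "(g + e) +o U = g +o U" if "e \<in> U" for g e
  proof -
    have "\<exists>u\<in>U. g + e + v = g + u" if "v \<in> U" for v
      using fun_space.subspace_add[OF U(1) \<open>e \<in> U\<close> that] by (intro bexI[of _ "e + v"]) (auto simp: add.assoc)
    moreover have "\<exists>u\<in>U. g + v = g + e + u" if "v \<in> U" for v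
      using fun_space.subspace_diff[OF U(1) that \<open>e \<in> U\<close>] by (intro bexI[of _ "v - e"]) auto
    ultimately show ?thesis unfolding elt_set_plus_def by blast
  qed
  have "quotient_space ?V U = (\<lambda>f. f +o U) ` fun_space.span B"
    unfolding quotient_space_def
  proof (intro equalityI subsetI)
    fix X assume "X \<in> (\<lambda>f. f +o U) ` ?V"
    then obtain f where f: "f \<in> ?V" "X = f +o U" by blast
    obtain g e where ge: "f = g + e" "g \<in> fun_space.span B" "e \<in> U" using VW[OF f(1)] by (auto simp: W_def)
    show "X \<in> (\<lambda>f. f +o U) ` fun_space.span B" using coset[OF ge(3)] ge f(2) by auto
  qed (use span_sub in auto)
  thus ?thesis unfolding finite_codimension_in_def using B by blast
qed

section \<open>Eta-quotients with all zeros at infinity\<close>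

text \<open>
  Halved exponents of an eta-quotient of positive weight that has no zero or pole at any cusp but
  \<open>\<infinity>\<close>. They are the product over the primes \<open>p\<close> dividing \<open>N\<close> of \<open>p\<close> at the full power of \<open>p\<close> minus
  \<open>1\<close> at the next lower power; for \<open>N = p\<close> the function is \<open>\<eta>(p z)\<^sup>2\<^sup>p / \<eta>(z)\<^sup>2\<close>.
\<close>

definition inf_vec :: "nat \<Rightarrow> nat \<Rightarrow> int" where
  "inf_vec N \<delta> = (\<Sum>S \<in> {S \<in> Pow (prime_factors N). N div \<Prod>S = \<delta>}. (- 1) ^ card S * int (\<Prod>(prime_factors N - S)))"

lemma prime_coprime_prod_primes:
  fixes p :: nat
  assumes "prime p" "finite S" "\<And>q. q \<in> S \<Longrightarrow> prime q \<and> q \<noteq> p"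
  shows "coprime p (\<Prod>S)"
proof (rule prime_imp_coprime[OF assms(1)])
  show "\<not> p dvd \<Prod>S"
  proof
    assume "p dvd \<Prod>S"
    then obtain q where "q \<in> S" "p dvd q" using prime_dvd_prod_iff[OF assms(2,1), of "\<lambda>x. x"] by auto
    thus False using assms(1,3) primes_dvd_imp_eq by blast
  qed
qed

lemma prod_primes_dvd:
  fixes N :: nat
  assumes "N > 0" "S \<subseteq> prime_factors N"
  shows "\<Prod>S dvd N"
proof -
  have "finite S" using assms finite_subset by blast
  thus ?thesis using assms(2)
  proof (induction S rule: finite_induct)
    case (insert p S)
    have p: "prime p" "p dvd N" using insert.prems by auto
    have "coprime p (\<Prod>S)"
      by (rule prime_coprime_prod_primes) (use insert p in auto)
    moreover have "\<Prod>S dvd N" using insert by blast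
    ultimately have "p * \<Prod>S dvd N" using p(2) by (intro divides_mult)
    thus ?case using insert.hyps by simp
  qed simp
qed

lemma inf_vec_sum:
  fixes g :: "nat \<Rightarrow> real"
  assumes N: "N > 0"
  shows "(\<Sum>\<delta> | \<delta> dvd N. of_int (inf_vec N \<delta>) * g \<delta>) =
    (\<Sum>S \<in> Pow (prime_factors N). (- 1) ^ card S * of_nat (\<Prod>(prime_factors N - S)) * g (N div \<Prod>S))"
proof -
  have "(\<Sum>\<delta> | \<delta> dvd N. of_int (inf_vec N \<delta>) * g \<delta>) =
     (\<Sum>\<delta> | \<delta> dvd N. \<Sum>S \<in> {S \<in> Pow (prime_factors N). N div \<Prod>S = \<delta>}.
        (- 1) ^ card S * of_nat (\<Prod>(prime_factors N - S)) * g (N div \<Prod>S))"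
    by (intro sum.cong refl) (auto simp: inf_vec_def sum_distrib_right intro!: sum.cong)
  also have "\<dots> = (\<Sum>S \<in> Pow (prime_factors N). (- 1) ^ card S * of_nat (\<Prod>(prime_factors N - S)) * g (N div \<Prod>S))"
  proof (rule sum.group)
    show "(\<lambda>S. N div \<Prod>S) ` Pow (prime_factors N) \<subseteq> {\<delta>. \<delta> dvd N}"
    proof clarify
      fix S assume "S \<subseteq> prime_factors N"
      hence "N div \<Prod>S * \<Prod>S = N" by (intro dvd_div_mult_self prod_primes_dvd[OF N])
      thus "N div \<Prod>S dvd N" by (metis dvd_triv_left)
    qed
  qed (use N in auto)
  finally show ?thesis .
qed

lemma sum_Pow_prod:
  fixes P :: "nat set" and a b :: "nat \<Rightarrow> real"
  assumes "finite P"
  shows "(\<Sum>S \<in> Pow P. (- 1) ^ card S * real (\<Prod>(P - S)) / (\<Prod>p\<in>S. b p)) = (\<Prod>p\<in>P. real p - 1 / b p)"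
proof -
  have "(\<Prod>p\<in>P. - (1 / b p) + real p) = (\<Sum>S \<in> Pow P. (\<Prod>p\<in>S. - (1 / b p)) * (\<Prod>p\<in>P - S. real p))"
    by (rule prod_add[OF assms])
  also have "\<dots> = (\<Sum>S \<in> Pow P. (- 1) ^ card S * real (\<Prod>(P - S)) / (\<Prod>p\<in>S. b p))"
  proof (intro sum.cong refl)
    fix S
    have "(\<Prod>p\<in>S. - (1 / b p)) = (\<Prod>p\<in>S. (- 1) * (1 / b p))" by simp
    also have "\<dots> = (- 1) ^ card S * (\<Prod>p\<in>S. 1 / b p)" by (subst prod.distrib) simp
    also have "(\<Prod>p\<in>S. 1 / b p) = 1 / (\<Prod>p\<in>S. b p)" by (simp add: prod_dividef)
    finally show "(\<Prod>p\<in>S. - (1 / b p)) * (\<Prod>p\<in>P - S. real p) = (- 1) ^ card S * real (\<Prod>(P - S)) / (\<Prod>p\<in>S. b p)"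
      by (simp add: of_nat_prod)
  qed
  finally show ?thesis by simp
qed

definition inf_weight :: "nat \<Rightarrow> int" where
  "inf_weight N = (\<Sum>\<delta> | \<delta> dvd N. inf_vec N \<delta>)"

lemma inf_weight_eq:
  assumes "N > 0"
  shows "of_int (inf_weight N) = (\<Prod>p\<in>prime_factors N. real p - 1)"
  using inf_vec_sum[OF assms, of "\<lambda>_. 1"] sum_Pow_prod[of "prime_factors N" "\<lambda>_. 1"]
  by (simp add: inf_weight_def)

lemma inf_weight_pos:
  assumes "N > 0"
  shows "inf_weight N > 0"
proof -
  have "(\<Prod>p\<in>prime_factors N. real p - 1) > 0"
    by (intro prod_pos) (auto dest!: in_prime_factors_imp_prime prime_gt_1_nat)
  thus ?thesis using inf_weight_eq[OF assms] by linarith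
qed

lemma cusp_sum_inf_vec_0:
  assumes N: "N > 0"
  shows "cusp_sum N (inf_vec N) 0 = N * (\<Prod>p\<in>prime_factors N. real p - 1 / real p)"
proof -
  have "cusp_sum N (inf_vec N) 0 = (\<Sum>\<delta> | \<delta> dvd N. of_int (inf_vec N \<delta>) * real \<delta>)"
    unfolding cusp_sum_def by (intro sum.cong refl) (auto simp: power2_eq_square)
  also have "\<dots> = (\<Sum>S \<in> Pow (prime_factors N). (- 1) ^ card S * of_nat (\<Prod>(prime_factors N - S)) * real (N div \<Prod>S))"
    by (rule inf_vec_sum[OF N])
  also have "\<dots> = (\<Sum>S \<in> Pow (prime_factors N). N * ((- 1) ^ card S * of_nat (\<Prod>(prime_factors N - S)) / (\<Prod>p\<in>S. real p)))"
    using prod_primes_dvd[OF N] by (intro sum.cong refl) (auto simp: real_of_nat_div of_nat_prod)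
  also have "\<dots> = N * (\<Prod>p\<in>prime_factors N. real p - 1 / real p)"
    unfolding sum_distrib_left[symmetric] by (subst sum_Pow_prod) auto
  finally show ?thesis .
qed

text \<open>
  In the product over the primes, \<open>p - 1 / p\<close> exceeds \<open>p - 1\<close>. The inequality makes the functions
  of \<open>inf_scale\<close> have a pole at \<open>\<infinity>\<close>.
\<close>

lemma cusp_sum_inf_vec_0_gt:
  assumes N: "N > 1"
  shows "cusp_sum N (inf_vec N) 0 > N * of_int (inf_weight N)"
proof -
  obtain q where "prime q" "q dvd N" using N prime_factor_nat[of N] by auto
  hence "q \<in> prime_factors N" using N by (simp add: in_prime_factors_iff)
  have "(\<Prod>p\<in>prime_factors N. real p - 1) < (\<Prod>p\<in>prime_factors N. real p - 1 / real p)"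
  proof (rule prod_mono_strict)
    show "q \<in> prime_factors N" by fact
    have *: "0 < real p - 1 \<and> real p - 1 < real p - 1 / real p" if "p \<in> prime_factors N" for p
    proof -
      have "p > 1" using that by (auto dest!: in_prime_factors_imp_prime prime_gt_1_nat)
      thus ?thesis by (simp add: field_simps)
    qed
    show "real q - 1 < real q - 1 / real q" using * \<open>q \<in> prime_factors N\<close> by blast
    show "0 \<le> real p - 1 \<and> real p - 1 \<le> real p - 1 / real p" "0 < real p - 1 / real p" if "p \<in> prime_factors N" for p
      using *[OF that] by linarith+
  qed auto
  thus ?thesis using N cusp_sum_inf_vec_0[of N] inf_weight_eq[of N] by simp
qed

text \<open>
  If \<open>p ^ a\<close> divides \<open>N\<close> but not \<open>c\<close>, then \<open>gcd \<delta> c\<close> is the same for \<open>\<delta> = N / T\<close> and \<open>\<delta> = N / (p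
  T)\<close>, so that the terms cancel in pairs.
\<close>

lemma cusp_sum_inf_vec_other:
  assumes N: "N > 0" and c: "\<not> int N dvd c"
  shows "cusp_sum N (inf_vec N) c = 0"
proof -
  obtain p a where p: "prime p" "p ^ a dvd N" "\<not> int (p ^ a) dvd c"
  proof -
    have nd: "\<not> N dvd nat \<bar>c\<bar>" using c by simp
    obtain p where p: "prime p" "\<not> multiplicity p N \<le> multiplicity p (nat \<bar>c\<bar>)"
      using multiplicity_le_imp_dvd[of N "nat \<bar>c\<bar>"] nd N by blast
    have "nat \<bar>c\<bar> \<noteq> 0" using nd by auto
    hence "\<not> p ^ multiplicity p N dvd nat \<bar>c\<bar>"
      using p not_prime_unit[of p] multiplicity_geI[of "nat \<bar>c\<bar>" p] by blast
    hence "\<not> int (p ^ multiplicity p N) dvd c" by simp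
    moreover have "p ^ multiplicity p N dvd N" by (rule multiplicity_dvd)
    ultimately show ?thesis using that p(1) by blast
  qed
  have a: "a > 0" using p(3) by (cases a) auto
  hence pP: "p \<in> prime_factors N" using p N dvd_power[of a p] dvd_trans by (auto simp: in_prime_factors_iff)
  define P where "P = prime_factors N - {p}"
  have P: "prime_factors N = insert p P" "p \<notin> P" "finite P" using pP by (auto simp: P_def)
  have pr: "prime q" if "q \<in> prime_factors N" for q using that by auto
  define F where "F = (\<lambda>S. (- 1) ^ card S * real (\<Prod>(prime_factors N - S)) * (of_int (gcd (int (N div \<Prod>S)) c) ^ 2 / real (N div \<Prod>S)))"
  have pair: "F S + F (insert p S) = 0" if "S \<subseteq> P" for S
  proof -
    have fS: "finite S" "p \<notin> S" using that P finite_subset by auto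
    define T where "T = \<Prod>S"
    have T: "p * T dvd N" using prod_primes_dvd[OF N, of "insert p S"] that P fS by (simp add: T_def) blast
    then obtain \<delta> where \<delta>: "N = p * T * \<delta>" by blast
    have T0: "T > 0" "\<delta> > 0" "p > 0" using \<delta> N by (auto intro!: Nat.gr0I)
    have 1: "N div \<Prod>S = p * \<delta>" "N div \<Prod>(insert p S) = \<delta>"
      using T0 fS by (auto simp: T_def[symmetric] \<delta>)
    have "coprime p T" unfolding T_def
      by (rule prime_coprime_prod_primes) (use p(1) that P fS pr in auto)
    hence "coprime (p ^ a) T" by simp
    moreover have "p ^ a dvd T * (p * \<delta>)" using p(2) by (simp add: \<delta> mult_ac)
    ultimately have pa: "p ^ a dvd p * \<delta>" by (simp add: coprime_dvd_mult_right_iff)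
    have "gcd (int (p * \<delta>)) c dvd int \<delta>"
    proof -
      obtain m where m: "int (p * \<delta>) = gcd (int (p * \<delta>)) c * m" by (metis dvdE gcd_dvd1)
      have "int p dvd m"
      proof (rule ccontr)
        assume "\<not> int p dvd m"
        hence "coprime (int p) m" using p(1) prime_imp_coprime by (metis prime_int_nat_transfer prime_nat_int_transfer)
        hence "coprime (int (p ^ a)) m" by simp
        moreover have "int (p ^ a) dvd gcd (int (p * \<delta>)) c * m" unfolding m[symmetric] using pa by (simp only: int_dvd_int_iff)
        ultimately have "int (p ^ a) dvd gcd (int (p * \<delta>)) c" by (simp add: coprime_dvd_mult_left_iff)
        thus False using p(3) dvd_trans gcd_dvd2 by blast
      qed
      then obtain m' where "m = int p * m'" by blast
      hence "int p * int \<delta> = int p * (gcd (int (p * \<delta>)) c * m')" using m by (simp add: mult_ac)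
      hence "int \<delta> = gcd (int (p * \<delta>)) c * m'" using T0 by simp
      thus ?thesis by (metis dvd_triv_left)
    qed
    hence "gcd (int (p * \<delta>)) c dvd gcd (int \<delta>) c" by simp
    moreover have "gcd (int \<delta>) c dvd gcd (int (p * \<delta>)) c" by (simp add: gcd_greatest dvd_mult)
    ultimately have g: "gcd (int (p * \<delta>)) c = gcd (int \<delta>) c" by (intro zdvd_antisym_nonneg) auto
    have "prime_factors N - S = insert p (P - S)" "prime_factors N - insert p S = P - S" using P fS by auto
    hence 2: "\<Prod>(prime_factors N - S) = p * \<Prod>(P - S)" "\<Prod>(prime_factors N - insert p S) = \<Prod>(P - S)"
      using P by auto
    show ?thesis unfolding F_def 1 2 g using T0 fS by simp
  qed
  have "cusp_sum N (inf_vec N) c = (\<Sum>S \<in> Pow (prime_factors N). F S)"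
    unfolding cusp_sum_def F_def using inf_vec_sum[OF N, of "\<lambda>\<delta>. of_int (gcd (int \<delta>) c) ^ 2 / real \<delta>"] by simp
  also have "\<dots> = (\<Sum>S \<in> Pow P. F S) + (\<Sum>S \<in> insert p ` Pow P. F S)"
    unfolding P(1) Pow_insert by (rule sum.union_disjoint) (use P in auto)
  also have "(\<Sum>S \<in> insert p ` Pow P. F S) = (\<Sum>S \<in> Pow P. F (insert p S))"
    by (subst sum.reindex) (use P in \<open>auto simp: inj_on_def\<close>)
  also have "(\<Sum>S \<in> Pow P. F S) + \<dots> = (\<Sum>S \<in> Pow P. F S + F (insert p S))" by (simp add: sum.distrib)
  also have "\<dots> = 0" using pair by (intro sum.neutral) auto
  finally show ?thesis .
qed

lemma trivial_multiplier_12: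
  assumes "\<And>\<delta>. \<delta> dvd N \<Longrightarrow> 12 dvd s \<delta>"
  shows "trivial_multiplier N s"
  unfolding trivial_multiplier_def using assms by (auto intro!: dvd_sum dvd_mult2)

lemma cusp_sum_linear:
  "cusp_sum N (\<lambda>\<delta>. x * s \<delta> + y * t \<delta>) c = of_int x * cusp_sum N s c + of_int y * cusp_sum N t c"
  unfolding cusp_sum_def sum_distrib_left sum.distrib[symmetric]
  by (intro sum.cong refl) (simp add: add_divide_distrib distrib_right mult.assoc)

section \<open>Orders of eta-quotients and the valence bound\<close>

lemma cusp_sum_0: "cusp_sum N s 0 = of_int (\<Sum>\<delta> | \<delta> dvd N. int \<delta> * s \<delta>)"
  unfolding cusp_sum_def of_int_sum by (intro sum.cong refl) (auto simp: power2_eq_square)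

text \<open>
  An eta-quotient is a power of \<open>q\<close> times this power series in \<open>q\<close>.
\<close>

definition euler_quot :: "nat \<Rightarrow> (nat \<Rightarrow> int) \<Rightarrow> complex \<Rightarrow> complex" where
  "euler_quot N r w = (\<Prod>\<delta> | \<delta> dvd N. euler_prod (w ^ \<delta>) powi r \<delta>)"

lemma euler_quot_0 [simp]:
  assumes "N > 0"
  shows "euler_quot N r 0 = 1"
  unfolding euler_quot_def
proof (rule prod.neutral, rule ballI)
  fix \<delta> assume "\<delta> \<in> {\<delta>. \<delta> dvd N}"
  hence "\<delta> > 0" using assms by (auto intro: dvd_pos_nat)
  thus "euler_prod (0 ^ \<delta>) powi r \<delta> = 1" by (simp add: zero_power)
qed

lemma euler_quot_deriv:
  assumes "N > 0"
  shows "(euler_quot N r has_field_derivative - of_int (r 1)) (at 0)"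
proof -
  have fin: "finite {\<delta>. \<delta> dvd N}" using assms by simp
  have e: "((\<lambda>w. euler_prod (w ^ \<delta>)) has_field_derivative (if \<delta> = 1 then - 1 else 0)) (at 0)" if "\<delta> dvd N" for \<delta>
  proof -
    have \<delta>: "\<delta> > 0" using that assms by (auto intro: dvd_pos_nat)
    have "((\<lambda>w. euler_prod (w ^ \<delta>)) has_field_derivative - 1 * (of_nat \<delta> * 0 ^ (\<delta> - 1))) (at 0)"
      by (rule DERIV_chain'[of "\<lambda>w. w ^ \<delta>" _ _ _ euler_prod])
         (use \<delta> euler_prod_deriv_0 in \<open>auto intro!: derivative_eq_intros simp: zero_power\<close>)
    moreover have "- 1 * (of_nat \<delta> * 0 ^ (\<delta> - 1)) = (if \<delta> = 1 then - 1 else (0::complex))"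
      using \<delta> by (auto simp: zero_power)
    ultimately show ?thesis by simp
  qed
  have p: "((\<lambda>w. euler_prod (w ^ \<delta>) powi r \<delta>) has_field_derivative (if \<delta> = 1 then - of_int (r 1) else 0)) (at 0)" if "\<delta> dvd N" for \<delta>
  proof -
    have "\<delta> > 0" using that assms by (auto intro: dvd_pos_nat)
    thus ?thesis using DERIV_power_int[OF e[OF that], of "r \<delta>"] by (auto simp: zero_power split: if_splits)
  qed
  have "((\<lambda>w. \<Prod>\<delta>\<in>A. euler_prod (w ^ \<delta>) powi r \<delta>) has_field_derivative (\<Sum>\<delta>\<in>A. if \<delta> = 1 then - of_int (r 1) else 0)) (at 0)"
    if "finite A" "A \<subseteq> {\<delta>. \<delta> dvd N}" for A
    using that
  proof (induction A rule: finite_induct)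
    case (insert \<delta> A)
    have one: "euler_prod (0 ^ \<delta>) powi r \<delta> = 1" if "\<delta> dvd N" for \<delta>
    proof -
      have "\<delta> > 0" using that assms by (auto intro: dvd_pos_nat)
      thus ?thesis by (simp add: zero_power)
    qed
    have prodA: "(\<Prod>\<delta>\<in>A. euler_prod (0 ^ \<delta>) powi r \<delta>) = 1" by (rule prod.neutral) (use one insert.prems in blast)
    have \<delta>: "\<delta> dvd N" and A: "A \<subseteq> {\<delta>. \<delta> dvd N}" using insert.prems by auto
    from DERIV_mult[OF p[OF \<delta>] insert.IH[OF A]] show ?case
      unfolding prodA one[OF \<delta>] mult_1_right prod.insert[OF insert.hyps] sum.insert[OF insert.hyps] .
  qed simp
  from this[OF fin] show ?thesis
    unfolding euler_quot_def [abs_def] using fin assms by (simp add: sum.delta)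
qed

lemma eta_quotient_q_expansion:
  assumes "N > 0" "z \<in> uhp"
  shows "eta_quotient N r z = nome (of_int (\<Sum>\<delta> | \<delta> dvd N. int \<delta> * r \<delta>) / 24 * z) * euler_quot N r (nome z)"
proof -
  have fin: "finite {\<delta>. \<delta> dvd N}" using assms by simp
  have "eta_quotient N r z = (\<Prod>\<delta> | \<delta> dvd N. (nome (of_nat \<delta> * z / 24) * euler_prod (nome z ^ \<delta>)) powi r \<delta>)"
    using assms by (simp add: eta_quotient_def dedekind_eta_altdef nome_of_nat_mult)
  also have "\<dots> = (\<Prod>\<delta> | \<delta> dvd N. nome (of_nat \<delta> * z / 24) powi r \<delta>) * euler_quot N r (nome z)"
    by (simp add: power_int_mult_distrib prod.distrib euler_quot_def)
  also have "(\<Prod>\<delta> | \<delta> dvd N. nome (of_nat \<delta> * z / 24) powi r \<delta>) = nome (\<Sum>\<delta> | \<delta> dvd N. of_int (r \<delta>) * (of_nat \<delta> * z / 24))"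
    using fin by (induction rule: finite_induct) (auto simp: nome_powi nome_add)
  also have "(\<Sum>\<delta> | \<delta> dvd N. of_int (r \<delta>) * (of_nat \<delta> * z / 24)) = of_int (\<Sum>\<delta> | \<delta> dvd N. int \<delta> * r \<delta>) / 24 * z"
    unfolding of_int_sum sum_divide_distrib sum_distrib_right by (intro sum.cong refl) simp
  finally show ?thesis .
qed

lemma euler_quot_limit:
  assumes "N > 0"
  shows "((\<lambda>z. euler_quot N r (nome z)) \<longlongrightarrow> 1) ii_inf"
proof -
  have "isCont (euler_quot N r) 0" using euler_quot_deriv[OF assms] DERIV_isCont by blast
  thus ?thesis using filterlim_compose[OF _ filterlim_nome[of 1 0], of "euler_quot N r" "nhds (euler_quot N r 0)"] assms
    by (simp add: isCont_def)
qed

lemma eta_quotient_normalized: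
  assumes "N > 0" "z \<in> uhp" "(\<Sum>\<delta> | \<delta> dvd N. int \<delta> * r \<delta>) = 24 * n"
  shows "eta_quotient N r z * nome z powi (- n) = euler_quot N r (nome z)"
proof -
  have "nome (of_int n * z) * nome z powi (- n) = 1" by (simp add: nome_powi flip: nome_add)
  thus ?thesis using eta_quotient_q_expansion[OF assms(1,2), of r] assms(3) by (simp add: mult_ac)
qed

lemma eta_quotient_has_order:
  assumes "N > 0" "(\<Sum>\<delta> | \<delta> dvd N. int \<delta> * r \<delta>) = 24 * n"
  shows "has_order (eta_quotient N r) n"
proof -
  have "((\<lambda>z. eta_quotient N r z * nome z powi (- n)) \<longlongrightarrow> 1) ii_inf"
    by (rule Lim_transform_eventually[OF euler_quot_limit[OF assms(1), of r]])
       (use eventually_uhp in \<open>eventually_elim, simp add: eta_quotient_normalized[OF assms(1) _ assms(2)]\<close>)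
  thus ?thesis unfolding has_order_def by (intro exI[of _ 1]) simp
qed

text \<open>
  A valence bound. Let \<open>e\<close> be the eta-quotient of weight \<open>w\<close> with all zeros at \<open>\<infinity>\<close>. For \<open>f\<close> of
  weight \<open>k\<close> the function \<open>f\<^sup>w / e\<^sup>k\<close> has weight \<open>0\<close> and is bounded at the other cusps, where \<open>e\<close>
  has order \<open>0\<close>. If the order of \<open>f\<close> at \<open>\<infinity>\<close> exceeds \<open>k / w\<close> times that of \<open>e\<close>, it vanishes at \<open>\<infinity>\<close>,
  and hence everywhere.
\<close>

theorem R_space_order_bound:
  assumes N: "N > 0"
  obtains K :: int where "\<And>f n. f \<in> R_space (int k) N \<Longrightarrow> has_order f n \<Longrightarrow> n \<le> K"
proof -
  define s where "s = (\<lambda>\<delta>. 12 * inf_vec N \<delta>)"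
  define w where "w = nat (12 * inf_weight N)"
  have w: "w > 0" "int w = 12 * inf_weight N" using inf_weight_pos[OF N] by (auto simp: w_def)
  have sw: "(\<Sum>\<delta> | \<delta> dvd N. s \<delta>) = int w" by (simp add: s_def w(2) inf_weight_def sum_distrib_left)
  have triv: "trivial_multiplier N s" by (rule trivial_multiplier_12) (simp add: s_def)
  define e where "e = eta_quotient N (\<lambda>\<delta>. 2 * s \<delta>)"
  define m where "m = (\<Sum>\<delta> | \<delta> dvd N. int \<delta> * inf_vec N \<delta>)"
  have "has_order e m" unfolding e_def
    by (rule eta_quotient_has_order[OF N]) (simp add: s_def m_def sum_distrib_left mult_ac)
  have e_nz: "e z \<noteq> 0" if "z \<in> uhp" for z unfolding e_def by (rule eta_quotient_nonzero[OF N that])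
  have e_inv: "invariant_form (int w) N e" unfolding e_def by (rule invariant_eta_quotient[OF N sw triv])
  show ?thesis
  proof
    fix f n assume f: "f \<in> R_space (int k) N" and n: "has_order f n"
    show "n \<le> int k * m"
    proof (rule ccontr)
      assume "\<not> n \<le> int k * m"
      have "real_of_int m = cusp_sum N (inf_vec N) 0" by (simp add: cusp_sum_0 m_def)
      also have "\<dots> \<ge> 0" unfolding cusp_sum_inf_vec_0[OF N]
      proof (intro mult_nonneg_nonneg prod_nonneg)
        fix p assume "p \<in> prime_factors N"
        hence "real p > 1" by (auto dest!: in_prime_factors_imp_prime prime_gt_1_nat)
        moreover from this have "1 / real p < 1" by simp
        ultimately show "0 \<le> real p - 1 / real p" by linarith
      qed simp
      finally have "m \<ge> 0" by simp
      hence "n > 0" using \<open>\<not> n \<le> int k * m\<close> by (meson le_less_trans linorder_not_le mult_nonneg_nonneg of_nat_0_le_iff)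
      hence "int w * n \<ge> 1 * n" using w(1) by (intro mult_right_mono) auto
      hence gt: "int w * n - int k * m > 0" using \<open>\<not> n \<le> int k * m\<close> by linarith
      define H where "H = (\<lambda>z. f z ^ w / e z ^ k)"
      have f_hol: "f holomorphic_on uhp" and f_inv: "invariant_form (int k) N f" using f by (auto simp: R_space_iff)
      have H_inv: "H (mob a b c d z) = H z" if det: "a * d - b * c = 1" and c: "int N dvd c" and z: "z \<in> uhp" for a b c d z
      proof -
        define J where "J = of_int c * z + of_int d"
        have J: "J \<noteq> 0" unfolding J_def by (rule uhp_lin_nonzero[OF z det])
        have "f (mob a b c d z) = J ^ k * f z" "e (mob a b c d z) = J ^ w * e z"
          using invariant_formD[OF f_inv det c z] invariant_formD[OF e_inv det c z] by (simp_all add: J_def)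
        thus ?thesis using J unfolding H_def by (simp only: power_mult_distrib) (simp add: power_mult[symmetric] mult.commute)
      qed
      have H_ord: "has_order H (int w * n - int k * m)"
      proof -
        obtain c d where cd: "c \<noteq> 0" "d \<noteq> 0" "((\<lambda>z. f z * nome z powi (- n)) \<longlongrightarrow> c) ii_inf"
          "((\<lambda>z. e z * nome z powi (- m)) \<longlongrightarrow> d) ii_inf"
          using n \<open>has_order e m\<close> by (auto simp: has_order_def)
        have "((\<lambda>z. (f z * nome z powi (- n)) ^ w / (e z * nome z powi (- m)) ^ k) \<longlongrightarrow> c ^ w / d ^ k) ii_inf"
          by (intro tendsto_intros cd) (use cd in auto)
        moreover have "(f z * nome z powi (- n)) ^ w / (e z * nome z powi (- m)) ^ k = H z * nome z powi (- (int w * n - int k * m))" for z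
        proof -
          have "(x powi (- a)) ^ b = x powi (- (int b * a))" for x :: complex and a b
            using power_int_mult[of x "- a" "int b"] by (simp add: mult.commute)
          hence "(f z * nome z powi (- n)) ^ w / (e z * nome z powi (- m)) ^ k
              = H z * (nome z powi (- (int w * n)) / nome z powi (- (int k * m)))"
            by (simp add: H_def power_mult_distrib)
          also have "nome z powi (- (int w * n)) / nome z powi (- (int k * m)) = nome z powi (- (int w * n) - - (int k * m))"
            by (rule power_int_diff[symmetric]) simp
          finally show ?thesis by simp
        qed
        ultimately show ?thesis unfolding has_order_def using cd by (intro exI[of _ "c ^ w / d ^ k"]) auto
      qed
      have H_lim: "(H \<longlongrightarrow> 0) ii_inf" using has_order_vanish[OF H_ord gt] by simp
      have H_bd: "\<exists>C. eventually (\<lambda>z. norm (H (mob a b c d z)) \<le> C) ii_inf" if det: "a * d - b * c = 1" for a b c d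
      proof (cases "int N dvd c")
        case True
        have "eventually (\<lambda>z. norm (H z) < 1) ii_inf"
          using order_tendstoD(2)[OF tendsto_norm[OF H_lim], of 1] by simp
        hence "eventually (\<lambda>z. norm (H (mob a b c d z)) \<le> 1) ii_inf"
          using eventually_uhp by eventually_elim (simp add: H_inv[OF det True])
        thus ?thesis by blast
      next
        case False
        have "holomorphic_at_ii_infinity N (slash k f (mat2 a b c d))" using f det False by (simp add: R_space_iff)
        then obtain C where C: "eventually (\<lambda>z. norm (slash k f (mat2 a b c d) z) \<le> C) ii_inf"
          using holomorphic_at_ii_infinityD N by blast
        have "ii_growth (slash w e (mat2 a b c d)) (cusp_sum N s c / 12)"
          unfolding e_def by (rule slash_eta_quotient_growth[OF N det sw])
        moreover have "cusp_sum N s c = 0"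
          using cusp_sum_linear[of N 12 "inf_vec N" 0 "\<lambda>_. 0" c] cusp_sum_inf_vec_other[OF N False] by (simp add: s_def)
        ultimately obtain D where D: "D > 0" "((\<lambda>z. norm (slash w e (mat2 a b c d) z)) \<longlongrightarrow> D) ii_inf"
          by (auto simp: ii_growth_def)
        have "eventually (\<lambda>z. norm (slash w e (mat2 a b c d) z) > D / 2) ii_inf"
          by (rule order_tendstoD(1)[OF D(2)]) (use D(1) in simp)
        hence "eventually (\<lambda>z. norm (H (mob a b c d z)) \<le> \<bar>C\<bar> ^ w / (D / 2) ^ k) ii_inf"
          using C eventually_uhp
        proof eventually_elim
          case (elim z)
          define J where "J = of_int c * z + of_int d"
          have J: "J \<noteq> 0" unfolding J_def by (rule uhp_lin_nonzero[OF elim(3) det])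
          have "f (mob a b c d z) = J ^ k * slash k f (mat2 a b c d) z" "e (mob a b c d z) = J ^ w * slash w e (mat2 a b c d) z"
            unfolding slash_mat2 J_def[symmetric] using J by (simp_all add: power_int_minus)
          hence "H (mob a b c d z) = slash k f (mat2 a b c d) z ^ w / slash w e (mat2 a b c d) z ^ k"
            using J unfolding H_def by (simp only: power_mult_distrib) (simp add: power_mult[symmetric] mult.commute)
          hence "norm (H (mob a b c d z)) = norm (slash k f (mat2 a b c d) z) ^ w / norm (slash w e (mat2 a b c d) z) ^ k"
            by (simp add: norm_divide norm_power)
          also have "\<dots> \<le> \<bar>C\<bar> ^ w / (D / 2) ^ k"
            using elim D(1) by (intro frac_le power_mono) auto
          finally show ?case .
        qed
        thus ?thesis by blast
      qed
      have "H holomorphic_on uhp"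
        unfolding H_def e_def using eta_quotient_nonzero[OF N]
        by (intro holomorphic_intros f_hol holomorphic_eta_quotient[OF N]) auto
      hence "H z = 0" if "z \<in> uhp" for z
        by (rule bounded_invariant_vanishing[OF N _ H_inv H_bd H_lim that])
      hence "eventually (\<lambda>z. H z = 0) ii_inf" using eventually_uhp by (auto elim: eventually_mono)
      hence "has_order (\<lambda>z. 0) (int w * n - int k * m)" by (rule has_order_cong[OF H_ord])
      thus False by (auto simp: has_order_def LIM_const_eq tendsto_const_iff)
    qed
  qed
qed

section \<open>Products and functions of weight zero\<close>

lemma powi_prod_cancel:
  fixes j :: complex
  assumes "j \<noteq> 0"
  shows "j powi (- (k + l)) * (a * b) = (j powi (- k) * a) * (j powi (- l) * b)"
proof -
  have "j powi (- (k + l)) = j powi (- k) * j powi (- l)" using power_int_add[of j "- k" "- l"] assms by simp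
  thus ?thesis by (simp only: mult_ac)
qed

lemma slash_mult:
  assumes "a * d - b * c = 1" "z \<in> uhp"
  shows "slash (k + l) (\<lambda>z. f z * g z) (mat2 a b c d) z = slash k f (mat2 a b c d) z * slash l g (mat2 a b c d) z"
  unfolding slash_mat2 by (rule powi_prod_cancel) (rule uhp_lin_nonzero[OF assms(2,1)])

lemma holomorphic_at_ii_infinity_mult:
  assumes "holomorphic_at_ii_infinity N f" "holomorphic_at_ii_infinity N g"
    "eventually (\<lambda>z. h z = f z * g z) ii_inf"
  shows "holomorphic_at_ii_infinity N h"
proof -
  obtain F y where F: "F analytic_on {0}" "\<And>z. Im z > y \<Longrightarrow> f z = F (exp (2 * of_real pi * \<i> * z / of_nat N))"
    using assms(1) unfolding holomorphic_at_ii_infinity_def by blast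
  obtain G x where G: "G analytic_on {0}" "\<And>z. Im z > x \<Longrightarrow> g z = G (exp (2 * of_real pi * \<i> * z / of_nat N))"
    using assms(2) unfolding holomorphic_at_ii_infinity_def by blast
  obtain t where t: "\<And>z. Im z > t \<Longrightarrow> h z = f z * g z" using assms(3) by (auto simp: eventually_ii_inf)
  show ?thesis unfolding holomorphic_at_ii_infinity_def
    by (intro exI[of _ "\<lambda>w. F w * G w"] exI[of _ "max (max x y) t"] conjI analytic_on_mult F G) (use F G t in auto)
qed

lemma meromorphic_at_ii_infinity_mult:
  assumes "meromorphic_at_ii_infinity N f" "meromorphic_at_ii_infinity N g"
    "eventually (\<lambda>z. h z = f z * g z) ii_inf"
  shows "meromorphic_at_ii_infinity N h"
proof -
  obtain F y where F: "F meromorphic_on {0}" "\<And>z. Im z > y \<Longrightarrow> f z = F (exp (2 * of_real pi * \<i> * z / of_nat N))"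
    using assms(1) unfolding meromorphic_at_ii_infinity_def by blast
  obtain G x where G: "G meromorphic_on {0}" "\<And>z. Im z > x \<Longrightarrow> g z = G (exp (2 * of_real pi * \<i> * z / of_nat N))"
    using assms(2) unfolding meromorphic_at_ii_infinity_def by blast
  obtain t where t: "\<And>z. Im z > t \<Longrightarrow> h z = f z * g z" using assms(3) by (auto simp: eventually_ii_inf)
  show ?thesis unfolding meromorphic_at_ii_infinity_def
    by (intro exI[of _ "\<lambda>w. F w * G w"] exI[of _ "max (max x y) t"] conjI meromorphic_on_mult F G) (use F G t in auto)
qed

lemma R_space_mult:
  assumes "f \<in> R_space k N" "g \<in> R_space l N"
  shows "(\<lambda>z. f z * g z) \<in> R_space (k + l) N"
  unfolding R_space_iff
proof (intro conjI allI impI)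
  note F = assms(1)[unfolded R_space_iff] and G = assms(2)[unfolded R_space_iff]
  show "f z * g z = 0" if "z \<notin> uhp" for z using F that by simp
  show "(\<lambda>z. f z * g z) holomorphic_on uhp" using F G by (intro holomorphic_intros) auto
  show "invariant_form (k + l) N (\<lambda>z. f z * g z)"
    unfolding invariant_form_def
  proof (intro allI impI ballI)
    fix a b c d z assume *: "a * d - b * c = 1" "int N dvd c" "z \<in> uhp"
    have "of_int c * z + of_int d \<noteq> 0" by (rule uhp_lin_nonzero[OF *(3,1)])
    thus "f (mob a b c d z) * g (mob a b c d z) = (of_int c * z + of_int d) powi (k + l) * (f z * g z)"
      using invariant_formD[OF _ *, of k f] invariant_formD[OF _ *, of l g] F G by (simp add: power_int_add mult_ac)
  qed
  fix a b c d :: int assume det: "a * d - b * c = 1"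
  have ev: "eventually (\<lambda>z. slash (k + l) (\<lambda>z. f z * g z) (mat2 a b c d) z = slash k f (mat2 a b c d) z * slash l g (mat2 a b c d) z) ii_inf"
    using eventually_uhp by eventually_elim (rule slash_mult[OF det])
  show "meromorphic_at_ii_infinity N (slash (k + l) (\<lambda>z. f z * g z) (mat2 a b c d))"
    using F G det by (intro meromorphic_at_ii_infinity_mult[OF _ _ ev]) auto
  assume "\<not> int N dvd c"
  thus "holomorphic_at_ii_infinity N (slash (k + l) (\<lambda>z. f z * g z) (mat2 a b c d))"
    using F G det by (intro holomorphic_at_ii_infinity_mult[OF _ _ ev]) auto
qed

lemma eta_quotient_mult:
  assumes "N > 0"
  shows "(\<lambda>z. eta_quotient N r z * eta_quotient N r' z) = eta_quotient N (\<lambda>\<delta>. r \<delta> + r' \<delta>)"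
proof
  fix z
  show "eta_quotient N r z * eta_quotient N r' z = eta_quotient N (\<lambda>\<delta>. r \<delta> + r' \<delta>) z"
  proof (cases "z \<in> uhp")
    case True
    have "dedekind_eta (of_nat \<delta> * z) \<noteq> 0" if "\<delta> dvd N" for \<delta>
      using dedekind_eta_nonzero dvd_scale_uhp[OF that assms True] by blast
    thus ?thesis using True by (auto simp: eta_quotient_def power_int_add prod.distrib[symmetric] intro!: prod.cong)
  qed (simp add: eta_quotient_def)
qed

lemma prod_power_int:
  fixes f :: "'a \<Rightarrow> complex"
  shows "(\<Prod>x\<in>A. f x) powi n = (\<Prod>x\<in>A. f x powi n)"
  by (induction A rule: infinite_finite_induct) (simp_all add: power_int_mult_distrib)

lemma eta_quotient_power_int:
  assumes "z \<in> uhp"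
  shows "eta_quotient N (\<lambda>\<delta>. n * r \<delta>) z = eta_quotient N r z powi n"
proof -
  have "x powi (n * m) = (x powi m) powi n" for x :: complex and m
    by (metis mult.commute power_int_mult)
  thus ?thesis using assms by (simp add: eta_quotient_def prod_power_int)
qed

text \<open>
  Products of eta-quotients are eta-quotients; linearity in each factor extends this to the spans.
\<close>

lemma E_space_mult:
  assumes N: "N > 0" and f: "f \<in> E_space k N" and g: "g \<in> E_space l N"
  shows "(\<lambda>z. f z * g z) \<in> E_space (k + l) N"
proof -
  let ?B = "\<lambda>k. range (eta_quotient N) \<inter> R_space k N"
  have base: "(\<lambda>z. f z * g z) \<in> ?B (k + l)" if "f \<in> ?B k" "g \<in> ?B l" for f g
    using that R_space_mult eta_quotient_mult[OF N] by blast
  have sub: "fun_space.subspace {g. (\<lambda>z. f z * g z) \<in> E_space (k + l) N}" for f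
    unfolding E_space_def
  proof (rule fun_space.subspaceI)
    have "(\<lambda>z. f z * (0 :: complex \<Rightarrow> complex) z) = 0" by (simp add: fun_eq_iff)
    thus "0 \<in> {g. (\<lambda>z. f z * g z) \<in> fun_space.span (?B (k + l))}" by (simp add: fun_space.span_zero)
  next
    fix x y assume "x \<in> {g. (\<lambda>z. f z * g z) \<in> fun_space.span (?B (k + l))}" "y \<in> {g. (\<lambda>z. f z * g z) \<in> fun_space.span (?B (k + l))}"
    moreover have "(\<lambda>z. f z * (x + y) z) = (\<lambda>z. f z * x z) + (\<lambda>z. f z * y z)" by (simp add: fun_eq_iff algebra_simps)
    ultimately show "x + y \<in> {g. (\<lambda>z. f z * g z) \<in> fun_space.span (?B (k + l))}" by (simp add: fun_space.span_add)
  next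
    fix c x assume "x \<in> {g. (\<lambda>z. f z * g z) \<in> fun_space.span (?B (k + l))}"
    moreover have "(\<lambda>z. f z * fun_scale c x z) = fun_scale c (\<lambda>z. f z * x z)" by (simp add: fun_eq_iff fun_scale_def)
    ultimately show "fun_scale c x \<in> {g. (\<lambda>z. f z * g z) \<in> fun_space.span (?B (k + l))}" by (simp add: fun_space.span_scale)
  qed
  have 1: "(\<lambda>z. f z * g z) \<in> E_space (k + l) N" if "f \<in> ?B k" for f
  proof -
    have "?B l \<subseteq> {g. (\<lambda>z. f z * g z) \<in> E_space (k + l) N}"
      using base[OF that] unfolding E_space_def by (auto intro!: fun_space.span_base)
    from fun_space.span_minimal[OF this sub] g show ?thesis unfolding E_space_def by blast
  qed
  have "?B k \<subseteq> {f. (\<lambda>z. g z * f z) \<in> E_space (k + l) N}"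
    using 1 by (auto simp: mult.commute)
  from fun_space.span_minimal[OF this sub] f have "(\<lambda>z. g z * f z) \<in> E_space (k + l) N" unfolding E_space_def by blast
  thus ?thesis by (simp add: mult.commute)
qed

lemma E_space_eta_quotient:
  "eta_quotient N r \<in> R_space k N \<Longrightarrow> eta_quotient N r \<in> E_space k N"
  unfolding E_space_def by (auto intro: fun_space.span_base)

lemma subspace_E_space: "fun_space.subspace (E_space k N)"
  unfolding E_space_def by (rule fun_space.subspace_span)

text \<open>
  The constant \<open>1\<close>, extended by \<open>0\<close> as the elements of the spaces are.
\<close>

definition uhp_one :: "complex \<Rightarrow> complex" where
  "uhp_one z = (if z \<in> uhp then 1 else 0)"

lemma uhp_one_in_E_space:
  assumes "N > 0"
  shows "uhp_one \<in> E_space 0 N"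
proof -
  have "eta_quotient N (\<lambda>\<delta>. 2 * 0) \<in> R_space 0 N"
    by (rule eta_quotient_in_R_space[OF assms]) (auto simp: trivial_multiplier_def cusp_sum_def)
  moreover have "eta_quotient N (\<lambda>\<delta>. 2 * 0) = uhp_one" by (auto simp: eta_quotient_def uhp_one_def fun_eq_iff)
  ultimately show ?thesis using E_space_eta_quotient by metis
qed

lemma E_space_power:
  assumes N: "N > 0" and f: "f \<in> E_space 0 N"
  shows "(\<lambda>z. if z \<in> uhp then f z ^ n else 0) \<in> E_space 0 N"
proof (induction n)
  case 0
  show ?case using uhp_one_in_E_space[OF N] by (simp add: uhp_one_def [abs_def] cong: if_cong)
next
  case (Suc n)
  have "(\<lambda>z. f z * (if z \<in> uhp then f z ^ n else 0)) = (\<lambda>z. if z \<in> uhp then f z ^ Suc n else 0)" by (auto simp: fun_eq_iff)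
  thus ?case using E_space_mult[OF N f Suc] by simp
qed

lemma has_order_uhp_power:
  assumes "has_order f n"
  shows "has_order (\<lambda>z. if z \<in> uhp then f z ^ m else 0) (int m * n)"
  by (rule has_order_cong[OF has_order_power[OF assms]]) (use eventually_uhp in \<open>eventually_elim, simp\<close>)

text \<open>
  The pole orders \<open>m\<close> and \<open>m m' - 1\<close> are coprime, so their combinations with nonnegative
  coefficients contain all large integers. The factor \<open>g\<close> supplies the weight.
\<close>

lemma E_space_all_orders:
  assumes N: "N > 0" and u: "u \<in> E_space 0 N" "has_order u (- int m)" and x: "x \<in> E_space 0 N" "has_order x (- int (m * m' - 1))"
    and m: "m > 0" "m' > 0" and g: "g \<in> E_space k N" "has_order g g0"
  shows "\<exists>m0. \<forall>n\<le>m0. \<exists>e\<in>E_space k N. has_order e n"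
proof (intro exI[of _ "g0 - int (m * (m * m'))"] allI impI)
  fix n assume n: "n \<le> g0 - int (m * (m * m'))"
  define t where "t = nat (g0 - n)"
  have ge: "int (m * (m * m')) \<le> g0 - n" using n by linarith
  have "nat (int (m * (m * m'))) \<le> t" unfolding t_def by (rule nat_mono[OF ge])
  hence t1: "t \<ge> m * (m * m')" by (simp only: nat_int)
  have "int t = g0 - n" unfolding t_def using ge by linarith
  hence t: "t \<ge> m * (m * m')" "n = g0 - int t" using t1 by simp_all
  define j where "j = (m - t mod m) mod m"
  have j: "j < m" using m by (simp add: j_def)
  have "m dvd t + j"
  proof (cases "t mod m = 0")
    case True
    thus ?thesis by (simp add: j_def dvd_eq_mod_eq_0)
  next
    case False
    hence "j = m - t mod m" using m by (simp add: j_def)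
    moreover have "t mod m < m" "t mod m \<le> t" using m by simp_all
    ultimately have "t + j = (t - t mod m) + m" by linarith
    moreover have "m dvd (t - t mod m) + m" by (intro dvd_add dvd_minus_mod dvd_refl)
    ultimately show ?thesis by simp
  qed
  then obtain q where q: "t + j = m * q" by blast
  have "j * m' \<le> q"
  proof (rule ccontr)
    assume "\<not> j * m' \<le> q"
    hence "m * q < m * (j * m')" using m by simp
    also have "\<dots> \<le> m * (m * m')" using j by (intro mult_le_mono) auto
    finally show False using t(1) q by linarith
  qed
  define i where "i = q - j * m'"
  have mm: "m * m' \<ge> 1" using m by simp
  have it: "int t = int i * int m + int j * int (m * m' - 1)"
  proof -
    have tq: "int t = int m * int q - int j" using q by (metis add_diff_cancel_right' of_nat_add of_nat_mult)
    have iq: "int i = int q - int j * int m'" using \<open>j * m' \<le> q\<close> by (simp add: i_def of_nat_diff)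
    have mm1: "int (m * m' - 1) = int m * int m' - 1" using mm by (simp add: of_nat_diff)
    show ?thesis unfolding tq iq mm1 by (simp add: algebra_simps)
  qed
  define e where "e = (\<lambda>z. (if z \<in> uhp then u z ^ i else 0) * ((if z \<in> uhp then x z ^ j else 0) * g z))"
  have "e \<in> E_space (0 + (0 + k)) N"
    unfolding e_def by (intro E_space_mult[OF N] E_space_power[OF N] u x g)
  moreover have "has_order e (int i * (- int m) + (int j * (- int (m * m' - 1)) + g0))"
    unfolding e_def by (intro has_order_mult has_order_uhp_power u x g)
  moreover have "int i * (- int m) + (int j * (- int (m * m' - 1)) + g0) = n" using it t(2) by simp
  ultimately show "\<exists>e\<in>E_space k N. has_order e n" by auto
qed

section \<open>Composite levels\<close>

text \<open>
  Halved exponents of \<open>\<eta>(\<delta>0 z)\<^sup>2\<^sup>w\<close> divided by the eta-quotient of \<open>inf_vec N\<close>, where \<open>w\<close> is the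
  weight of the latter. The quotient has weight \<open>0\<close> and zeros at all cusps but \<open>\<infinity>\<close>. The factor
  \<open>12\<close> that makes the multiplier trivial is put in where these exponents are used, and \<open>inf_pole\<close>
  is the pole order after that.
\<close>

definition inf_scale :: "nat \<Rightarrow> nat \<Rightarrow> nat \<Rightarrow> int" where
  "inf_scale N \<delta>0 \<delta> = inf_weight N * (if \<delta> = \<delta>0 then 1 else 0) - inf_vec N \<delta>"

definition inf_pole :: "nat \<Rightarrow> nat \<Rightarrow> nat" where
  "inf_pole N \<delta>0 = nat ((\<Sum>\<delta> | \<delta> dvd N. int \<delta> * inf_vec N \<delta>) - inf_weight N * int \<delta>0)"

lemma cusp_sum_inf_scale:
  assumes N: "N > 0" and \<delta>0: "\<delta>0 dvd N"
  shows "cusp_sum N (inf_scale N \<delta>0) c = of_int (inf_weight N) * (of_int (gcd (int \<delta>0) c) ^ 2 / real \<delta>0) - cusp_sum N (inf_vec N) c"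
proof -
  have "cusp_sum N (\<lambda>\<delta>. if \<delta> = \<delta>0 then 1 else 0) c = (\<Sum>\<delta> | \<delta> dvd N. if \<delta> = \<delta>0 then of_int (gcd (int \<delta>) c) ^ 2 / real \<delta> else 0)"
    unfolding cusp_sum_def by (intro sum.cong refl) auto
  also have "\<dots> = of_int (gcd (int \<delta>0) c) ^ 2 / real \<delta>0" using N \<delta>0 by (subst sum.delta) auto
  finally show ?thesis
    using cusp_sum_linear[of N "inf_weight N" "\<lambda>\<delta>. if \<delta> = \<delta>0 then 1 else 0" "- 1" "inf_vec N" c]
    by (simp add: inf_scale_def [abs_def])
qed

lemma inf_scale_properties:
  assumes N: "N > 1" and \<delta>0: "\<delta>0 dvd N"
  shows "(\<Sum>\<delta> | \<delta> dvd N. 12 * inf_scale N \<delta>0 \<delta>) = 0"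
    and "\<not> int N dvd c \<Longrightarrow> cusp_sum N (\<lambda>\<delta>. 12 * inf_scale N \<delta>0 \<delta>) c > 0"
    and "(\<Sum>\<delta> | \<delta> dvd N. int \<delta> * (2 * (12 * inf_scale N \<delta>0 \<delta>))) = 24 * (- int (inf_pole N \<delta>0))"
    and "inf_pole N \<delta>0 > 0"
    and "eta_quotient N (\<lambda>\<delta>. 2 * (12 * inf_scale N \<delta>0 \<delta>)) \<in> R_space 0 N"
proof -
  have N0: "N > 0" using N by simp
  have lin: "cusp_sum N (\<lambda>\<delta>. 12 * inf_scale N \<delta>0 \<delta>) c = 12 * cusp_sum N (inf_scale N \<delta>0) c" for c
    using cusp_sum_linear[of N 12 "inf_scale N \<delta>0" 0 "\<lambda>_. 0" c] by simp
  have d0: "\<delta>0 > 0" using \<delta>0 N0 by (auto intro: dvd_pos_nat)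
  show sum0: "(\<Sum>\<delta> | \<delta> dvd N. 12 * inf_scale N \<delta>0 \<delta>) = 0"
  proof -
    have "(\<Sum>\<delta> | \<delta> dvd N. inf_scale N \<delta>0 \<delta>) = inf_weight N * (\<Sum>\<delta> | \<delta> dvd N. if \<delta> = \<delta>0 then 1 else 0) - inf_weight N"
      unfolding inf_scale_def sum_subtractf sum_distrib_left[symmetric] inf_weight_def[symmetric] ..
    also have "(\<Sum>\<delta> | \<delta> dvd N. if \<delta> = \<delta>0 then 1 else 0) = (1::int)" using N0 \<delta>0 by (subst sum.delta) auto
    finally show ?thesis by (simp add: sum_distrib_left[symmetric])
  qed
  show pos: "cusp_sum N (\<lambda>\<delta>. 12 * inf_scale N \<delta>0 \<delta>) c > 0" if "\<not> int N dvd c" for c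
    unfolding lin cusp_sum_inf_scale[OF N0 \<delta>0] cusp_sum_inf_vec_other[OF N0 that]
    using inf_weight_pos[OF N0] d0 by simp
  define G where "G = (\<Sum>\<delta> | \<delta> dvd N. int \<delta> * inf_vec N \<delta>)"
  have "real_of_int G > N * of_int (inf_weight N)"
    using cusp_sum_inf_vec_0_gt[OF N] by (simp add: cusp_sum_0 G_def)
  hence "of_int G > real_of_int (int N * inf_weight N)" by simp
  hence G: "G > int N * inf_weight N" by (simp only: of_int_less_iff)
  have "inf_weight N * int \<delta>0 \<le> inf_weight N * int N"
    using dvd_imp_le[OF \<delta>0 N0] inf_weight_pos[OF N0] by (intro mult_left_mono) auto
  hence gt: "G > inf_weight N * int \<delta>0" using G by (simp add: mult.commute)
  thus pole: "inf_pole N \<delta>0 > 0" by (simp add: inf_pole_def G_def[symmetric])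
  have pole_eq: "int (inf_pole N \<delta>0) = G - inf_weight N * int \<delta>0" using gt by (simp add: inf_pole_def G_def[symmetric])
  show "(\<Sum>\<delta> | \<delta> dvd N. int \<delta> * (2 * (12 * inf_scale N \<delta>0 \<delta>))) = 24 * (- int (inf_pole N \<delta>0))"
  proof -
    have "(\<Sum>\<delta> | \<delta> dvd N. int \<delta> * (2 * (12 * inf_scale N \<delta>0 \<delta>))) =
      24 * (\<Sum>\<delta> | \<delta> dvd N. (if \<delta> = \<delta>0 then inf_weight N * int \<delta> else 0) - int \<delta> * inf_vec N \<delta>)"
      unfolding sum_distrib_left by (intro sum.cong refl) (auto simp: inf_scale_def algebra_simps)
    also have "(\<Sum>\<delta> | \<delta> dvd N. (if \<delta> = \<delta>0 then inf_weight N * int \<delta> else 0) - int \<delta> * inf_vec N \<delta>) = inf_weight N * int \<delta>0 - G"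
      unfolding sum_subtractf G_def using N0 \<delta>0 by (subst sum.delta) auto
    finally show ?thesis by (simp add: pole_eq)
  qed
  show "eta_quotient N (\<lambda>\<delta>. 2 * (12 * inf_scale N \<delta>0 \<delta>)) \<in> R_space 0 N"
    by (rule eta_quotient_in_R_space[OF N0 sum0 trivial_multiplier_12]) (use pos in \<open>auto intro: less_imp_le\<close>)
qed

text \<open>
  If \<open>u = q\<^bsup>-m\<^esup> (1 - a q + \<dots>)\<close> and \<open>v = q\<^bsup>-m'\<^esup> (1 - a' q + \<dots>)\<close>, then the coefficient of \<open>q\<^bsup>1 - m
  m'\<^esup>\<close> in \<open>u\<^bsup>m'\<^esup> - v\<^bsup>m\<^esup>\<close> is \<open>m a' - m' a\<close>.
\<close>

lemma eta_quotient_difference_order: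
  assumes N: "N > 0" and r: "(\<Sum>\<delta> | \<delta> dvd N. int \<delta> * r \<delta>) = 24 * (- int m)" "(\<Sum>\<delta> | \<delta> dvd N. int \<delta> * r' \<delta>) = 24 * (- int m')"
    and ne: "int m' * r 1 \<noteq> int m * r' 1" and m: "m > 0" "m' > 0"
  shows "has_order (\<lambda>z. eta_quotient N r z ^ m' - eta_quotient N r' z ^ m) (- int (m * m' - 1))"
proof -
  define \<Phi> where "\<Phi> = (\<lambda>w. euler_quot N r w ^ m' - euler_quot N r' w ^ m)"
  define c where "c = complex_of_int (int m * r' 1 - int m' * r 1)"
  have "(\<Phi> has_field_derivative of_nat m' * (- of_int (r 1) * euler_quot N r 0 ^ (m' - Suc 0)) - of_nat m * (- of_int (r' 1) * euler_quot N r' 0 ^ (m - Suc 0))) (at 0)"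
    unfolding \<Phi>_def by (intro DERIV_diff DERIV_power euler_quot_deriv N)
  hence "(\<Phi> has_field_derivative c) (at 0)" by (simp add: euler_quot_0[OF N] c_def algebra_simps)
  hence "((\<lambda>w. \<Phi> w / w) \<longlongrightarrow> c) (at 0)"
    unfolding has_field_derivative_iff by (simp add: \<Phi>_def euler_quot_0[OF N])
  hence lim: "((\<lambda>z. \<Phi> (nome z) / nome z) \<longlongrightarrow> c) ii_inf"
    using filterlim_compose[OF _ filterlim_nome[of 1 0], of "\<lambda>w. \<Phi> w / w" "nhds c"] by simp
  have ev: "\<Phi> (nome z) / nome z = (eta_quotient N r z ^ m' - eta_quotient N r' z ^ m) * nome z powi (- (- int (m * m' - 1)))" if z: "z \<in> uhp" for z
  proof -
    have e1: "eta_quotient N r z * nome z ^ m = euler_quot N r (nome z)"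
      using eta_quotient_normalized[OF N z r(1)] by simp
    have e2: "eta_quotient N r' z * nome z ^ m' = euler_quot N r' (nome z)"
      using eta_quotient_normalized[OF N z r(2)] by simp
    have "\<Phi> (nome z) = (eta_quotient N r z ^ m' - eta_quotient N r' z ^ m) * nome z ^ (m * m')"
      unfolding \<Phi>_def e1[symmetric] e2[symmetric]
      by (simp add: power_mult_distrib left_diff_distrib power_mult[symmetric] mult.commute[of m' m])
    moreover have "nome z ^ (m * m') = nome z ^ (m * m' - 1) * nome z"
      using m by (metis mult_pos_pos power_minus_mult)
    ultimately show ?thesis by simp
  qed
  have "((\<lambda>z. (eta_quotient N r z ^ m' - eta_quotient N r' z ^ m) * nome z powi (- (- int (m * m' - 1)))) \<longlongrightarrow> c) ii_inf"
    by (rule Lim_transform_eventually[OF lim]) (use eventually_uhp ev in \<open>auto elim: eventually_mono\<close>)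
  moreover have "c \<noteq> 0" using ne unfolding c_def by (simp only: of_int_eq_0_iff)
  ultimately show ?thesis unfolding has_order_def by blast
qed

text \<open>
  The divisors \<open>1\<close>, \<open>p\<close> and \<open>N\<close>, with \<open>p\<close> a divisor strictly between, give functions of weight \<open>0\<close>
  with poles only at \<open>\<infinity>\<close>. The coefficients of \<open>q\<close> in two of them are not in the ratio of the pole
  orders: if \<open>inf_vec\<close> vanishes at \<open>1\<close>, then only \<open>\<delta>0 = 1\<close> gives a nonzero coefficient; otherwise
  \<open>p\<close> and \<open>N\<close> give equal nonzero coefficients and different pole orders.
\<close>

lemma composite_all_orders:
  assumes N: "N > 1" "\<not> prime N" and g: "g \<in> E_space k N" "has_order g g0"
  shows "\<exists>m0. \<forall>n\<le>m0. \<exists>e\<in>E_space k N. has_order e n"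
proof -
  have N0: "N > 0" using N by simp
  define r where "r = (\<lambda>\<delta>0 \<delta>. 2 * (12 * inf_scale N \<delta>0 \<delta>))"
  define G where "G = (\<Sum>\<delta> | \<delta> dvd N. int \<delta> * inf_vec N \<delta>)"
  note P = inf_scale_properties[OF N(1)]
  have pole_eq: "int (inf_pole N \<delta>0) = G - inf_weight N * int \<delta>0" if "\<delta>0 dvd N" for \<delta>0
    using P(4)[OF that] by (simp add: inf_pole_def G_def)
  have W: "inf_weight N > 0" by (rule inf_weight_pos[OF N0])
  obtain p where p: "p dvd N" "p \<noteq> 1" "p \<noteq> N" using N by (auto simp: prime_nat_iff)
  have "\<exists>d d'. d dvd N \<and> d' dvd N \<and> int (inf_pole N d') * r d 1 \<noteq> int (inf_pole N d) * r d' 1"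
  proof (cases "inf_vec N 1 = 0")
    case True
    have "r 1 1 = 24 * inf_weight N" "r N 1 = 0" using True N(1) by (auto simp: r_def inf_scale_def)
    thus ?thesis using W P(4)[of N] by (intro exI[of _ 1] exI[of _ N]) auto
  next
    case False
    have "r p 1 = - 24 * inf_vec N 1" "r N 1 = - 24 * inf_vec N 1" using p N(1) by (auto simp: r_def inf_scale_def)
    moreover have "int (inf_pole N N) \<noteq> int (inf_pole N p)"
      using pole_eq[of N] pole_eq[of p] p W by simp
    ultimately show ?thesis using False p(1) by (intro exI[of _ p] exI[of _ N]) auto
  qed
  then obtain d d' where d: "d dvd N" "d' dvd N" "int (inf_pole N d') * r d 1 \<noteq> int (inf_pole N d) * r d' 1" by blast
  define u v where "u = eta_quotient N (r d)" and "v = eta_quotient N (r d')"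
  define m m' where "m = inf_pole N d" and "m' = inf_pole N d'"
  have m: "m > 0" "m' > 0" using P(4) d by (auto simp: m_def m'_def)
  have u: "u \<in> E_space 0 N" and v: "v \<in> E_space 0 N"
    using P(5) d by (auto simp: u_def v_def r_def intro: E_space_eta_quotient)
  have ou: "has_order u (- int m)" unfolding u_def
    by (rule eta_quotient_has_order[OF N0]) (use P(3)[OF d(1)] in \<open>simp add: r_def m_def\<close>)
  define x where "x = (\<lambda>z. if z \<in> uhp then u z ^ m' else 0) - (\<lambda>z. if z \<in> uhp then v z ^ m else 0)"
  have "x \<in> E_space 0 N" unfolding x_def
    by (intro fun_space.subspace_diff[OF subspace_E_space] E_space_power[OF N0] u v)
  moreover have "has_order x (- int (m * m' - 1))"
  proof (rule has_order_cong)
    show "has_order (\<lambda>z. eta_quotient N (r d) z ^ m' - eta_quotient N (r d') z ^ m) (- int (m * m' - 1))"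
      by (rule eta_quotient_difference_order[OF N0])
         (use P(3) d m in \<open>auto simp: r_def m_def m'_def\<close>)
    show "eventually (\<lambda>z. eta_quotient N (r d) z ^ m' - eta_quotient N (r d') z ^ m = x z) ii_inf"
      using eventually_uhp by eventually_elim (simp add: x_def u_def v_def)
  qed
  ultimately show ?thesis using E_space_all_orders[OF N0 u ou _ _ m g] by blast
qed

section \<open>Prime levels of genus zero\<close>

lemma divisors_prime: "prime p \<Longrightarrow> {\<delta>. \<delta> dvd p} = {1, p::nat}"
  by (auto simp: prime_nat_iff)

lemma sum_divisors_prime:
  fixes g :: "nat \<Rightarrow> 'a :: comm_monoid_add"
  assumes "prime p"
  shows "(\<Sum>\<delta> | \<delta> dvd p. g \<delta>) = g 1 + g p"
  using divisors_prime[OF assms] prime_gt_1_nat[OF assms] by simp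

text \<open>
  Modulo \<open>p - 1\<close>, the number \<open>p\<close> is \<open>1\<close>, and an integer polynomial does not see the replacement of
  \<open>(b, c)\<close> by \<open>(p b, c / p)\<close>.
\<close>

lemma eta_exp_conjugate_cong:
  assumes "int p dvd c" "p > 0"
  shows "[eta_exp a (int p * b) (c div int p) d = eta_exp a b c d] (mod (int p - 1))"
proof -
  obtain c' where c: "c = int p * c'" using assms by blast
  have p1: "[int p = 1] (mod (int p - 1))" by (simp add: cong_iff_dvd_diff)
  have "[int p * b = 1 * b] (mod (int p - 1))" "[int p * c' = 1 * c'] (mod (int p - 1))"
    by (intro cong_mult p1 cong_refl)+
  hence "[int p * b = b] (mod (int p - 1))" "[c' = c] (mod (int p - 1))" by (auto simp: c cong_sym)
  moreover have "c div int p = c'" using assms(2) by (simp add: c)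
  ultimately show ?thesis by (auto intro!: eta_exp_cong)
qed

text \<open>
  These are the primes for which \<open>p - 1\<close> divides \<open>12\<close>, and \<open>(\<eta>(z) / \<eta>(p z))\<^bsup>24 / (p - 1)\<^esup>\<close> has
  weight \<open>0\<close>, trivial multiplier and a simple pole at \<open>\<infinity>\<close>: it is a generator of the function
  field.
\<close>

lemma genus_zero_all_orders:
  assumes p: "p \<in> {2, 3, 5, 7, 13}" and g: "g \<in> E_space k p" "has_order g g0"
  shows "\<exists>m0. \<forall>n\<le>m0. \<exists>e\<in>E_space k p. has_order e n"
proof -
  have pr: "prime p" using p by auto
  have p0: "p > 0" "p > 1" using prime_gt_1_nat[OF pr] by auto
  obtain h :: int where h: "h * (int p - 1) = 12" "h > 0"
  proof -
    have "\<exists>h::int. h * (int p - 1) = 12 \<and> h > 0" using p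
      by (elim insertE emptyE) (auto intro: exI[of _ 12] exI[of _ 6] exI[of _ 3] exI[of _ 2] exI[of _ 1])
    thus ?thesis using that by blast
  qed
  define s where "s = (\<lambda>\<delta>. if \<delta> = 1 then h else if \<delta> = p then - h else 0)"
  have s: "s 1 = h" "s p = - h" using p0 by (auto simp: s_def)
  have "trivial_multiplier p s"
    unfolding trivial_multiplier_def sum_divisors_prime[OF pr] s
  proof (intro allI impI)
    fix a b c d :: int assume "int p dvd c"
    hence "[eta_exp a (int p * b) (c div int p) d = eta_exp a b c d] (mod (int p - 1))"
      by (rule eta_exp_conjugate_cong[OF _ p0(1)])
    hence "int p - 1 dvd eta_exp a b c d - eta_exp a (int p * b) (c div int p) d"
      by (meson cong_iff_dvd_diff cong_sym)
    hence "h * (int p - 1) dvd h * (eta_exp a b c d - eta_exp a (int p * b) (c div int p) d)" by simp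
    thus "12 dvd h * eta_exp a (int 1 * b) (c div int 1) d + - h * eta_exp a (int p * b) (c div int p) d"
      unfolding h by (simp add: right_diff_distrib)
  qed
  moreover have "cusp_sum p s c \<ge> 0" if "\<not> int p dvd c" for c
  proof -
    have "coprime (int p) c" using pr that by (metis prime_imp_coprime prime_nat_int_transfer)
    hence "gcd (int p) c = 1" by simp
    hence "cusp_sum p s c = of_int h * (1 - 1 / real p)"
      unfolding cusp_sum_def sum_divisors_prime[OF pr] s by (simp add: algebra_simps)
    thus ?thesis using h p0 by simp
  qed
  ultimately have "eta_quotient p (\<lambda>\<delta>. 2 * s \<delta>) \<in> R_space 0 p"
    by (intro eta_quotient_in_R_space p0) (auto simp: sum_divisors_prime[OF pr] s s[unfolded One_nat_def])
  hence u: "eta_quotient p (\<lambda>\<delta>. 2 * s \<delta>) \<in> E_space 0 p" by (rule E_space_eta_quotient)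
  have "(\<Sum>\<delta> | \<delta> dvd p. int \<delta> * (2 * s \<delta>)) = 24 * (- 1)"
    unfolding sum_divisors_prime[OF pr] s using h(1) by (simp add: algebra_simps)
  hence ou: "has_order (eta_quotient p (\<lambda>\<delta>. 2 * s \<delta>)) (- 1)" by (rule eta_quotient_has_order[OF p0(1)])
  have "has_order uhp_one (- int (1 * 1 - 1))"
    by (rule has_order_cong[of "\<lambda>_. 1"]) (use eventually_uhp has_order_1 in \<open>auto simp: uhp_one_def elim: eventually_mono\<close>)
  from E_space_all_orders[OF p0(1) u, of 1 uhp_one 1, OF _ uhp_one_in_E_space[OF p0(1)] this _ _ g] ou
  show ?thesis by simp
qed

lemma finite_codimension_of_eta_quotient:
  assumes N: "(N > 1 \<and> \<not> prime N) \<or> N \<in> {2, 3, 5, 7, 13}" and k: "0 \<le> k"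
    and g: "g \<in> E_space k N" "has_order g g0"
  shows "finite_codimension_in (E_space k N) (R_space k N)"
proof -
  have N0: "N > 0" using N by auto
  have "\<exists>m0. \<forall>n\<le>m0. \<exists>e\<in>E_space k N. has_order e n"
    using N composite_all_orders[OF _ _ g] genus_zero_all_orders[OF _ g] by blast
  then obtain m0 where m0: "\<And>n. n \<le> m0 \<Longrightarrow> \<exists>e\<in>E_space k N. has_order e n" by blast
  obtain K where K: "\<And>f n. f \<in> R_space k N \<Longrightarrow> has_order f n \<Longrightarrow> n \<le> K"
    using R_space_order_bound[OF N0, of "nat k"] k by auto
  show ?thesis
    by (rule finite_codimension_of_orders[OF N0 subspace_E_space E_space_subset_R_space K m0])
qed

section \<open>Elliptic points\<close>

lemma mat2_mult: "mat2 a b c d ** mat2 a' b' c' d' = mat2 (a * a' + b * c') (a * b' + b * d') (c * a' + d * c') (c * b' + d * d')"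
  by (simp add: vec_eq_iff forall_2 matrix_matrix_mult_def sum_2)

lemma mat2_eq_iff: "mat2 a b c d = mat2 a' b' c' d' \<longleftrightarrow> a = a' \<and> b = b' \<and> c = c' \<and> d = d'"
  by (auto simp: vec_eq_iff forall_2)

lemma mat_1_mat2: "mat 1 = mat2 1 0 0 1" "- mat2 a b c d = mat2 (- a) (- b) (- c) (- d)"
  by (simp_all add: vec_eq_iff forall_2 mat_def)

lemma moebius_act_mat2: "moebius_act (mat2 a b c d) z = mob a b c d z"
  by (simp add: moebius_act_def)

text \<open>
  An inclusion for all matrices, applied to a matrix and to its inverse.
\<close>

lemma Gamma0_orbit_eqI:
  assumes z: "z \<in> uhp" and det: "a * d - b * c = 1" and c: "int N dvd c"
  shows "Gamma0_orbit N (mob a b c d z) = Gamma0_orbit N z"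
proof -
  have sub: "Gamma0_orbit N (mob a b c d z) \<subseteq> Gamma0_orbit N z"
    if z: "z \<in> uhp" and det: "a * d - b * c = 1" and c: "int N dvd c" for a b c d z
  proof
    fix y assume "y \<in> Gamma0_orbit N (mob a b c d z)"
    then obtain M where M: "M \<in> Gamma0 N" "y = moebius_act M (mob a b c d z)" by (auto simp: Gamma0_orbit_def)
    obtain a' b' c' d' where M': "M = mat2 a' b' c' d'" by (rule mat2_exhaust)
    have G: "a' * d' - b' * c' = 1" "int N dvd c'" using M(1) by (auto simp: M' mat2_Gamma0)
    have "y = mob (a' * a + b' * c) (a' * b + b' * d) (c' * a + d' * c) (c' * b + d' * d) z"
      unfolding M(2) M' moebius_act_mat2 by (rule mob_compose[OF z det])
    moreover have "(a' * a + b' * c) * (c' * b + d' * d) - (a' * b + b' * d) * (c' * a + d' * c) = (a' * d' - b' * c') * (a * d - b * c)"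
      by (simp add: algebra_simps)
    hence "mat2 (a' * a + b' * c) (a' * b + b' * d) (c' * a + d' * c) (c' * b + d' * d) \<in> Gamma0 N"
      using G det c by (simp add: mat2_Gamma0)
    ultimately show "y \<in> Gamma0_orbit N z"
      unfolding Gamma0_orbit_def using moebius_act_mat2 by (metis (no_types, lifting) image_eqI)
  qed
  have e: "d * a + - b * c = 1" "d * b + - b * d = 0" "- c * a + a * c = 0" "- c * b + a * d = 1"
    using det by (simp_all add: algebra_simps)
  have inv: "mob d (- b) (- c) a (mob a b c d z) = z"
    unfolding mob_compose[OF z det] e by simp
  show ?thesis
  proof (rule equalityI[OF sub[OF z det c]])
    have "Gamma0_orbit N (mob d (- b) (- c) a (mob a b c d z)) \<subseteq> Gamma0_orbit N (mob a b c d z)"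
      by (rule sub[OF uhp_moebius(2)[OF z det]]) (use det c in \<open>auto simp: algebra_simps\<close>)
    thus "Gamma0_orbit N z \<subseteq> Gamma0_orbit N (mob a b c d z)" unfolding inv .
  qed
qed

text \<open>
  As \<open>w\<close> is fixed, \<open>\<bar>r w + s\<bar> = 1\<close> and \<open>2 r Re w = p - s\<close>. With \<open>w\<close> in the region given by
  \<open>fundamental_domain\<close>, this bounds \<open>r\<close>, then \<open>p - s\<close> and \<open>p + s\<close>, and with the determinant also
  \<open>q\<close>.
\<close>

lemma elliptic_matrix_bound:
  assumes w: "w \<in> uhp" "Im w \<ge> 1 / 2" "\<bar>Re w\<bar> \<le> 1 / 2" and det: "p * s - q * r = 1" and fixed: "mob p q r s w = w"
    and r: "r \<noteq> 0"
  shows "\<bar>p\<bar> \<le> 5" "\<bar>q\<bar> \<le> 5" "\<bar>r\<bar> \<le> 5" "\<bar>s\<bar> \<le> 5"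
proof -
  define J where "J = of_int r * w + of_int s"
  have J: "J \<noteq> 0" unfolding J_def by (rule uhp_lin_nonzero[OF w(1) det])
  have y: "Im w > 0" using w(1) by (simp add: uhp_def)
  have "Im w = Im w / norm J ^ 2" using uhp_moebius(1)[OF w(1) det] unfolding fixed J_def .
  hence "norm J ^ 2 = 1" using y J by (simp add: field_simps)
  hence nJ: "norm J = 1" by (simp add: power2_eq_1_iff) (smt (verit) norm_ge_zero)
  have "\<bar>of_int r * Im w\<bar> \<le> 1" using abs_Im_le_cmod[of J] nJ by (simp add: J_def)
  hence "\<bar>real_of_int r\<bar> * Im w \<le> 1" using y by (simp add: abs_mult)
  hence "\<bar>real_of_int r\<bar> * (1 / 2) \<le> 1" using w(2) by (meson abs_ge_zero mult_left_mono order_trans)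
  hence r2: "\<bar>r\<bar> \<le> 2" by linarith
  have "of_int p * w + of_int q = w * J" using fixed J unfolding J_def[symmetric] by (simp add: field_simps)
  hence "Im (of_int p * w + of_int q) = Im (w * J)" by simp
  hence "of_int p * Im w = (2 * of_int r * Re w + of_int s) * Im w" by (simp add: J_def algebra_simps)
  hence ps: "real_of_int p - of_int s = 2 * of_int r * Re w" using y by simp
  have "\<bar>real_of_int p - of_int s\<bar> \<le> \<bar>real_of_int r\<bar>"
  proof -
    have "\<bar>2 * of_int r * Re w\<bar> = \<bar>real_of_int r\<bar> * (2 * \<bar>Re w\<bar>)" by (simp add: abs_mult)
    also have "\<dots> \<le> \<bar>real_of_int r\<bar> * 1" using w(3) by (intro mult_left_mono) auto
    finally show ?thesis by (simp add: ps)
  qed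
  hence 1: "\<bar>p - s\<bar> \<le> 2" using r2 by linarith
  have "\<bar>of_int r * Re w + of_int s\<bar> \<le> 1" using abs_Re_le_cmod[of J] nJ by (simp add: J_def)
  hence 2: "\<bar>p + s\<bar> \<le> 2" using ps by linarith
  have p: "\<bar>p\<bar> \<le> 2" and s: "\<bar>s\<bar> \<le> 2" using 1 2 by linarith+
  have "\<bar>q\<bar> * 1 \<le> \<bar>q\<bar> * \<bar>r\<bar>" using r by (intro mult_left_mono) auto
  also have "\<dots> = \<bar>p * s - 1\<bar>" using det by (metis abs_mult add_diff_cancel_left' diff_add_cancel diff_diff_eq2)
  also have "\<dots> \<le> \<bar>p\<bar> * \<bar>s\<bar> + 1" by (metis abs_mult abs_one abs_triangle_ineq4)
  also have "\<bar>p\<bar> * \<bar>s\<bar> \<le> 2 * 2" using p s by (intro mult_mono) auto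
  finally show "\<bar>q\<bar> \<le> 5" by simp
  show "\<bar>p\<bar> \<le> 5" "\<bar>r\<bar> \<le> 5" "\<bar>s\<bar> \<le> 5" using p s r2 by auto
qed

text \<open>
  Two fixed points are roots of one real quadratic equation, so their sum would be real.
\<close>

lemma elliptic_fixed_point_unique:
  assumes "w \<in> uhp" "w' \<in> uhp" "p * s - q * r = 1" "mob p q r s w = w" "mob p q r s w' = w'" and r: "r \<noteq> 0"
  shows "w = w'"
proof (rule ccontr)
  assume ne: "w \<noteq> w'"
  have q: "of_int p * w + of_int q = w * (of_int r * w + of_int s)" if "w \<in> uhp" "mob p q r s w = w" for w
    using uhp_lin_nonzero[OF that(1) assms(3)] that(2) by (simp add: divide_eq_eq)
  have "(w - w') * (of_int r * (w + w') + of_int (s - p)) =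
      (w * (of_int r * w + of_int s) - (of_int p * w + of_int q)) - (w' * (of_int r * w' + of_int s) - (of_int p * w' + of_int q))"
    by (simp add: algebra_simps)
  also have "\<dots> = 0" unfolding q[OF assms(1,4)] q[OF assms(2,5)] by simp
  finally have "of_int r * (w + w') + of_int (s - p) = 0" using ne by simp
  hence "Im (of_int r * (w + w') + of_int (s - p)) = 0" by simp
  hence "Im w + Im w' = 0" using r by simp
  thus False using assms(1,2) by (simp add: uhp_def)
qed

text \<open>
  Finiteness matters because \<open>card\<close> is \<open>0\<close> on infinite sets: without it a vanishing
  \<open>elliptic_number\<close> would say nothing about elliptic points. An elliptic point is moved into the
  fundamental domain by a matrix \<open>A\<close>. The conjugate of the stabilising matrix then has bounded
  entries and determines the moved point, and the bottom row of the inverse of \<open>A\<close> modulo \<open>N\<close>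
  determines the orbit.
\<close>

lemma finite_elliptic_orbits:
  assumes N: "N > 0"
  shows "finite (Gamma0_orbit N ` elliptic_points n N)"
proof -
  define X :: "(int \<times> int \<times> int \<times> int \<times> int \<times> int) set" where
    "X = {- 5..5} \<times> {- 5..5} \<times> {- 5..5} \<times> {- 5..5} \<times> {0..<int N} \<times> {0..<int N}"
  define R where "R = (\<lambda>(p, q, r, s, x, y) Y. \<exists>w a b c d. w \<in> uhp \<and> p * s - q * r = 1 \<and> r \<noteq> 0 \<and> mob p q r s w = w \<and>
     a * d - b * c = 1 \<and> c mod int N = x \<and> d mod int N = y \<and> Y = Gamma0_orbit N (mob a b c d w))"
  show ?thesis
  proof (rule finite_via_relation[of X _ R])
    show "finite X" by (simp add: X_def)
  next
    fix Y assume "Y \<in> Gamma0_orbit N ` elliptic_points n N"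
    then obtain z M where z: "z \<in> uhp" "Y = Gamma0_orbit N z" and M: "M \<in> Gamma0 N" "M \<noteq> mat 1" "M \<noteq> - mat 1" "moebius_act M z = z"
      by (auto simp: elliptic_points_def)
    obtain p q r s where M_eq: "M = mat2 p q r s" by (rule mat2_exhaust)
    have det: "p * s - q * r = 1" using M(1) by (simp add: M_eq mat2_Gamma0)
    have fixed: "mob p q r s z = z" using M(4) by (simp add: M_eq moebius_act_mat2)
    obtain a b c d where A: "a * d - b * c = 1" "Im (mob a b c d z) \<ge> 1 / 2" "\<bar>Re (mob a b c d z)\<bar> \<le> 1 / 2"
      by (rule fundamental_domain[OF z(1)])
    define w where "w = mob a b c d z"
    have w: "w \<in> uhp" unfolding w_def by (rule uhp_moebius(2)[OF z(1) A(1)])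
    have A': "d * a - (- b) * (- c) = 1" using A(1) by (simp add: algebra_simps)
    have zw: "mob d (- b) (- c) a w = z"
    proof -
      have e: "d * a + - b * c = 1" "d * b + - b * d = 0" "- c * a + a * c = 0" "- c * b + a * d = 1"
        using A(1) by (simp_all add: algebra_simps)
      show ?thesis unfolding w_def mob_compose[OF z(1) A(1)] e by simp
    qed
    define P where "P = mat2 a b c d ** (mat2 p q r s ** mat2 d (- b) (- c) a)"
    obtain p' q' r' s' where P: "P = mat2 p' q' r' s'" by (rule mat2_exhaust)
    have inv: "mat2 d (- b) (- c) a ** mat2 a b c d = mat 1" "mat2 a b c d ** mat2 d (- b) (- c) a = mat 1"
      using A(1) by (auto simp: mat2_mult mat_1_mat2 mat2_eq_iff algebra_simps)
    have MP: "M = mat2 d (- b) (- c) a ** (P ** mat2 a b c d)"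
    proof -
      have "mat2 d (- b) (- c) a ** (P ** mat2 a b c d) =
        (mat2 d (- b) (- c) a ** mat2 a b c d) ** (mat2 p q r s ** (mat2 d (- b) (- c) a ** mat2 a b c d))"
        unfolding P_def by (simp only: matrix_mul_assoc)
      thus ?thesis by (simp add: inv M_eq)
    qed
    have "det P = 1"
      unfolding P_def det_mul using A(1) det by (simp add: det_2 algebra_simps)
    hence detP: "p' * s' - q' * r' = 1" by (simp add: P det_2)
    have fixedP: "mob p' q' r' s' w = w"
    proof -
      let ?p = "p * d + q * - c" and ?q = "p * - b + q * a" and ?r = "r * d + s * - c" and ?s = "r * - b + s * a"
      have eqs: "p' = a * ?p + b * ?r" "q' = a * ?q + b * ?s" "r' = c * ?p + d * ?r" "s' = c * ?q + d * ?s"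
        using P unfolding P_def mat2_mult mat2_eq_iff by auto
      have "?p * ?s - ?q * ?r = (p * s - q * r) * (a * d - b * c)" by (simp add: algebra_simps)
      hence d1: "?p * ?s - ?q * ?r = 1" using det A(1) by simp
      have h1: "mob p' q' r' s' w = mob a b c d (mob ?p ?q ?r ?s w)"
        unfolding eqs by (rule mob_compose[OF w d1, symmetric])
      have h2: "mob ?p ?q ?r ?s w = mob p q r s (mob d (- b) (- c) a w)" by (rule mob_compose[OF w A', symmetric])
      show ?thesis unfolding h1 h2 zw fixed by (rule w_def[symmetric])
    qed
    have r': "r' \<noteq> 0"
    proof
      assume r0: "r' = 0"
      hence ps: "p' * s' = 1" using detP by simp
      hence "p' = 1 \<and> s' = 1 \<or> p' = - 1 \<and> s' = - 1" by (metis pos_zmult_eq_1_iff_lemma zmult_eq_1_iff)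
      moreover from this have "q' = 0" using fixedP r0 by auto
      ultimately have "P = mat 1 \<or> P = - mat 1" using r0 by (auto simp: P mat_1_mat2 mat2_eq_iff)
      hence "M = mat 1 \<or> M = - mat 1"
      proof
        assume "P = mat 1" thus ?thesis using MP inv by simp
      next
        assume "P = - mat 1"
        hence "M = mat2 d (- b) (- c) a ** mat2 (- a) (- b) (- c) (- d)" using MP by (simp add: mat_1_mat2 mat2_mult)
        hence "M = - mat 1" using A(1) by (simp add: mat2_mult mat_1_mat2 mat2_eq_iff algebra_simps)
        thus ?thesis ..
      qed
      thus False using M(2,3) by blast
    qed
    have bounds: "\<bar>p'\<bar> \<le> 5" "\<bar>q'\<bar> \<le> 5" "\<bar>r'\<bar> \<le> 5" "\<bar>s'\<bar> \<le> 5"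
      using elliptic_matrix_bound[OF w _ _ detP fixedP r'] A(2,3) unfolding w_def by blast+
    show "\<exists>x\<in>X. R x Y"
    proof (rule bexI[of _ "(p', q', r', s', (- c) mod int N, a mod int N)"])
      show "(p', q', r', s', (- c) mod int N, a mod int N) \<in> X" using bounds N by (auto simp: X_def)
      show "R (p', q', r', s', (- c) mod int N, a mod int N) Y"
        unfolding R_def split using w detP r' fixedP A' zw z(2) by blast
    qed
  next
    fix x Y Y' assume "R x Y" "R x Y'"
    obtain p q r s u v where x: "x = (p, q, r, s, u, v)" by (cases x)
    obtain w a b c d where 1: "w \<in> uhp" "p * s - q * r = 1" "r \<noteq> 0" "mob p q r s w = w"
       "a * d - b * c = 1" "c mod int N = u" "d mod int N = v" "Y = Gamma0_orbit N (mob a b c d w)"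
      using \<open>R x Y\<close> unfolding R_def x split by blast
    obtain w' a' b' c' d' where 2: "w' \<in> uhp" "mob p q r s w' = w'"
       "a' * d' - b' * c' = 1" "c' mod int N = u" "d' mod int N = v" "Y' = Gamma0_orbit N (mob a' b' c' d' w')"
      using \<open>R x Y'\<close> unfolding R_def x split by blast
    have ww: "w' = w" by (rule elliptic_fixed_point_unique[OF 2(1) 1(1) 1(2) 2(2) 1(4) 1(3)])
    have "[c' * d - d' * c = c * d - d * c] (mod int N)"
      using 1(6,7) 2(4,5) by (intro cong_diff cong_mult) (auto simp: cong_def)
    hence dv: "int N dvd c' * d - d' * c" by (simp add: cong_0_iff mult.commute)
    have "(a' * d - b' * c) * (d' * a - c' * b) - (b' * a - a' * b) * (c' * d - d' * c) = (a' * d' - b' * c') * (a * d - b * c)"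
      by (simp add: algebra_simps)
    hence dg: "(a' * d - b' * c) * (d' * a - c' * b) - (b' * a - a' * b) * (c' * d - d' * c) = 1" using 1(5) 2(3) by simp
    have e: "(a' * d - b' * c) * a + (b' * a - a' * b) * c = a' * (a * d - b * c)" "(a' * d - b' * c) * b + (b' * a - a' * b) * d = b' * (a * d - b * c)"
      "(c' * d - d' * c) * a + (d' * a - c' * b) * c = c' * (a * d - b * c)" "(c' * d - d' * c) * b + (d' * a - c' * b) * d = d' * (a * d - b * c)"
      by (simp_all add: algebra_simps)
    have "mob (a' * d - b' * c) (b' * a - a' * b) (c' * d - d' * c) (d' * a - c' * b) (mob a b c d w) = mob a' b' c' d' w"
      unfolding mob_compose[OF 1(1,5)] e 1(5) by simp
    thus "Y = Y'" unfolding 1(8) 2(6) ww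
      using Gamma0_orbit_eqI[OF uhp_moebius(2)[OF 1(1,5)] dg dv] by simp
  qed
qed

lemma elliptic_number_pos:
  assumes "N > 0" "z \<in> elliptic_points n N"
  shows "elliptic_number n N \<noteq> 0"
  unfolding elliptic_number_def using finite_elliptic_orbits[OF assms(1)] assms(2) by (auto simp: card_eq_0_iff)

text \<open>
  With \<open>x\<^sup>2 + 1 = N y\<close>, the matrix with rows \<open>(x, -y)\<close> and \<open>(N, -x)\<close> has trace \<open>0\<close> and fixes \<open>(x +
  \<i>) / N\<close>.
\<close>

lemma elliptic_point_order_2:
  assumes N: "N > 0" and x: "int N dvd x\<^sup>2 + 1"
  shows "epsilon2 N \<noteq> 0"
proof -
  obtain y where y: "x\<^sup>2 + 1 = int N * y" using x by blast
  define M where "M = mat2 x (- y) (int N) (- x)"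
  have det: "x * (- x) - (- y) * int N = 1" using y by (simp add: power2_eq_square algebra_simps)
  define z where "z = (of_int x + \<i>) / of_nat N"
  have z: "z \<in> uhp" using N by (simp add: z_def uhp_def Im_divide_of_nat)
  have Nz: "of_nat N * z = of_int x + \<i>" using N by (simp add: z_def)
  have "of_nat N * (of_int x * z + of_int (- y)) = of_int x * (of_nat N * z) - of_int (int N * y)" by (simp add: algebra_simps)
  also have "\<dots> = \<i> * (of_nat N * z)" unfolding Nz y[symmetric] by (simp add: power2_eq_square algebra_simps)
  also have "\<dots> = of_nat N * (\<i> * z)" by simp
  finally have num: "of_int x * z + of_int (- y) = \<i> * z" using N by simp
  have den: "of_int (int N) * z + of_int (- x) = \<i>" using Nz by simp
  have "moebius_act M z = z" unfolding M_def moebius_act_mat2 num den by simp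
  moreover have "M \<in> Gamma0 N" using det by (simp add: M_def mat2_Gamma0)
  moreover have ne: "M \<noteq> mat 1" "M \<noteq> - mat 1" using N by (auto simp: M_def mat_1_mat2 mat2_eq_iff)
  moreover have "M ** M = - mat 1" using det by (simp add: M_def mat2_mult mat_1_mat2 mat2_eq_iff algebra_simps)
  hence "has_PSL2_order M 2"
    unfolding has_PSL2_order_def using ne by (auto simp: numeral_2_eq_2 less_Suc_eq)
  ultimately have "z \<in> elliptic_points 2 N" using z by (auto simp: elliptic_points_def)
  thus ?thesis by (rule elliptic_number_pos[OF N])
qed

text \<open>
  With \<open>x\<^sup>2 + x + 1 = N y\<close>, the matrix with rows \<open>(x, -y)\<close> and \<open>(N, -x - 1)\<close> has trace \<open>-1\<close> and
  fixes \<open>(x + \<rho>) / N\<close>, where \<open>\<rho>\<close> is a primitive sixth root of unity.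
\<close>

lemma elliptic_point_order_3:
  assumes N: "N > 0" and x: "int N dvd x\<^sup>2 + x + 1"
  shows "epsilon3 N \<noteq> 0"
proof -
  obtain y where y: "x\<^sup>2 + x + 1 = int N * y" using x by blast
  define M where "M = mat2 x (- y) (int N) (- x - 1)"
  have det: "x * (- x - 1) - (- y) * int N = 1" using y by (simp add: power2_eq_square algebra_simps)
  \<comment> \<open>The sixth root of unity \<open>exp (\<pi> \<i> / 3)\<close>, which satisfies \<open>\<rho>\<^sup>2 = \<rho> - 1\<close>.\<close>
  define \<rho> where "\<rho> = Complex (1 / 2) (sqrt 3 / 2)"
  have \<rho>: "\<rho> * \<rho> = \<rho> - 1" by (simp add: \<rho>_def complex_eq_iff)
  have \<rho>1: "\<rho> - 1 \<noteq> 0" by (simp add: \<rho>_def complex_eq_iff)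
  define z where "z = (of_int x + \<rho>) / of_nat N"
  have z: "z \<in> uhp" using N by (simp add: z_def uhp_def Im_divide_of_nat \<rho>_def)
  have Nz: "of_nat N * z = of_int x + \<rho>" using N by (simp add: z_def)
  have "of_nat N * (of_int x * z + of_int (- y)) = of_int x * (of_nat N * z) - of_int (int N * y)" by (simp add: algebra_simps)
  also have "\<dots> = (\<rho> - 1) * (of_int x + \<rho>)" unfolding Nz y[symmetric] by (simp add: power2_eq_square algebra_simps \<rho>)
  also have "\<dots> = of_nat N * ((\<rho> - 1) * z)" unfolding Nz[symmetric] by (simp add: mult_ac)
  finally have num: "of_int x * z + of_int (- y) = (\<rho> - 1) * z" using N by simp
  have den: "of_int (int N) * z + of_int (- x - 1) = \<rho> - 1" using Nz by simp
  have "moebius_act M z = z" unfolding M_def moebius_act_mat2 num den using \<rho>1 by simp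
  moreover have "M \<in> Gamma0 N" using det by (simp add: M_def mat2_Gamma0)
  moreover have ne: "M \<noteq> mat 1" "M \<noteq> - mat 1" using N by (auto simp: M_def mat_1_mat2 mat2_eq_iff)
  moreover have M2: "M ** M = mat2 (- x - 1) y (- int N) x"
    using det by (simp add: M_def mat2_mult mat2_eq_iff algebra_simps)
  moreover have "M ** (M ** M) = mat 1"
    unfolding M2 using det by (simp add: M_def mat2_mult mat_1_mat2 mat2_eq_iff algebra_simps)
  moreover have "M ** M \<noteq> mat 1" "M ** M \<noteq> - mat 1" using N unfolding M2 by (auto simp: mat_1_mat2 mat2_eq_iff)
  ultimately have "has_PSL2_order M 3" and "z \<in> elliptic_points 3 N"
    using z unfolding has_PSL2_order_def elliptic_points_def by (auto simp: numeral_3_eq_3 less_Suc_eq)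
  thus ?thesis using elliptic_number_pos[OF N] by blast
qed

section \<open>Roots of unity of order three and four in residue rings\<close>

lemma element_of_order:
  fixes p n :: nat
  assumes p: "prime p" and n: "n > 1" "n dvd p - 1"
  obtains x :: nat where "[x ^ n = 1] (mod p)" "\<And>m. 0 < m \<Longrightarrow> m < n \<Longrightarrow> \<not> [x ^ m = 1] (mod p)"
proof -
  have "card {k \<in> totatives p. ord p k = n} = totient n"
    using prime_card_elements_with_ord_eq_totient[OF prime_gt_1_nat[OF p] p, of n] n(2) by simp
  moreover have "totient n > 0" using n(1) by simp
  ultimately have "{k \<in> totatives p. ord p k = n} \<noteq> {}" by (metis card.empty less_numeral_extra(3))
  then obtain x where x: "ord p x = n" by blast
  show ?thesis
  proof
    show "[x ^ n = 1] (mod p)" unfolding ord_divides x by simp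
    fix m assume m: "0 < m" "m < n"
    show "\<not> [x ^ m = 1] (mod p)" unfolding ord_divides x using m by (auto dest: dvd_imp_le)
  qed
qed

text \<open>
  A simple root is lifted by one Newton step at a time.
\<close>

lemma quadratic_Hensel:
  fixes b x0 :: int
  assumes p: "prime p" and x0: "p dvd x0\<^sup>2 + b * x0 + 1" "\<not> p dvd 2 * x0 + b"
  shows "\<exists>x. p ^ Suc a dvd x\<^sup>2 + b * x + 1 \<and> \<not> p dvd 2 * x + b"
proof (induction a)
  case 0
  show ?case using x0 by (intro exI[of _ x0]) auto
next
  case (Suc a)
  then obtain x where x: "p ^ Suc a dvd x\<^sup>2 + b * x + 1" "\<not> p dvd 2 * x + b" by blast
  obtain u where u: "x\<^sup>2 + b * x + 1 = p ^ Suc a * u" using x(1) by blast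
  have "coprime (2 * x + b) p" using p x(2) by (simp add: coprime_commute prime_imp_coprime)
  then obtain t where "[(2 * x + b) * t = - u] (mod p)" using cong_solve_coprime_int by (metis cong_scalar_right mult.assoc mult_1 mult.commute)
  hence t: "p dvd u + (2 * x + b) * t" by (simp add: cong_iff_dvd_diff add.commute)
  define x' where "x' = x + t * p ^ Suc a"
  have "x'\<^sup>2 + b * x' + 1 = p ^ Suc a * (u + (2 * x + b) * t) + p ^ Suc (Suc a) * (t * t * p ^ a)"
    using u by (simp add: x'_def power2_eq_square algebra_simps)
  moreover have "p ^ Suc (Suc a) dvd p ^ Suc a * (u + (2 * x + b) * t)"
    using mult_dvd_mono[OF dvd_refl t, of "p ^ Suc a"] by (simp add: mult.commute)
  ultimately have 1: "p ^ Suc (Suc a) dvd x'\<^sup>2 + b * x' + 1" by simp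
  have e: "2 * x' + b = (2 * x + b) + p * (2 * t * p ^ a)" by (simp add: x'_def algebra_simps)
  have "\<not> p dvd 2 * x' + b" unfolding e dvd_add_left_iff[OF dvd_triv_left] by (rule x(2))
  with 1 show ?case by blast
qed

lemma quadratic_root_CRT:
  fixes b :: int
  assumes "N > 0" "\<And>p a. prime p \<Longrightarrow> a > 0 \<Longrightarrow> p ^ a dvd N \<Longrightarrow> \<exists>x. int (p ^ a) dvd x\<^sup>2 + b * x + 1"
  shows "\<exists>x. int N dvd x\<^sup>2 + b * x + 1"
  using assms
proof (induction N rule: less_induct)
  case (less N)
  show ?case
  proof (cases "N = 1")
    case False
    then obtain p where p: "prime p" "p dvd N" using prime_factor_nat by blast
    define a where "a = multiplicity p N"
    obtain m where m: "N = p ^ a * m" "\<not> p dvd m"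
      using multiplicity_decompose'[of N p] less.prems(1) p(1) unfolding a_def by (metis not_prime_unit neq0_conv)
    have a: "a > 0" using p m by (cases a) auto
    have m0: "m > 0" using m less.prems(1) by (auto intro!: Nat.gr0I)
    have "p ^ a > 1" using one_less_power[OF prime_gt_1_nat[OF p(1)] a] .
    hence "m < N" using m m0 by simp
    obtain x1 where x1: "int (p ^ a) dvd x1\<^sup>2 + b * x1 + 1" using less.prems(2)[OF p(1) a] m by auto
    obtain x2 where x2: "int m dvd x2\<^sup>2 + b * x2 + 1"
      using less.IH[OF \<open>m < N\<close> m0 less.prems(2)] unfolding m(1) by (auto intro: dvd_mult)
    have "coprime (p ^ a) m" using prime_imp_coprime[OF p(1) m(2)] by simp
    hence co: "coprime (int (p ^ a)) (int m)" by (simp only: coprime_int_iff)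
    obtain x where x: "[x = x1] (mod int (p ^ a))" "[x = x2] (mod int m)"
      using binary_chinese_remainder_int[OF co] by blast
    have "[x\<^sup>2 + b * x + 1 = x1\<^sup>2 + b * x1 + 1] (mod int (p ^ a))" by (intro cong_add cong_mult cong_pow cong_refl x)
    hence 1: "int (p ^ a) dvd x\<^sup>2 + b * x + 1" using x1 cong_dvd_iff by blast
    have "[x\<^sup>2 + b * x + 1 = x2\<^sup>2 + b * x2 + 1] (mod int m)" by (intro cong_add cong_mult cong_pow cong_refl x)
    hence 2: "int m dvd x\<^sup>2 + b * x + 1" using x2 cong_dvd_iff by blast
    have "int N dvd x\<^sup>2 + b * x + 1" using divides_mult[OF 1 2 co] by (simp add: m(1))
    thus ?thesis by blast
  qed simp
qed

text \<open>
  Otherwise \<open>x\<^sup>2 = -1\<close> is solvable modulo every prime power dividing \<open>N\<close>, hence modulo \<open>N\<close>, and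
  there is an elliptic point of order \<open>2\<close>. An element of order \<open>4\<close> modulo \<open>p\<close> solves the equation
  modulo \<open>p\<close>.
\<close>

lemma epsilon2_zero_imp:
  assumes N: "N > 0" and e: "epsilon2 N = 0"
  shows "4 dvd N \<or> (\<exists>p. prime p \<and> p dvd N \<and> p mod 4 = 3)"
proof (rule ccontr)
  assume neg: "\<not> ?thesis"
  have "\<exists>x. int N dvd x\<^sup>2 + 0 * x + 1"
  proof (rule quadratic_root_CRT[OF N])
    fix p a :: nat assume p: "prime p" "a > 0" "p ^ a dvd N"
    have pN: "p dvd N" using p by (meson dvd_power dvd_trans)
    show "\<exists>x. int (p ^ a) dvd x\<^sup>2 + 0 * x + 1"
    proof (cases "p = 2")
      case True
      have "a = 1"
      proof (rule ccontr)
        assume "a \<noteq> 1"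
        hence "p ^ 2 dvd p ^ a" using p(2) by (intro le_imp_power_dvd) simp
        hence "4 dvd N" using p(3) True dvd_trans by force
        thus False using neg by blast
      qed
      thus ?thesis using True by (intro exI[of _ 1]) simp
    next
      case False
      hence "odd p" using p(1) primes_dvd_imp_eq two_is_prime_nat by blast
      moreover have "p mod 4 \<noteq> 3" using neg p(1) pN by blast
      ultimately have "p mod 4 = 1" by presburger
      hence "4 dvd p - 1" using prime_gt_1_nat[OF p(1)] by presburger
      then obtain x :: nat where x: "[x ^ 4 = 1] (mod p)" "\<And>m. 0 < m \<Longrightarrow> m < 4 \<Longrightarrow> \<not> [x ^ m = 1] (mod p)"
        using element_of_order[OF p(1), of 4] by auto
      have pi: "prime (int p)" using p(1) by simp
      have "[int x ^ 4 = 1] (mod int p)" using x(1) by (metis cong_int_iff of_nat_1 of_nat_power)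
      hence "int p dvd int x ^ 4 - 1" by (simp add: cong_iff_dvd_diff)
      also have "int x ^ 4 - 1 = (int x ^ 2 - 1) * (int x ^ 2 + 1)" by (simp add: algebra_simps flip: power_add)
      finally have "int p dvd int x ^ 2 - 1 \<or> int p dvd int x ^ 2 + 1" using pi prime_dvd_mult_iff by blast
      moreover have "\<not> int p dvd int x ^ 2 - 1"
      proof
        assume "int p dvd int x ^ 2 - 1"
        hence "[int (x ^ 2) = int 1] (mod int p)" by (simp add: cong_iff_dvd_diff)
        thus False using x(2)[of 2] by (simp only: cong_int_iff)
      qed
      ultimately have d: "int p dvd int x ^ 2 + 1" by blast
      have "\<not> int p dvd 2 * int x"
      proof
        assume "int p dvd 2 * int x"
        hence "int p dvd 2 \<or> int p dvd int x" using pi prime_dvd_mult_iff by blast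
        thus False
        proof
          assume "int p dvd 2"
          hence "p dvd 2" by (metis int_dvd_int_iff of_nat_numeral)
          thus False using False p(1) primes_dvd_imp_eq two_is_prime_nat by blast
        next
          assume "int p dvd int x"
          hence "int p dvd int x ^ 2" by (simp add: power2_eq_square)
          hence "int p dvd 1" using d by (simp add: dvd_add_right_iff)
          thus False using pi not_prime_unit by blast
        qed
      qed
      then obtain y where "int p ^ Suc (a - 1) dvd y\<^sup>2 + 0 * y + 1"
        using quadratic_Hensel[OF pi, of "int x" 0 "a - 1"] d by auto
      thus ?thesis using p(2) by auto
    qed
  qed
  then obtain x where "int N dvd x\<^sup>2 + 1" by auto
  thus False using elliptic_point_order_2[OF N] e by blast
qed

text \<open>
  The same for \<open>x\<^sup>2 + x + 1 = 0\<close> and elements of order \<open>3\<close> modulo \<open>p\<close>.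
\<close>

lemma epsilon3_zero_imp:
  assumes N: "N > 0" and e: "epsilon3 N = 0"
  shows "9 dvd N \<or> (\<exists>p. prime p \<and> p dvd N \<and> p mod 3 = 2)"
proof (rule ccontr)
  assume neg: "\<not> ?thesis"
  have "\<exists>x. int N dvd x\<^sup>2 + 1 * x + 1"
  proof (rule quadratic_root_CRT[OF N])
    fix p a :: nat assume p: "prime p" "a > 0" "p ^ a dvd N"
    have pN: "p dvd N" using p by (meson dvd_power dvd_trans)
    show "\<exists>x. int (p ^ a) dvd x\<^sup>2 + 1 * x + 1"
    proof (cases "p = 3")
      case True
      have "a = 1"
      proof (rule ccontr)
        assume "a \<noteq> 1"
        hence "p ^ 2 dvd p ^ a" using p(2) by (intro le_imp_power_dvd) simp
        hence "9 dvd N" using p(3) True dvd_trans by force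
        thus False using neg by blast
      qed
      thus ?thesis using True by (intro exI[of _ 1]) simp
    next
      case False
      hence "\<not> 3 dvd p" using p(1) by (auto simp: prime_nat_iff)
      moreover have "p mod 3 \<noteq> 2" using neg p(1) pN by blast
      ultimately have "p mod 3 = 1" by presburger
      hence "3 dvd p - 1" using prime_gt_1_nat[OF p(1)] by presburger
      then obtain x :: nat where x: "[x ^ 3 = 1] (mod p)" "\<And>m. 0 < m \<Longrightarrow> m < 3 \<Longrightarrow> \<not> [x ^ m = 1] (mod p)"
        using element_of_order[OF p(1), of 3] by auto
      have pi: "prime (int p)" using p(1) by simp
      have "[int x ^ 3 = 1] (mod int p)" using x(1) by (metis cong_int_iff of_nat_1 of_nat_power)
      hence "int p dvd int x ^ 3 - 1" by (simp add: cong_iff_dvd_diff)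
      also have "int x ^ 3 - 1 = (int x - 1) * (int x ^ 2 + 1 * int x + 1)" by (simp add: algebra_simps power3_eq_cube power2_eq_square)
      finally have "int p dvd int x - 1 \<or> int p dvd int x ^ 2 + 1 * int x + 1" using pi prime_dvd_mult_iff by blast
      moreover have "\<not> int p dvd int x - 1"
      proof
        assume "int p dvd int x - 1"
        hence "[int (x ^ 1) = int 1] (mod int p)" by (simp add: cong_iff_dvd_diff)
        thus False using x(2)[of 1] by (simp only: cong_int_iff)
      qed
      ultimately have d: "int p dvd int x ^ 2 + 1 * int x + 1" by blast
      have "\<not> int p dvd 2 * int x + 1"
      proof
        assume "int p dvd 2 * int x + 1"
        hence "int p dvd 4 * (int x ^ 2 + 1 * int x + 1) - (2 * int x + 1) * (2 * int x + 1)"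
          using d by (intro dvd_diff dvd_mult)
        also have "4 * (int x ^ 2 + 1 * int x + 1) - (2 * int x + 1) * (2 * int x + 1) = 3"
          by (simp add: algebra_simps power2_eq_square)
        finally have "p dvd 3" by (metis int_dvd_int_iff of_nat_numeral)
        moreover from this have "p \<le> 3" by (auto dest: dvd_imp_le)
        hence "p = 2" using False prime_gt_1_nat[OF p(1)] by linarith
        ultimately show False by simp
      qed
      then obtain y where "int p ^ Suc (a - 1) dvd y\<^sup>2 + 1 * y + 1"
        using quadratic_Hensel[OF pi d, of "a - 1"] by auto
      thus ?thesis using p(2) by auto
    qed
  qed
  then obtain x where "int N dvd x\<^sup>2 + x + 1" by auto
  thus False using elliptic_point_order_3[OF N] e by blast
qed

section \<open>Eta-quotients of prescribed weight\<close>

lemma trivial_multiplier_combine: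
  assumes "trivial_multiplier N s" "trivial_multiplier N t"
  shows "trivial_multiplier N (\<lambda>\<delta>. x * s \<delta> + y * t \<delta>)"
  unfolding trivial_multiplier_def
proof (intro allI impI)
  fix a b c d :: int assume "a * d - b * c = 1" "int N dvd c"
  hence "12 dvd x * (\<Sum>\<delta> | \<delta> dvd N. s \<delta> * eta_exp a (int \<delta> * b) (c div int \<delta>) d) +
     y * (\<Sum>\<delta> | \<delta> dvd N. t \<delta> * eta_exp a (int \<delta> * b) (c div int \<delta>) d)"
    using assms unfolding trivial_multiplier_def by (intro dvd_add dvd_mult) blast+
  also have "\<dots> = (\<Sum>\<delta> | \<delta> dvd N. (x * s \<delta> + y * t \<delta>) * eta_exp a (int \<delta> * b) (c div int \<delta>) d)"
    by (simp add: sum_distrib_left sum.distrib[symmetric] algebra_simps)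
  finally show "12 dvd \<dots>" .
qed

lemma sum_two_divisors:
  fixes g :: "nat \<Rightarrow> int"
  assumes "N > 0" "p dvd N" "p \<noteq> 1"
  shows "(\<Sum>\<delta> | \<delta> dvd N. (if \<delta> = 1 then x else if \<delta> = p then y else 0) * g \<delta>) = x * g 1 + y * g p"
proof -
  have "(\<Sum>\<delta> | \<delta> dvd N. (if \<delta> = 1 then x else if \<delta> = p then y else 0) * g \<delta>) =
    (\<Sum>\<delta> \<in> {1, p}. (if \<delta> = 1 then x else if \<delta> = p then y else 0) * g \<delta>)"
    by (rule sum.mono_neutral_right) (use assms in auto)
  thus ?thesis using assms(3) by simp
qed

text \<open>
  If \<open>p = -1\<close> modulo \<open>m\<close>, then conjugation by \<open>z \<mapsto> p z\<close> acts on a matrix modulo \<open>m\<close> by a change of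
  sign of both off-diagonal entries.
\<close>

lemma conjugate_minus_cong:
  assumes "int p dvd c" "p > 0" "[int p = - 1] (mod m)"
  shows "[int p * b = - b] (mod m)" "[c div int p = - c] (mod m)"
proof -
  obtain c' where c: "c = int p * c'" using assms(1) by blast
  have "[int p * b = (- 1) * b] (mod m)" by (intro cong_mult assms(3) cong_refl)
  thus "[int p * b = - b] (mod m)" by simp
  have "[int p * c' = (- 1) * c'] (mod m)" by (intro cong_mult assms(3) cong_refl)
  hence "[- (int p * c') = - (- 1 * c')] (mod m)" by (simp only: cong_minus_minus_iff)
  thus "[c div int p = - c] (mod m)" using assms(2) by (simp add: c cong_sym)
qed

text \<open>
  The exponent sums have to vanish modulo \<open>4\<close>; modulo \<open>3\<close> the factors \<open>6\<close> and \<open>3\<close> suffice. If \<open>4\<close>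
  divides \<open>N\<close>, then \<open>\<eta>(2 z)\<^bsup>12\<^esup>\<close> has trivial multiplier. If \<open>p = 3\<close> modulo \<open>4\<close>, then the exponents
  for \<open>\<eta>(z)\<^sup>6\<close> and \<open>\<eta>(p z)\<^sup>6\<close> are opposite modulo \<open>4\<close>, so that the product has trivial multiplier.
\<close>

lemma weight_6_vector:
  assumes N: "N > 0" and "4 dvd N \<or> (\<exists>p. prime p \<and> p dvd N \<and> p mod 4 = 3)"
  obtains s where "(\<Sum>\<delta> | \<delta> dvd N. s \<delta>) = 6" "trivial_multiplier N s"
  using assms(2)
proof (elim disjE exE conjE)
  assume four: "4 dvd N"
  hence two: "2 dvd N" using dvd_trans[of 2 4 N] by simp
  define s where "s = (\<lambda>\<delta>::nat. if \<delta> = 1 then 0 else if \<delta> = 2 then 6 else 0 :: int)"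
  have "(\<Sum>\<delta> | \<delta> dvd N. s \<delta>) = 6" using sum_two_divisors[OF N two, of 0 6 "\<lambda>_. 1"] by (simp add: s_def)
  moreover have "trivial_multiplier N s" unfolding trivial_multiplier_def
  proof (intro allI impI)
    fix a b c d :: int assume det: "a * d - b * c = 1" and c: "int N dvd c"
    have "int 4 dvd c" using four c dvd_trans int_dvd_int_iff by blast
    then obtain c' where c': "c = 4 * c'" by auto
    have "odd d"
    proof
      assume "even d"
      hence "even (a * d - b * c)" by (simp add: c')
      thus False by (simp add: det)
    qed
    have "[eta_exp4 a (2 * b) (2 * c') d = eta_exp4 a 0 0 d] (mod 2)"
      by (rule eta_exp4_cong) (auto simp: cong_def)
    moreover have "even (eta_exp4 a 0 0 d)" using \<open>odd d\<close> by (simp add: eta_exp4_def)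
    ultimately have "even (eta_exp4 a (2 * b) (2 * c') d)" using cong_dvd_iff by blast
    hence "even (eta_exp a (2 * b) (2 * c') d)" by (simp add: eta_exp_def)
    hence "6 * 2 dvd 6 * eta_exp a (2 * b) (2 * c') d" by (intro mult_dvd_mono) auto
    thus "12 dvd (\<Sum>\<delta> | \<delta> dvd N. s \<delta> * eta_exp a (int \<delta> * b) (c div int \<delta>) d)"
      unfolding s_def using sum_two_divisors[OF N two, of 0 6 "\<lambda>\<delta>. eta_exp a (int \<delta> * b) (c div int \<delta>) d"] by (simp add: c')
  qed
  ultimately show ?thesis by (rule that)
next
  fix p assume p: "prime p" "p dvd N" "p mod 4 = 3"
  have p1: "p \<noteq> 1" "p > 0" using p(1) prime_gt_1_nat[OF p(1)] by auto
  define s where "s = (\<lambda>\<delta>::nat. if \<delta> = 1 then 3 else if \<delta> = p then 3 else 0 :: int)"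
  have "(\<Sum>\<delta> | \<delta> dvd N. s \<delta>) = 6" using sum_two_divisors[OF N p(2) p1(1), of 3 3 "\<lambda>_. 1"] by (simp add: s_def)
  moreover have "trivial_multiplier N s" unfolding trivial_multiplier_def
  proof (intro allI impI)
    fix a b c d :: int assume det: "a * d - b * c = 1" and c: "int N dvd c"
    have pc: "int p dvd c" using p(2) c dvd_trans int_dvd_int_iff by blast
    have "int p mod 4 = 3" using p(3) by (metis of_nat_mod of_nat_numeral)
    hence "[int p = - 1] (mod 4)" by (simp add: cong_def)
    note cc = conjugate_minus_cong[OF pc p1(2) this]
    have "[eta_exp4 a (int p * b) (c div int p) d = eta_exp4 a (- b) (- c) d] (mod 4)"
      by (rule eta_exp4_cong[OF cong_refl cc cong_refl])
    hence "[eta_exp4 a (int p * b) (c div int p) d = - eta_exp4 a b c d] (mod 4)"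
      using eta_exp4_relations(3)[OF det] cong_trans by blast
    hence "4 dvd eta_exp4 a b c d + eta_exp4 a (int p * b) (c div int p) d"
      by (simp add: cong_iff_dvd_diff add.commute)
    then obtain u where u: "eta_exp4 a b c d + eta_exp4 a (int p * b) (c div int p) d = 4 * u" by blast
    have "3 * eta_exp a b c d + 3 * eta_exp a (int p * b) (c div int p) d =
       12 * (eta_exp3 a b c d + eta_exp3 a (int p * b) (c div int p) d) - 9 * (eta_exp4 a b c d + eta_exp4 a (int p * b) (c div int p) d)"
      by (simp add: eta_exp_def algebra_simps)
    also have "\<dots> = 12 * (eta_exp3 a b c d + eta_exp3 a (int p * b) (c div int p) d - 3 * u)" unfolding u by simp
    finally show "12 dvd (\<Sum>\<delta> | \<delta> dvd N. s \<delta> * eta_exp a (int \<delta> * b) (c div int \<delta>) d)"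
      unfolding s_def sum_two_divisors[OF N p(2) p1(1)] by simp
  qed
  ultimately show ?thesis by (rule that)
qed

text \<open>
  The exponent sums have to vanish modulo \<open>3\<close>; modulo \<open>4\<close> the factors \<open>4\<close> and \<open>8\<close> suffice. If \<open>9\<close>
  divides \<open>N\<close>, then \<open>\<eta>(3 z)\<^sup>8\<close> has trivial multiplier. If \<open>p = 2\<close> modulo \<open>3\<close>, then the exponents
  for \<open>\<eta>(z)\<^sup>8\<close> and \<open>\<eta>(p z)\<^sup>8\<close> are opposite modulo \<open>3\<close>, and \<open>\<eta>(z)\<^bsup>16\<^esup> / \<eta>(p z)\<^sup>8\<close> has trivial
  multiplier and the weight \<open>4\<close>.
\<close>

lemma weight_4_vector:
  assumes N: "N > 0" and "9 dvd N \<or> (\<exists>p. prime p \<and> p dvd N \<and> p mod 3 = 2)"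
  obtains s where "(\<Sum>\<delta> | \<delta> dvd N. s \<delta>) = 4" "trivial_multiplier N s"
  using assms(2)
proof (elim disjE exE conjE)
  assume nine: "9 dvd N"
  hence three: "3 dvd N" using dvd_trans[of 3 9 N] by simp
  define s where "s = (\<lambda>\<delta>::nat. if \<delta> = 1 then 0 else if \<delta> = 3 then 4 else 0 :: int)"
  have "(\<Sum>\<delta> | \<delta> dvd N. s \<delta>) = 4" using sum_two_divisors[OF N three, of 0 4 "\<lambda>_. 1"] by (simp add: s_def)
  moreover have "trivial_multiplier N s" unfolding trivial_multiplier_def
  proof (intro allI impI)
    fix a b c d :: int assume det: "a * d - b * c = 1" and c: "int N dvd c"
    have "int 9 dvd c" using nine c dvd_trans int_dvd_int_iff by blast
    then obtain c' where c': "c = 9 * c'" by auto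
    have "[eta_exp3 a (3 * b) (3 * c') d = eta_exp3 a 0 0 d] (mod 3)"
      by (rule eta_exp3_cong) (auto simp: cong_def)
    hence "3 dvd eta_exp3 a (3 * b) (3 * c') d" by (simp add: eta_exp3_def cong_0_iff)
    hence "3 dvd eta_exp a (3 * b) (3 * c') d" by (simp add: eta_exp_def)
    hence "4 * 3 dvd 4 * eta_exp a (3 * b) (3 * c') d" by (intro mult_dvd_mono) auto
    thus "12 dvd (\<Sum>\<delta> | \<delta> dvd N. s \<delta> * eta_exp a (int \<delta> * b) (c div int \<delta>) d)"
      unfolding s_def using sum_two_divisors[OF N three, of 0 4 "\<lambda>\<delta>. eta_exp a (int \<delta> * b) (c div int \<delta>) d"] by (simp add: c')
  qed
  ultimately show ?thesis by (rule that)
next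
  fix p assume p: "prime p" "p dvd N" "p mod 3 = 2"
  have p1: "p \<noteq> 1" "p > 0" using p(1) prime_gt_1_nat[OF p(1)] by auto
  define s where "s = (\<lambda>\<delta>::nat. if \<delta> = 1 then 8 else if \<delta> = p then - 4 else 0 :: int)"
  have "(\<Sum>\<delta> | \<delta> dvd N. s \<delta>) = 4" using sum_two_divisors[OF N p(2) p1(1), of 8 "- 4" "\<lambda>_. 1"] by (simp add: s_def)
  moreover have "trivial_multiplier N s" unfolding trivial_multiplier_def
  proof (intro allI impI)
    fix a b c d :: int assume det: "a * d - b * c = 1" and c: "int N dvd c"
    have pc: "int p dvd c" using p(2) c dvd_trans int_dvd_int_iff by blast
    have "int p mod 3 = 2" using p(3) by (metis of_nat_mod of_nat_numeral)
    hence "[int p = - 1] (mod 3)" by (simp add: cong_def)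
    note cc = conjugate_minus_cong[OF pc p1(2) this]
    have "[eta_exp3 a (int p * b) (c div int p) d = eta_exp3 a (- b) (- c) d] (mod 3)"
      by (rule eta_exp3_cong[OF cong_refl cc cong_refl])
    moreover have "eta_exp3 a (- b) (- c) d = - eta_exp3 a b c d" by (simp add: eta_exp3_def)
    ultimately have "3 dvd eta_exp3 a b c d + eta_exp3 a (int p * b) (c div int p) d"
      by (simp add: cong_iff_dvd_diff add.commute)
    then obtain u where u: "eta_exp3 a b c d + eta_exp3 a (int p * b) (c div int p) d = 3 * u" by blast
    have "8 * eta_exp a b c d + - 4 * eta_exp a (int p * b) (c div int p) d =
       12 * eta_exp a b c d + 12 * (eta_exp4 a b c d + eta_exp4 a (int p * b) (c div int p) d)
        - 16 * (eta_exp3 a b c d + eta_exp3 a (int p * b) (c div int p) d)"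
      by (simp add: eta_exp_def algebra_simps)
    also have "\<dots> = 12 * (eta_exp a b c d + (eta_exp4 a b c d + eta_exp4 a (int p * b) (c div int p) d) - 4 * u)" unfolding u by simp
    finally show "12 dvd (\<Sum>\<delta> | \<delta> dvd N. s \<delta> * eta_exp a (int \<delta> * b) (c div int \<delta>) d)"
      unfolding s_def sum_two_divisors[OF N p(2) p1(1)] by simp
  qed
  ultimately show ?thesis by (rule that)
qed

text \<open>
  Weight \<open>12\<close> is always possible; weight \<open>6\<close> is possible if there are no elliptic points of order
  \<open>2\<close>, weight \<open>4\<close> if there are none of order \<open>3\<close>. These generate the weights in question, as \<open>2 =
  6 - 4\<close>.
\<close>

lemma weight_vector:
  assumes N: "N > 0" and k: "even k" and e3: "epsilon3 N = 0 \<or> 6 dvd k" and e2: "epsilon2 N = 0 \<or> 4 dvd (k::int)"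
  obtains s where "(\<Sum>\<delta> | \<delta> dvd N. s \<delta>) = k" "trivial_multiplier N s"
proof -
  have scale: "(\<Sum>\<delta> | \<delta> dvd N. x * s \<delta> + y * t \<delta>) = x * (\<Sum>\<delta> | \<delta> dvd N. s \<delta>) + y * (\<Sum>\<delta> | \<delta> dvd N. t \<delta>)" for x y :: int and s t
    by (simp add: sum.distrib sum_distrib_left)
  have "12 dvd k \<longleftrightarrow> 4 dvd k \<and> 6 dvd k" by presburger
  then consider (twelve) "12 dvd k" | (six) "6 dvd k" "\<not> 4 dvd k" | (four) "4 dvd k" "\<not> 6 dvd k" | (two) "\<not> 4 dvd k" "\<not> 6 dvd k"
    by blast
  thus ?thesis
  proof cases
    case twelve
    define s where "s = (\<lambda>\<delta>::nat. if \<delta> = 1 then k else 0)"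
    have "(\<Sum>\<delta> | \<delta> dvd N. s \<delta>) = k" unfolding s_def using N by (subst sum.delta) auto
    moreover have "trivial_multiplier N s" by (rule trivial_multiplier_12) (use twelve in \<open>simp add: s_def\<close>)
    ultimately show ?thesis by (rule that)
  next
    case six
    then obtain s where s: "(\<Sum>\<delta> | \<delta> dvd N. s \<delta>) = 6" "trivial_multiplier N s"
      using weight_6_vector[OF N] epsilon2_zero_imp[OF N] e2 by metis
    obtain j where "k = 6 * j" using six by blast
    thus ?thesis using that[of "\<lambda>\<delta>. j * s \<delta> + 0 * s \<delta>"] trivial_multiplier_combine[OF s(2) s(2), of j 0] scale[of j s 0 s] s(1) by simp
  next
    case four
    then obtain s where s: "(\<Sum>\<delta> | \<delta> dvd N. s \<delta>) = 4" "trivial_multiplier N s"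
      using weight_4_vector[OF N] epsilon3_zero_imp[OF N] e3 by metis
    obtain j where "k = 4 * j" using four by blast
    thus ?thesis using that[of "\<lambda>\<delta>. j * s \<delta> + 0 * s \<delta>"] trivial_multiplier_combine[OF s(2) s(2), of j 0] scale[of j s 0 s] s(1) by simp
  next
    case two
    then obtain s t where s: "(\<Sum>\<delta> | \<delta> dvd N. s \<delta>) = 6" "trivial_multiplier N s"
      and t: "(\<Sum>\<delta> | \<delta> dvd N. t \<delta>) = 4" "trivial_multiplier N t"
      using weight_6_vector[OF N] epsilon2_zero_imp[OF N] e2 weight_4_vector[OF N] epsilon3_zero_imp[OF N] e3 by metis
    obtain j where "k = 2 * j" using k by blast
    thus ?thesis using that[of "\<lambda>\<delta>. j * s \<delta> + (- j) * t \<delta>"] trivial_multiplier_combine[OF s(2) t(2), of j "- j"] scale[of j s "- j" t] s(1) t(1) by simp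
  qed
qed

lemma cusp_sum_gcd:
  assumes "N > 0"
  shows "cusp_sum N s c = cusp_sum N s (gcd (int N) c)"
  unfolding cusp_sum_def
proof (intro sum.cong refl)
  fix \<delta> assume "\<delta> \<in> {\<delta>. \<delta> dvd N}"
  hence "gcd (int \<delta>) (int N) = int \<delta>" by (simp add: gcd_proj1_if_dvd)
  hence "gcd (int \<delta>) (gcd (int N) c) = gcd (int \<delta>) c" by (metis gcd.assoc)
  thus "of_int (s \<delta>) * of_int (gcd (int \<delta>) c) ^ 2 / of_nat \<delta> = of_int (s \<delta>) * of_int (gcd (int \<delta>) (gcd (int N) c)) ^ 2 / of_nat \<delta>" by simp
qed

text \<open>
  A power of a function of weight \<open>0\<close> with zeros at all cusps but \<open>\<infinity>\<close> removes the poles there. The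
  order at a cusp depends on \<open>gcd N c\<close> only, so that one power serves for all cusps.
\<close>

lemma eta_quotient_of_weight:
  assumes N: "N > 1" and s: "(\<Sum>\<delta> | \<delta> dvd N. s \<delta>) = k" "trivial_multiplier N s"
  obtains r where "eta_quotient N r \<in> R_space k N"
proof -
  have N0: "N > 0" using N by simp
  define u where "u = (\<lambda>\<delta>. 12 * inf_scale N 1 \<delta>)"
  note u = inf_scale_properties[OF N one_dvd, folded u_def]
  define C where "C = {c \<in> {1..int N}. \<not> int N dvd c}"
  have finC: "finite C" by (rule finite_subset[of _ "{1..int N}"]) (auto simp: C_def)
  \<comment> \<open>A sum instead of a maximum, to bound the required exponent for all residues at once.\<close>
  define t where "t = (\<Sum>c\<in>C. nat \<lceil>\<bar>cusp_sum N s c\<bar> / cusp_sum N u c\<rceil>)"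
  define s' where "s' = (\<lambda>\<delta>. 1 * s \<delta> + int t * u \<delta>)"
  have "(\<Sum>\<delta> | \<delta> dvd N. s' \<delta>) = k"
    using s(1) u(1) by (simp add: s'_def sum.distrib sum_distrib_left[symmetric])
  moreover have "trivial_multiplier N s'" unfolding s'_def
    by (intro trivial_multiplier_combine s(2) trivial_multiplier_12) (simp add: u_def)
  moreover have "cusp_sum N s' c \<ge> 0" if c: "\<not> int N dvd c" for c
  proof -
    define g where "g = gcd (int N) c"
    have g: "g \<in> C"
    proof -
      have "\<not> int N dvd g" using c unfolding g_def by (meson dvd_trans gcd_dvd2)
      moreover have "g > 0" "g \<le> int N" using N0 by (auto simp: g_def intro: zdvd_imp_le)
      ultimately show ?thesis by (simp add: C_def)
    qed
    have up: "cusp_sum N u g > 0" using u(2) g by (simp add: C_def)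
    have "nat \<lceil>\<bar>cusp_sum N s g\<bar> / cusp_sum N u g\<rceil> \<le> t"
      unfolding t_def using member_le_sum[OF g _ finC, of "\<lambda>c. nat \<lceil>\<bar>cusp_sum N s c\<bar> / cusp_sum N u c\<rceil>"] by simp
    hence "\<bar>cusp_sum N s g\<bar> / cusp_sum N u g \<le> real t" by linarith
    hence "\<bar>cusp_sum N s g\<bar> \<le> real t * cusp_sum N u g" using up by (simp add: divide_le_eq)
    hence "cusp_sum N s' g \<ge> 0" unfolding s'_def cusp_sum_linear by simp
    thus ?thesis using cusp_sum_gcd[OF N0, of s' c] by (simp add: g_def)
  qed
  ultimately have "eta_quotient N (\<lambda>\<delta>. 2 * s' \<delta>) \<in> R_space k N" by (rule eta_quotient_in_R_space[OF N0])
  thus ?thesis by (rule that)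
qed

theorem finite_codimension:
  assumes N: "(N > 1 \<and> \<not> prime N) \<or> N \<in> {2, 3, 5, 7, 13}" and k: "0 \<le> k" "even k"
    and e: "epsilon3 N = 0 \<or> 6 dvd k" "epsilon2 N = 0 \<or> 4 dvd k"
  shows "finite_codimension_in (E_space k N) (R_space k N)"
proof -
  have N1: "N > 1" "N > 0" using N by auto
  obtain s where s: "(\<Sum>\<delta> | \<delta> dvd N. s \<delta>) = k" "trivial_multiplier N s"
    by (rule weight_vector[OF N1(2) k(2) e])
  obtain r where r: "eta_quotient N r \<in> R_space k N" by (rule eta_quotient_of_weight[OF N1(1) s])
  have "\<i> \<in> uhp" by (simp add: uhp_def)
  then obtain g0 where "has_order (eta_quotient N r) g0"
    using R_space_has_order[OF N1(2) r eta_quotient_nonzero[OF N1(2)]] by blast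
  thus ?thesis using finite_codimension_of_eta_quotient[OF N k(1) E_space_eta_quotient[OF r]] by blast
qed

section \<open>Prime levels of positive genus\<close>

text \<open>
  If \<open>g = u(w) w\<^sup>m\<close> with \<open>w = exp (2 \<pi> \<i> z / N)\<close>, then \<open>g' / g = (2 \<pi> \<i> / N) (m + w u'(w) /
  u(w))\<close>.
\<close>

lemma logderiv_limit:
  fixes N :: nat
  assumes N: "N > 0" and r: "r > 0" and u: "u holomorphic_on ball 0 r" "u 0 \<noteq> 0"
    and g: "eventually (\<lambda>z. g z = u (nome (z / of_nat N)) * nome (z / of_nat N) powi m) ii_inf"
  shows "((\<lambda>z. deriv g z / g z) \<longlongrightarrow> 2 * of_real pi * \<i> / of_nat N * of_int m) ii_inf"
proof -
  define \<kappa> where "\<kappa> = 2 * of_real pi * \<i> / (of_nat N :: complex)"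
  have lim: "filterlim (\<lambda>z. nome (z / of_nat N)) (at 0) ii_inf"
    using filterlim_nome[of "1 / N" 0] N by simp
  have cu: "isCont u 0" using holomorphic_on_imp_continuous_on[OF u(1)] r by (simp add: continuous_on_eq_continuous_at)
  have "deriv u holomorphic_on ball 0 r" by (rule holomorphic_deriv[OF u(1)]) simp
  from holomorphic_on_imp_continuous_on[OF this] have cd: "isCont (deriv u) 0" using r by (simp add: continuous_on_eq_continuous_at)
  have "((\<lambda>w. \<kappa> * (w * deriv u w / u w + of_int m)) \<longlongrightarrow> \<kappa> * (0 * deriv u 0 / u 0 + of_int m)) (at 0)"
    using cu cd u(2) unfolding isCont_def by (intro tendsto_intros) auto
  hence L: "((\<lambda>z. \<kappa> * (nome (z / of_nat N) * deriv u (nome (z / of_nat N)) / u (nome (z / of_nat N)) + of_int m)) \<longlongrightarrow> \<kappa> * of_int m) ii_inf"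
    using filterlim_compose[OF _ lim] by simp
  have "eventually (\<lambda>w. w \<in> ball 0 r \<and> u w \<noteq> 0) (at 0)"
  proof (rule eventually_conj)
    show "eventually (\<lambda>w. w \<in> ball 0 r) (at 0)" using r by (auto simp: eventually_at dist_commute intro!: exI[of _ r])
    show "eventually (\<lambda>w. u w \<noteq> 0) (at 0)" using cu u(2) by (auto simp: isCont_def intro: tendsto_imp_eventually_ne)
  qed
  hence ev: "eventually (\<lambda>z. nome (z / of_nat N) \<in> ball 0 r \<and> u (nome (z / of_nat N)) \<noteq> 0) ii_inf"
    using lim by (auto simp: filterlim_iff)
  obtain y where y: "\<And>z. Im z > y \<Longrightarrow> g z = u (nome (z / of_nat N)) * nome (z / of_nat N) powi m"
    using g by (auto simp: eventually_ii_inf)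
  have "eventually (\<lambda>z. Im z > y) ii_inf" by (auto simp: eventually_ii_inf)
  hence "eventually (\<lambda>z. \<kappa> * (nome (z / of_nat N) * deriv u (nome (z / of_nat N)) / u (nome (z / of_nat N)) + of_int m) = deriv g z / g z) ii_inf"
    using ev
  proof eventually_elim
    case (elim z)
    define w where "w = nome (z / of_nat N)"
    have w0: "w \<noteq> 0" by (simp add: w_def)
    have dw: "((\<lambda>z. nome (z / of_nat N)) has_field_derivative \<kappa> * w) (at z)"
      unfolding nome_def w_def \<kappa>_def using N by (auto intro!: derivative_eq_intros)
    have du: "(u has_field_derivative deriv u w) (at w)"
      using holomorphic_derivI[OF u(1)] elim by (simp add: w_def)
    have D1: "((\<lambda>z. u (nome (z / of_nat N))) has_field_derivative deriv u w * (\<kappa> * w)) (at z)"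
      using DERIV_chain'[OF dw] du by (simp add: w_def)
    have D2: "((\<lambda>z. nome (z / of_nat N) powi m) has_field_derivative of_int m * w powi (m - 1) * (\<kappa> * w)) (at z)"
      using DERIV_power_int[OF dw, of m] by (simp add: w_def)
    have D3: "((\<lambda>z. u (nome (z / of_nat N)) * nome (z / of_nat N) powi m) has_field_derivative
        deriv u w * (\<kappa> * w) * w powi m + of_int m * w powi (m - 1) * (\<kappa> * w) * u w) (at z)"
      using DERIV_mult[OF D1 D2] by (simp add: w_def)
    have "(g has_field_derivative deriv u w * (\<kappa> * w) * w powi m + of_int m * w powi (m - 1) * (\<kappa> * w) * u w) (at z)"
      by (rule has_field_derivative_transform_within_open[OF D3, of "{z. Im z > y}"])
         (use elim y in \<open>auto simp: open_halfspace_Im_gt\<close>)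
    hence "deriv g z = deriv u w * (\<kappa> * w) * w powi m + of_int m * w powi (m - 1) * (\<kappa> * w) * u w"
      by (rule DERIV_imp_deriv)
    also have "\<dots> = deriv u w * (\<kappa> * w) * w powi m + of_int m * \<kappa> * u w * (w powi (m - 1) * w)" by (simp add: mult_ac)
    also have "w powi (m - 1) * w = w powi m" using w0 by (simp add: power_int_diff)
    also have "deriv u w * (\<kappa> * w) * w powi m + of_int m * \<kappa> * u w * w powi m = \<kappa> * (w * deriv u w + of_int m * u w) * w powi m"
      by (simp add: algebra_simps)
    finally have "deriv g z = \<kappa> * (w * deriv u w + of_int m * u w) * w powi m" .
    moreover have "g z = u w * w powi m" using y elim by (simp add: w_def)
    moreover have "u w \<noteq> 0" "w powi m \<noteq> 0" using elim w0 by (auto simp: w_def)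
    ultimately have "deriv g z / g z = \<kappa> * (w * deriv u w + of_int m * u w) / u w" by simp
    thus ?case using \<open>u w \<noteq> 0\<close> by (simp add: w_def[symmetric] field_simps)
  qed
  with L show ?thesis unfolding \<kappa>_def by (rule Lim_transform_eventually)
qed

lemma logderiv_bounded:
  assumes N: "N > 0" and mero: "meromorphic_at_ii_infinity N g" and nz: "\<And>z. z \<in> uhp \<Longrightarrow> g z \<noteq> 0"
  shows "\<exists>C. eventually (\<lambda>z. norm (deriv g z / g z) \<le> C) ii_inf"
proof -
  obtain F y where F: "F meromorphic_on {0}" "\<And>z. Im z > y \<Longrightarrow> g z = F (nome (z / of_nat N))"
    using mero unfolding meromorphic_at_ii_infinity_def nome_def by auto
  have lim: "filterlim (\<lambda>z. nome (z / of_nat N)) (at 0) ii_inf"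
    using filterlim_nome[of "1 / N" 0] N by simp
  have ev: "eventually (\<lambda>z. g z = F (nome (z / of_nat N))) ii_inf" using F(2) by (auto simp: eventually_ii_inf)
  have "\<exists>\<^sub>F w in at 0. F w \<noteq> 0"
  proof (rule ccontr)
    assume "\<not> (\<exists>\<^sub>F w in at 0. F w \<noteq> 0)"
    hence "eventually (\<lambda>w. F w = 0) (at 0)" by (simp add: frequently_def)
    hence "eventually (\<lambda>z. F (nome (z / of_nat N)) = 0) ii_inf" using lim by (auto simp: filterlim_iff)
    hence "eventually (\<lambda>z. False) ii_inf" using ev eventually_uhp by eventually_elim (use nz in auto)
    thus False by simp
  qed
  moreover have "isolated_singularity_at F 0" "not_essential F 0" using F(1) by (auto simp: meromorphic_at_iff)
  ultimately obtain n u r where u: "r > 0" "u holomorphic_on cball 0 r" "u 0 \<noteq> 0"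
    "\<And>w. w \<in> cball 0 r - {0} \<Longrightarrow> F w = u w * w powi n"
    using holomorphic_factor_puncture[of F 0] by auto
  have "eventually (\<lambda>w. w \<in> cball 0 r - {0}) (at 0)"
    using u(1) by (auto simp: eventually_at dist_commute intro!: exI[of _ r])
  hence "eventually (\<lambda>z. nome (z / of_nat N) \<in> cball 0 r - {0}) ii_inf" using lim by (auto simp: filterlim_iff)
  hence gu: "eventually (\<lambda>z. g z = u (nome (z / of_nat N)) * nome (z / of_nat N) powi n) ii_inf"
    using ev by eventually_elim (simp add: u(4))
  have hol: "u holomorphic_on ball 0 r" using u(2) by (rule holomorphic_on_subset) auto
  have "((\<lambda>z. deriv g z / g z) \<longlongrightarrow> 2 * of_real pi * \<i> / of_nat N * of_int n) ii_inf"
    by (rule logderiv_limit[OF N u(1) hol u(3) gu])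
  hence "eventually (\<lambda>z. norm (deriv g z / g z) < norm (2 * of_real pi * \<i> / of_nat N * of_int n) + 1) ii_inf"
    using order_tendstoD(2)[OF tendsto_norm] by (metis less_add_one)
  thus ?thesis by (auto elim!: eventually_mono intro: less_imp_le intro!: exI)
qed

definition log_derivative :: "(complex \<Rightarrow> complex) \<Rightarrow> complex \<Rightarrow> complex" where
  "log_derivative f z = (if z \<in> uhp then deriv f z / f z else 0)"

lemma moebius_deriv:
  assumes z: "z \<in> uhp" and det: "a * d - b * c = 1"
  shows "(mob a b c d has_field_derivative 1 / (of_int c * z + of_int d) ^ 2) (at z)"
proof -
  have J: "of_int c * z + of_int d \<noteq> 0" by (rule uhp_lin_nonzero[OF z det])
  have detC: "of_int a * of_int d - of_int b * of_int c = (1::complex)"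
    using det by (metis of_int_1 of_int_diff of_int_mult)
  have "(of_int a * (of_int c * z + of_int d) - (of_int a * z + of_int b) * of_int c) = of_int a * of_int d - of_int b * of_int c"
    by (simp add: algebra_simps)
  hence e: "(of_int a * (of_int c * z + of_int d) - (of_int a * z + of_int b) * of_int c) / ((of_int c * z + of_int d) * (of_int c * z + of_int d))
      = 1 / (of_int c * z + of_int d) ^ 2" unfolding detC by (simp add: power2_eq_square)
  have "((\<lambda>z. (of_int a * z + of_int b) / (of_int c * z + of_int d)) has_field_derivative
     (of_int a * (of_int c * z + of_int d) - (of_int a * z + of_int b) * of_int c) / ((of_int c * z + of_int d) * (of_int c * z + of_int d))) (at z)"
    by (rule DERIV_divide) (use J in \<open>auto intro!: derivative_eq_intros\<close>)
  thus ?thesis unfolding e .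
qed

text \<open>
  The derivative of \<open>z \<mapsto> f (M z)\<close> brings in the factor of weight \<open>2\<close>. At every cusp a zero or pole
  of \<open>f\<close> only gives a constant term of the logarithmic derivative.
\<close>

lemma log_derivative_in_R_space:
  assumes N: "N > 0" and f: "f \<in> R_space 0 N" and nz: "\<And>z. z \<in> uhp \<Longrightarrow> f z \<noteq> 0"
  shows "log_derivative f \<in> R_space 2 N"
proof -
  have hol: "f holomorphic_on uhp" and inv: "invariant_form 0 N f" using f by (auto simp: R_space_iff)
  have df: "(f has_field_derivative deriv f z) (at z)" if "z \<in> uhp" for z
    by (rule holomorphic_derivI[OF hol open_uhp that])
  have chain: "deriv (\<lambda>z. f (mob a b c d z)) z = deriv f (mob a b c d z) / (of_int c * z + of_int d) ^ 2"
    if z: "z \<in> uhp" and det: "a * d - b * c = 1" for a b c d z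
    using DERIV_imp_deriv[OF DERIV_chain'[OF moebius_deriv[OF z det] df[OF uhp_moebius(2)[OF z det]]]] by simp
  have "(\<lambda>z. deriv f z / f z) holomorphic_on uhp"
    by (intro holomorphic_intros holomorphic_deriv hol open_uhp) (use nz in auto)
  hence hol2: "log_derivative f holomorphic_on uhp"
    by (rule holomorphic_transform) (simp add: log_derivative_def)
  have inv2: "invariant_form 2 N (log_derivative f)"
    unfolding invariant_form_def
  proof (intro allI impI ballI)
    fix a b c d z assume *: "a * d - b * c = 1" "int N dvd c" "z \<in> uhp"
    have J: "of_int c * z + of_int d \<noteq> 0" by (rule uhp_lin_nonzero[OF *(3,1)])
    have eq: "f (mob a b c d z) = f z" if "z \<in> uhp" for z using invariant_formD[OF inv *(1,2) that] by simp
    have "((\<lambda>z. f (mob a b c d z)) has_field_derivative deriv f z) (at z)"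
      by (rule has_field_derivative_transform_within_open[OF df[OF *(3)] open_uhp *(3)]) (simp add: eq)
    from DERIV_imp_deriv[OF this] have "deriv f (mob a b c d z) = (of_int c * z + of_int d) ^ 2 * deriv f z"
      using chain[OF *(3,1)] J by (simp add: field_simps)
    thus "log_derivative f (mob a b c d z) = (of_int c * z + of_int d) powi 2 * log_derivative f z"
      using uhp_moebius(2)[OF *(3,1)] *(3) eq[OF *(3)] by (simp add: log_derivative_def)
  qed
  have bd: "\<exists>C. eventually (\<lambda>z. norm (slash 2 (log_derivative f) (mat2 a b c d) z) \<le> C) ii_inf" if det: "a * d - b * c = 1" for a b c d
  proof -
    have s0: "slash 0 f (mat2 a b c d) = (\<lambda>z. f (mob a b c d z))" by (simp add: fun_eq_iff slash_mat2)
    have "meromorphic_at_ii_infinity N (\<lambda>z. f (mob a b c d z))" using f det unfolding R_space_iff s0[symmetric] by blast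
    then obtain C where "eventually (\<lambda>z. norm (deriv (\<lambda>z. f (mob a b c d z)) z / f (mob a b c d z)) \<le> C) ii_inf"
      using logderiv_bounded[OF N] nz uhp_moebius(2)[OF _ det] by blast
    hence "eventually (\<lambda>z. norm (slash 2 (log_derivative f) (mat2 a b c d) z) \<le> C) ii_inf"
      using eventually_uhp
    proof eventually_elim
      case (elim z)
      have "slash 2 (log_derivative f) (mat2 a b c d) z = deriv (\<lambda>z. f (mob a b c d z)) z / f (mob a b c d z)"
        unfolding chain[OF elim(2) det] slash_mat2
        using uhp_moebius(2)[OF elim(2) det] by (simp add: log_derivative_def power_int_minus field_simps)
      thus ?case using elim by simp
    qed
    thus ?thesis by blast
  qed
  show ?thesis unfolding R_space_iff
  proof (intro conjI allI impI)
    show "log_derivative f z = 0" if "z \<notin> uhp" for z using that by (simp add: log_derivative_def)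
    fix a b c d :: int assume det: "a * d - b * c = 1"
    obtain C where C: "eventually (\<lambda>z. norm (slash 2 (log_derivative f) (mat2 a b c d) z) \<le> C) ii_inf" using bd[OF det] by blast
    show "holomorphic_at_ii_infinity N (slash 2 (log_derivative f) (mat2 a b c d))"
      by (rule slash_ii_infinityI(1)[OF N hol2 inv2 det C])
    show "meromorphic_at_ii_infinity N (slash 2 (log_derivative f) (mat2 a b c d))"
      by (rule slash_ii_infinityI(2)[OF N hol2 inv2 det, of C 0]) (use C in simp)
  qed (use hol2 inv2 in auto)
qed

lemma R_space_power:
  assumes N: "N > 0" and f: "f \<in> R_space k N"
  shows "(\<lambda>z. if z \<in> uhp then f z ^ n else 0) \<in> R_space (int n * k) N"
proof (induction n)
  case 0
  have "uhp_one \<in> R_space 0 N" using uhp_one_in_E_space[OF N] E_space_subset_R_space by blast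
  thus ?case by (simp add: uhp_one_def [abs_def] cong: if_cong)
next
  case (Suc n)
  have "(\<lambda>z. f z * (if z \<in> uhp then f z ^ n else 0)) = (\<lambda>z. if z \<in> uhp then f z ^ Suc n else 0)" by (auto simp: fun_eq_iff)
  thus ?case using R_space_mult[OF f Suc] by (simp add: algebra_simps)
qed

text \<open>
  The 24-th power has a multiplier and a \<open>q\<close>-expansion that are known for all exponents.
  Comparison of the two laws for the matrix with rows \<open>(1, 0)\<close> and \<open>(p, 1)\<close> at the point \<open>\<i>\<close> shows
  that its weight is \<open>24 k\<close>. The two equations determine the eta-quotient from its weight and its
  order.
\<close>

lemma prime_level_eta_quotient_order:
  assumes p: "prime p" and r: "eta_quotient p r \<in> R_space k p" and n: "has_order (eta_quotient p r) n"
  shows "r 1 + r p = 2 * k" "r 1 + int p * r p = 24 * n"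
proof -
  have p0: "p > 0" "p > 1" using prime_gt_1_nat[OF p] by auto
  define F where "F = eta_quotient p (\<lambda>\<delta>. 2 * (12 * r \<delta>))"
  have F: "F z = eta_quotient p r z ^ 24" if "z \<in> uhp" for z
    using eta_quotient_power_int[OF that, of p 24 r] by (simp add: F_def)
  have "has_order (\<lambda>z. eta_quotient p r z ^ 24) (int 24 * n)" by (rule has_order_power[OF n])
  hence h: "has_order (\<lambda>z. eta_quotient p r z ^ 24) (24 * n)" by simp
  have "eventually (\<lambda>z. eta_quotient p r z ^ 24 = F z) ii_inf"
    using eventually_uhp by eventually_elim (simp add: F)
  hence "has_order F (24 * n)" by (rule has_order_cong[OF h])
  moreover have "has_order F (r 1 + int p * r p)" unfolding F_def
    by (rule eta_quotient_has_order[OF p0(1)]) (simp add: sum_divisors_prime[OF p])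
  ultimately show "r 1 + int p * r p = 24 * n" using has_order_unique by blast
  have inv1: "invariant_form (12 * (r 1 + r p)) p F" unfolding F_def
    by (rule invariant_eta_quotient[OF p0(1) _ trivial_multiplier_12]) (simp_all add: sum_divisors_prime[OF p])
  have inv2: "invariant_form k p (eta_quotient p r)" using r by (simp add: R_space_iff)
  define J where "J = of_int (int p) * \<i> + of_int 1"
  have i: "\<i> \<in> uhp" by (simp add: uhp_def)
  have det: "1 * 1 - 0 * int p = 1" by simp
  have m: "mob 1 0 (int p) 1 \<i> \<in> uhp" by (rule uhp_moebius(2)[OF i det])
  have J0: "J \<noteq> 0" unfolding J_def by (rule uhp_lin_nonzero[OF i det])
  have "J powi (12 * (r 1 + r p)) * F \<i> = F (mob 1 0 (int p) 1 \<i>)"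
    using invariant_formD[OF inv1 det _ i] by (simp add: J_def)
  also have "\<dots> = (J powi k * eta_quotient p r \<i>) ^ 24"
    unfolding F[OF m] using invariant_formD[OF inv2 det _ i] by (simp add: J_def)
  also have "\<dots> = J powi (24 * k) * F \<i>"
    using power_int_mult[of J k 24] by (simp add: F[OF i] power_mult_distrib mult.commute)
  finally have "J powi (12 * (r 1 + r p)) = J powi (24 * k)"
    using eta_quotient_nonzero[OF p0(1) i] by (simp add: F[OF i])
  hence nJ: "norm J powi (12 * (r 1 + r p)) = norm J powi (24 * k)" by (metis norm_power_int)
  have "norm J > 1"
  proof -
    have "\<bar>Im J\<bar> \<le> norm J" by (rule abs_Im_le_cmod)
    thus ?thesis using p0 by (simp add: J_def)
  qed
  hence "12 * (r 1 + r p) = 24 * k"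
    using nJ power_int_strict_increasing[of "12 * (r 1 + r p)" "24 * k" "norm J"]
      power_int_strict_increasing[of "24 * k" "12 * (r 1 + r p)" "norm J"] by linarith
  thus "r 1 + r p = 2 * k" by simp
qed

text \<open>
  The least of the pairwise different orders wins.
\<close>

lemma combination_has_order:
  assumes I: "finite I" "I \<noteq> {}" and c: "\<And>i. i \<in> I \<Longrightarrow> c i \<noteq> 0"
    and f: "\<And>i. i \<in> I \<Longrightarrow> has_order (f i) (v i)" and inj: "inj_on v I"
  obtains i where "i \<in> I" "has_order (\<lambda>z. \<Sum>i\<in>I. c i * f i z) (v i)"
proof -
  define m where "m = arg_min_on v I"
  have m: "m \<in> I" unfolding m_def by (rule arg_min_if_finite(1)[OF I])
  have less: "v m < v i" if i: "i \<in> I - {m}" for i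
  proof -
    have "\<not> v i < v m" unfolding m_def using arg_min_if_finite(2)[OF I] i by blast
    moreover have "v i \<noteq> v m" using i m inj by (auto dest: inj_onD)
    ultimately show ?thesis by simp
  qed
  have "((\<lambda>z. \<Sum>i\<in>I - {m}. c i * (f i z * nome z powi (- v m))) \<longlongrightarrow> (\<Sum>i\<in>I - {m}. c i * 0)) ii_inf"
    by (intro tendsto_sum tendsto_mult tendsto_const has_order_vanish[OF f less]) auto
  hence "((\<lambda>z. (\<Sum>i\<in>I - {m}. c i * f i z) * nome z powi (- v m)) \<longlongrightarrow> 0) ii_inf"
    by (simp add: sum_distrib_right mult.assoc)
  moreover have "has_order (\<lambda>z. c m * f m z) (v m)" by (rule has_order_scale[OF f[OF m] c[OF m]])
  ultimately have "has_order (\<lambda>z. c m * f m z + (\<Sum>i\<in>I - {m}. c i * f i z)) (v m)" by (intro has_order_add)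
  moreover have "(\<lambda>z. c m * f m z + (\<Sum>i\<in>I - {m}. c i * f i z)) = (\<lambda>z. \<Sum>i\<in>I. c i * f i z)"
    using I(1) m by (simp add: sum.remove fun_eq_iff)
  ultimately show ?thesis using that[OF m] by simp
qed

lemma sum_fun_scale_apply: "(\<Sum>i\<in>I. fun_scale (c i) (f i)) z = (\<Sum>i\<in>I. c i * f i z)"
  by (induction I rule: infinite_finite_induct) (simp_all add: fun_scale_def)

text \<open>Functions of pairwise different orders: the order of a combination is the least one.\<close>

lemma span_has_order:
  assumes ord: "\<And>f. f \<in> B \<Longrightarrow> has_order f (v f)" and inj: "inj_on v B"
    and e: "e \<in> fun_space.span B" "has_order e n"
  shows "n \<in> v ` B"
proof -
  obtain T c where T: "finite T" "T \<subseteq> B" "e = (\<Sum>f\<in>T. fun_scale (c f) f)"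
    using e(1) unfolding fun_space.span_explicit by auto
  define T' where "T' = {f \<in> T. c f \<noteq> 0}"
  have T': "finite T'" "T' \<subseteq> B" using T by (auto simp: T'_def)
  have "e z = (\<Sum>f\<in>T. c f * f z)" for z unfolding T(3) by (rule sum_fun_scale_apply)
  also have "(\<Sum>f\<in>T. c f * f z) = (\<Sum>f\<in>T'. c f * f z)" for z
    unfolding T'_def by (rule sum.mono_neutral_right) (use T(1) in auto)
  finally have ez: "e = (\<lambda>z. \<Sum>f\<in>T'. c f * f z)" by (simp add: fun_eq_iff)
  have ne: "T' \<noteq> {}"
  proof
    assume "T' = {}"
    hence "((\<lambda>z. e z * nome z powi (- n)) \<longlongrightarrow> 0) ii_inf" by (simp add: ez)
    thus False using vanish_has_order[OF e(2)] by blast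
  qed
  obtain f where "f \<in> T'" "has_order e (v f)"
    unfolding ez
    by (rule combination_has_order[OF T'(1) ne, of c "\<lambda>f. f" v])
       (use T'(2) ord inj in \<open>auto simp: T'_def intro: inj_on_subset\<close>)
  thus ?thesis using has_order_unique[OF e(2)] T'(2) by blast
qed

text \<open>
  Distinct eta-quotients of weight \<open>k\<close> have distinct orders, so the order of an element of their
  span is the order of one of them, and the difference of the two equations for this one is \<open>(p -
  1) r\<^sub>p = 24 n - 2 k\<close>.
\<close>

lemma prime_level_E_space_order:
  assumes p: "prime p" and e: "e \<in> E_space k p" "has_order e n"
  shows "(int p - 1) dvd 24 * n - 2 * k"
proof -
  have p0: "p > 0" "p > 1" using prime_gt_1_nat[OF p] by auto
  define B where "B = range (eta_quotient p) \<inter> R_space k p"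
  have i: "\<i> \<in> uhp" by (simp add: uhp_def)
  have "\<exists>n. has_order f n" if fB: "f \<in> B" for f
  proof -
    obtain r where r: "f = eta_quotient p r" "eta_quotient p r \<in> R_space k p" using fB by (auto simp: B_def)
    show ?thesis unfolding r(1) using R_space_has_order[OF p0(1) r(2) eta_quotient_nonzero[OF p0(1) i]] by blast
  qed
  then obtain v where v: "\<And>f. f \<in> B \<Longrightarrow> has_order f (v f)" by metis
  have inj: "inj_on v B"
  proof (rule inj_onI)
    fix f f' assume *: "f \<in> B" "f' \<in> B" "v f = v f'"
    obtain r r' where r: "f = eta_quotient p r" "eta_quotient p r \<in> R_space k p"
       "f' = eta_quotient p r'" "eta_quotient p r' \<in> R_space k p" using * by (auto simp: B_def)
    note 1 = prime_level_eta_quotient_order[OF p r(2) v[OF *(1), unfolded r(1)]]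
      and 2 = prime_level_eta_quotient_order[OF p r(4) v[OF *(2), unfolded r(3)]]
    have "(int p - 1) * r p = (int p - 1) * r' p" using 1 2 *(3) unfolding r(1,3) by (simp add: algebra_simps)
    hence "r p = r' p" using p0 by simp
    moreover from this have "r 1 = r' 1" using 1(1) 2(1) by simp
    ultimately show "f = f'" unfolding r(1,3)
      by (auto simp: eta_quotient_def fun_eq_iff divisors_prime[OF p] intro!: prod.cong)
  qed
  have "n \<in> v ` B" by (rule span_has_order[OF v inj]) (use e in \<open>auto simp: E_space_def B_def\<close>)
  then obtain f where f: "f \<in> B" "n = v f" by blast
  obtain r where r: "f = eta_quotient p r" "eta_quotient p r \<in> R_space k p" using f(1) by (auto simp: B_def)
  note 1 = prime_level_eta_quotient_order[OF p r(2) v[OF f(1), unfolded r(1)]]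
  have "24 * n - 2 * k = (int p - 1) * r p" using 1 f(2) unfolding r(1) by (simp add: algebra_simps)
  thus ?thesis by simp
qed

text \<open>
  If finitely many functions spanned \<open>R_space k N\<close> modulo \<open>E_space k N\<close>, then some nontrivial
  combination of the \<open>f i\<close> would lie in \<open>E_space k N\<close>, and its order is one of the \<open>v i\<close>.
\<close>

lemma infinite_codimension_of_orders:
  fixes f :: "nat \<Rightarrow> complex \<Rightarrow> complex"
  assumes f: "\<And>i. f i \<in> R_space k N" "\<And>i. has_order (f i) (v i)" and inj: "inj v"
    and avoid: "\<And>e i. e \<in> E_space k N \<Longrightarrow> \<not> has_order e (v i)"
  shows "\<not> finite_codimension_in (E_space k N) (R_space k N)"
proof
  let ?V = "R_space k N" and ?U = "E_space k N"
  assume "finite_codimension_in ?U ?V"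
  then obtain B where B: "finite B" "quotient_space ?V ?U = (\<lambda>f. f +o ?U) ` fun_space.span B"
    unfolding finite_codimension_in_def by blast
  note U = subspace_E_space[of k N]
  have "\<exists>b. b \<in> fun_space.span B \<and> f i - b \<in> ?U" for i
  proof -
    have "f i +o ?U \<in> quotient_space ?V ?U" using f(1) by (auto simp: quotient_space_def)
    then obtain b where b: "b \<in> fun_space.span B" "f i +o ?U = b +o ?U" unfolding B(2) by auto
    have "f i + 0 \<in> f i +o ?U" using fun_space.subspace_0[OF U] by (auto simp: elt_set_plus_def)
    then obtain u where "u \<in> ?U" "f i = b + u" unfolding b(2) by (auto simp: elt_set_plus_def)
    hence "f i - b \<in> ?U" by simp
    thus ?thesis using b(1) by blast
  qed
  then obtain b where b: "\<And>i. b i \<in> fun_space.span B" "\<And>i. f i - b i \<in> ?U" by metis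
  \<comment> \<open>If a combination of the \<open>b i\<close> vanishes, the same combination of the \<open>f i\<close> lies in \<open>?U\<close>.\<close>
  have key: "c = (\<lambda>_. 0)" if c: "finite I" "(\<Sum>i\<in>I. fun_scale (c i) (b i)) = 0" "\<And>i. i \<notin> I \<Longrightarrow> c i = 0" for I c
  proof (rule ccontr)
    assume ne: "c \<noteq> (\<lambda>_. 0)"
    define g where "g = (\<Sum>i\<in>I. fun_scale (c i) (f i))"
    have "g = (\<Sum>i\<in>I. fun_scale (c i) (f i - b i)) + (\<Sum>i\<in>I. fun_scale (c i) (b i))"
      unfolding g_def sum.distrib[symmetric] by (intro sum.cong refl) (simp add: fun_scale_def fun_eq_iff algebra_simps)
    hence "g = (\<Sum>i\<in>I. fun_scale (c i) (f i - b i))" using c(2) by simp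
    hence gU: "g \<in> ?U" using b(2) by (auto intro!: fun_space.subspace_sum[OF U] fun_space.subspace_scale[OF U])
    define I' where "I' = {i \<in> I. c i \<noteq> 0}"
    have I': "finite I'" "I' \<noteq> {}" using c ne by (auto simp: I'_def fun_eq_iff)
    have "g z = (\<Sum>i\<in>I. c i * f i z)" for z unfolding g_def by (rule sum_fun_scale_apply)
    also have "(\<Sum>i\<in>I. c i * f i z) = (\<Sum>i\<in>I'. c i * f i z)" for z
      unfolding I'_def by (rule sum.mono_neutral_right) (use c(1) in auto)
    finally have gz: "g = (\<lambda>z. \<Sum>i\<in>I'. c i * f i z)" by (simp add: fun_eq_iff)
    obtain i where "has_order g (v i)" unfolding gz
      by (rule combination_has_order[OF I', of c f v]) (use f(2) inj in \<open>auto simp: I'_def intro: inj_on_subset\<close>)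
    thus False using avoid[OF gU] by blast
  qed
  have injb: "inj b"
  proof (rule injI, rule ccontr)
    fix i j assume ij: "b i = b j" "i \<noteq> j"
    define c where "c = (\<lambda>l. if l = i then 1 else if l = j then - 1 else (0::complex))"
    have "(\<Sum>l\<in>{i, j}. fun_scale (c l) (b l)) = 0" using ij by (simp add: c_def fun_scale_def fun_eq_iff)
    from key[OF _ this] have "c = (\<lambda>_. 0)" by (auto simp: c_def)
    from fun_cong[OF this, of i] show False by (simp add: c_def)
  qed
  have "fun_space.independent (range b)"
    unfolding fun_space.independent_explicit_module
  proof (intro allI impI)
    fix T c x assume T: "finite T" "T \<subseteq> range b" "(\<Sum>y\<in>T. fun_scale (c y) y) = 0" "x \<in> T"
    define I where "I = b -` T"
    have bI: "b ` I = T" using T(2) by (auto simp: I_def)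
    have finI: "finite I" unfolding I_def by (rule finite_vimageI[OF T(1) injb])
    define c' where "c' = (\<lambda>i. if i \<in> I then c (b i) else 0)"
    have "(\<Sum>i\<in>I. fun_scale (c' i) (b i)) = (\<Sum>i\<in>I. fun_scale (c (b i)) (b i))" by (intro sum.cong) (auto simp: c'_def)
    also have "\<dots> = (\<Sum>y\<in>T. fun_scale (c y) y)"
      unfolding bI[symmetric] by (subst sum.reindex) (use injb in \<open>auto intro: inj_on_subset\<close>)
    finally have c0: "c' = (\<lambda>_. 0)" using key[OF finI, of c'] T(3) by (simp add: c'_def)
    obtain i where "i \<in> I" "x = b i" using T(4) bI by blast
    thus "c x = 0" using fun_cong[OF c0, of i] by (simp add: c'_def)
  qed
  moreover have "range b \<subseteq> fun_space.span B" using b(1) by blast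
  ultimately have "finite (range b)" using fun_space.independent_span_bound[OF B(1)] by blast
  thus False using finite_imageD[OF _ injb] by simp
qed

text \<open>
  Let \<open>t = \<Delta>(z) / \<Delta>(p z)\<close> with \<open>\<Delta> = \<eta>\<^bsup>24\<^esup>\<close>, let \<open>h\<close> be its logarithmic derivative, of weight \<open>2\<close>
  and order \<open>0\<close>, and let \<open>x = \<Delta>(z) / \<Delta>(p z)\<^sup>2\<close>, of weight \<open>-12\<close>. The functions \<open>h\<^sup>l t\<^sup>i\<close> and \<open>h\<^bsup>l
  + 6\<^esup> t\<^sup>i x\<close> with \<open>k = 2 l\<close> have weight \<open>k\<close> and orders \<open>n\<close> divisible by \<open>p - 1\<close> in the first case
  and congruent to \<open>-1\<close> in the second. By \<open>prime_level_E_space_order\<close> such an order occurs in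
  \<open>E_space k p\<close> only if \<open>p - 1\<close> divides \<open>2 k\<close> or \<open>2 k + 24\<close> respectively. Both hold only if \<open>p -
  1\<close> divides \<open>24\<close>, which leaves \<open>2\<close>, \<open>3\<close>, \<open>5\<close>, \<open>7\<close> and \<open>13\<close> among the primes.
\<close>

theorem infinite_codimension:
  assumes p: "prime p" "p = 11 \<or> p \<ge> 17" and k: "0 \<le> k" "even k"
  shows "\<not> finite_codimension_in (E_space k p) (R_space k p)"
proof -
  have p0: "p > 0" "p > 1" using prime_gt_1_nat[OF p(1)] by auto
  have nd: "\<not> int p - 1 dvd 24"
  proof
    assume d: "int p - 1 dvd 24"
    hence "int p - 1 \<le> 24" by (rule zdvd_imp_le) simp
    hence "p \<in> {11, 17, 18, 19, 20, 21, 22, 23, 24, 25}" using p(2) by auto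
    moreover have "p \<noteq> 25"
    proof
      assume "p = 25"
      hence "5 dvd p" by simp
      hence "(5::nat) = 1 \<or> 5 = p" using p(1) unfolding prime_nat_iff by blast
      thus False using \<open>p = 25\<close> by simp
    qed
    ultimately show False using d by auto
  qed
  define t where "t = eta_quotient p (\<lambda>\<delta>. 2 * (if \<delta> = 1 then 12 else - 12))"
  define x where "x = eta_quotient p (\<lambda>\<delta>. 2 * (if \<delta> = 1 then 12 else - 24))"
  have cop: "gcd (int p) c = 1" if "\<not> int p dvd c" for c
    using prime_imp_coprime[of "int p" c] p(1) that by simp
  have t_R: "t \<in> R_space 0 p" unfolding t_def
  proof (rule eta_quotient_in_R_space[OF p0(1) _ trivial_multiplier_12])
    show "cusp_sum p (\<lambda>\<delta>. if \<delta> = 1 then 12 else - 12) c \<ge> 0" if "\<not> int p dvd c" for c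
      unfolding cusp_sum_def sum_divisors_prime[OF p(1)] using cop[OF that] p0 by (simp add: field_simps)
  qed (use p0 in \<open>auto simp: sum_divisors_prime[OF p(1)]\<close>)
  have x_R: "x \<in> R_space (- 12) p" unfolding x_def
  proof (rule eta_quotient_in_R_space[OF p0(1) _ trivial_multiplier_12])
    show "cusp_sum p (\<lambda>\<delta>. if \<delta> = 1 then 12 else - 24) c \<ge> 0" if "\<not> int p dvd c" for c
      unfolding cusp_sum_def sum_divisors_prime[OF p(1)] using cop[OF that] p0 by (simp add: field_simps)
  qed (use p0 in \<open>auto simp: sum_divisors_prime[OF p(1)]\<close>)
  have t_sum: "(\<Sum>\<delta> | \<delta> dvd p. int \<delta> * (2 * (if \<delta> = 1 then 12 else - 12))) = 24 * (1 - int p)"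
    using p0 by (simp add: sum_divisors_prime[OF p(1)])
  have t_ord: "has_order t (1 - int p)" unfolding t_def by (rule eta_quotient_has_order[OF p0(1) t_sum])
  have x_ord: "has_order x (1 - 2 * int p)" unfolding x_def
    by (rule eta_quotient_has_order[OF p0(1)]) (use p0 in \<open>simp add: sum_divisors_prime[OF p(1)]\<close>)
  have t_nz: "t z \<noteq> 0" if "z \<in> uhp" for z unfolding t_def by (rule eta_quotient_nonzero[OF p0(1) that])
  define h where "h = log_derivative t"
  have h_R: "h \<in> R_space 2 p" unfolding h_def by (rule log_derivative_in_R_space[OF p0(1) t_R t_nz])
  have h_ord: "has_order h 0"
  proof -
    define \<Phi> where "\<Phi> = euler_quot p (\<lambda>\<delta>. 2 * (if \<delta> = 1 then 12 else - 12))"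
    have "\<Phi> holomorphic_on ball 0 1"
      unfolding \<Phi>_def euler_quot_def [abs_def]
    proof (rule holomorphic_on_prod)
      fix \<delta> assume "\<delta> \<in> {\<delta>. \<delta> dvd p}"
      hence "\<delta> > 0" using p0 by (auto intro!: Nat.gr0I)
      hence w: "norm (w ^ \<delta>) < 1" if "norm w < 1" for w :: complex
        using that by (simp add: norm_power power_less_one_iff)
      have "(euler_prod \<circ> (\<lambda>w. w ^ \<delta>)) holomorphic_on ball 0 1"
        by (rule holomorphic_on_compose_gen[OF _ holomorphic_euler_prod]) (use w in \<open>auto intro!: holomorphic_intros\<close>)
      moreover have "euler_prod (w ^ \<delta>) \<noteq> 0" if "norm w < 1" for w using euler_prod_nonzero w that by blast
      ultimately show "(\<lambda>w. euler_prod (w ^ \<delta>) powi (2 * (if \<delta> = 1 then 12 else - 12))) holomorphic_on ball 0 1"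
        by (intro holomorphic_on_power_int) (auto simp: o_def)
    qed
    moreover have "\<Phi> 0 \<noteq> 0" by (simp add: \<Phi>_def p0)
    moreover have "eventually (\<lambda>z. t z = \<Phi> (nome (z / of_nat 1)) * nome (z / of_nat 1) powi (1 - int p)) ii_inf"
      using eventually_uhp
    proof eventually_elim
      case (elim z)
      have "t z * nome z powi (- (1 - int p)) = \<Phi> (nome z)"
        unfolding t_def \<Phi>_def by (rule eta_quotient_normalized[OF p0(1) elim t_sum])
      moreover have "nome z powi (- (1 - int p)) * nome z powi (1 - int p) = 1" by (simp flip: power_int_add)
      ultimately show ?case by (metis div_by_1 mult.assoc mult.right_neutral of_nat_1)
    qed
    ultimately have lim: "((\<lambda>z. deriv t z / t z) \<longlongrightarrow> 2 * of_real pi * \<i> / of_nat 1 * of_int (1 - int p)) ii_inf"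
      by (intro logderiv_limit[of 1 1 \<Phi>]) auto
    have "eventually (\<lambda>z. deriv t z / t z = h z * nome z powi (- 0)) ii_inf"
      using eventually_uhp by eventually_elim (simp add: h_def log_derivative_def)
    with lim have "((\<lambda>z. h z * nome z powi (- 0)) \<longlongrightarrow> 2 * of_real pi * \<i> / of_nat 1 * of_int (1 - int p)) ii_inf"
      by (rule Lim_transform_eventually)
    moreover have "2 * of_real pi * \<i> / of_nat 1 * of_int (1 - int p) \<noteq> (0 :: complex)"
    proof -
      have "(of_int (1 - int p) :: complex) \<noteq> 0" using p0 by (simp only: of_int_eq_0_iff)
      thus ?thesis by simp
    qed
    ultimately show ?thesis unfolding has_order_def by blast
  qed
  define pw where "pw = (\<lambda>f n z. if z \<in> uhp then f z ^ n else (0::complex))"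
  obtain l where l: "k = 2 * int l" using k by (metis evenE nonneg_int_cases zero_le_mult_iff zero_less_numeral not_less)
  have R: "(\<lambda>z. pw h l z * pw t i z) \<in> R_space k p" for i
    using R_space_mult[OF R_space_power[OF p0(1) h_R, of l] R_space_power[OF p0(1) t_R, of i]] by (simp add: pw_def l mult.commute)
  have O: "has_order (\<lambda>z. pw h l z * pw t i z) (int i * (1 - int p))" for i
    using has_order_mult[OF has_order_uhp_power[OF h_ord, of l] has_order_uhp_power[OF t_ord, of i]] by (simp add: pw_def)
  have R': "(\<lambda>z. (pw h (l + 6) z * pw t i z) * x z) \<in> R_space k p" for i
    using R_space_mult[OF R_space_mult[OF R_space_power[OF p0(1) h_R, of "l + 6"] R_space_power[OF p0(1) t_R, of i]] x_R]
    by (simp add: pw_def l algebra_simps)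
  have O': "has_order (\<lambda>z. (pw h (l + 6) z * pw t i z) * x z) (int i * (1 - int p) + (1 - 2 * int p))" for i
    using has_order_mult[OF has_order_mult[OF has_order_uhp_power[OF h_ord, of "l + 6"] has_order_uhp_power[OF t_ord, of i]] x_ord]
    by (simp add: pw_def)
  have inj: "inj (\<lambda>i. int i * (1 - int p) + y)" for y using p0 by (auto simp: inj_def)
  show ?thesis
  proof (cases "int p - 1 dvd 2 * k")
    case False
    show ?thesis
    proof (rule infinite_codimension_of_orders[OF R O])
      show "inj (\<lambda>i. int i * (1 - int p))" using inj[of 0] by simp
      fix e i assume e: "e \<in> E_space k p"
      show "\<not> has_order e (int i * (1 - int p))"
      proof
        assume "has_order e (int i * (1 - int p))"
        from prime_level_E_space_order[OF p(1) e this] have "int p - 1 dvd 24 * (int i * (1 - int p)) - 2 * k" .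
        moreover have "24 * (int i * (1 - int p)) = (int p - 1) * (- 24 * int i)" by (simp add: algebra_simps)
        ultimately have "int p - 1 dvd 2 * k" by (metis dvd_diff_right_iff dvd_triv_left)
        thus False using False by contradiction
      qed
    qed
  next
    case True
    show ?thesis
    proof (rule infinite_codimension_of_orders[OF R' O' inj])
      fix e i assume e: "e \<in> E_space k p"
      show "\<not> has_order e (int i * (1 - int p) + (1 - 2 * int p))"
      proof
        assume "has_order e (int i * (1 - int p) + (1 - 2 * int p))"
        from prime_level_E_space_order[OF p(1) e this]
        have 1: "int p - 1 dvd 24 * (int i * (1 - int p) + (1 - 2 * int p)) - 2 * k" .
        have eq: "24 * (int i * (1 - int p) + (1 - 2 * int p)) - 2 * k = (int p - 1) * (- 24 * int i - 48) - 2 * k - 24"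
          by (simp add: algebra_simps)
        have "int p - 1 dvd ((int p - 1) * (- 24 * int i - 48) - 2 * k) - 24" using 1 by (simp only: eq)
        moreover have "int p - 1 dvd (int p - 1) * (- 24 * int i - 48) - 2 * k" using True by (intro dvd_diff) auto
        ultimately have "int p - 1 dvd 24" by (metis dvd_diff_right_iff)
        thus False using nd by contradiction
      qed
    qed
  qed
qed

theorem theorem4:
  fixes N :: nat
  assumes "N > 0"
  shows "((N > 1 \<and> \<not> prime N) \<or> N \<in> {2, 3, 5, 7, 13} \<longrightarrow>
            (\<forall>k::int. 0 \<le> k \<and> even k \<and>
               (epsilon3 N = 0 \<or> 6 dvd k) \<and> (epsilon2 N = 0 \<or> 4 dvd k) \<longrightarrow>
               finite_codimension_in (E_space k N) (R_space k N))) \<and>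
         (prime N \<and> (N = 11 \<or> N \<ge> 17) \<longrightarrow>
            (\<forall>k::int. 0 \<le> k \<and> even k \<longrightarrow>
               \<not> finite_codimension_in (E_space k N) (R_space k N)))"
  using finite_codimension infinite_codimension by blast

end
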